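(* Let $(M,g)$ be an asymptotically flat 3-manifold satisfying the RT condition at a decay rate $q>1/2$, with mass $m\neq0$ and center of mass $C=(C^1,C^2,C^3)$. Fix $p\in\mathbb{R}^3$, let $S_R(p)=\{x:|x-p|=R\}$ be the coordinate sphere, and let $H_S$ be its mean curvature with respect to $g$. Then for $l=1,2,3$, as $R\to\infty$, $$\int_{S_R(p)}(x^l-p^l)\Big(H_S-\frac2R\Big)\,d\sigma_0=8\pi m\,(p^l-C^l)+O(R^{1-2q}).$$
   Context: $(M,g)$ is a Riemannian 3-manifold with a coordinate system $\{x\}=\{(x^1,x^2,x^3)\}$ identifying the complement of a compact set $B_{R_0}$ with the exterior of a ball in $\mathbb{R}^3$. For a function $f$ defined outside $B_{R_0}$, $f^{\mathrm{odd}}(x)=(f(x)-f(-x))/2$, applied to tensors componentwise. $(M,g)$ is asymptotically flat at decay rate $q>1/2$ if $g_{ij}(x)=\delta_{ij}+O(|x|^{-q})$, with corresponding decay of derivatives ($\partial^\alpha(g_{ij}-\delta_{ij})=O(|x|^{-q-|\alpha|})$), and the scalar curvature satisfies $R_g=O(|x|^{-2-2q})$. It satisfies the RT (Regge–Teitelboim) condition if moreover $g_{ij}^{\mathrm{odd}}=O(|x|^{-1-q})$, with corresponding decay of derivatives ($\partial^\alpha (g_{ij}^{\mathrm{odd}})=O(|x|^{-1-q-|\alpha|})$), and $R_g^{\mathrm{odd}}=O(|x|^{-3-2q})$. $d\sigma_0$ is the Euclidean area element, commas denote coordinate derivatives, and $$m=\frac1{16\pi}\lim_{r\to\infty}\int_{|x|=r}\sum_{i,j}(g_{ij,i}-g_{ii,j})\frac{x^j}{r}\,d\sigma_0,$$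 $$C^l=\frac1{16\pi m}\lim_{r\to\infty}\Big[\int_{|x|=r}x^l\sum_{i,j}(g_{ij,i}-g_{ii,j})\frac{x^j}{r}\,d\sigma_0-\int_{|x|=r}\sum_i\Big(g_{il}\frac{x^i}{r}-g_{ii}\frac{x^l}{r}\Big)d\sigma_0\Big].$$ The mean curvature is $H_S=\mathrm{div}_g(\nu_g)$, with $\nu_g$ the outward unit normal with respect to $g$ (so it equals $2/R$ for $g=\delta$). *)

theory Defs
  imports "HOL-Analysis.Analysis" "HOL-Library.Landau_Symbols"
begin

section \<open>Partial derivatives and smoothness\<close>

definition pdiff :: "3 \<Rightarrow> (real^3 \<Rightarrow> real) \<Rightarrow> real^3 \<Rightarrow> real" where
  "pdiff i f x = deriv (\<lambda>t. f (x + t *\<^sub>R axis i 1)) 0"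

text \<open>A multi-index \<open>\<alpha>\<close> is represented by the list of its directions, so \<open>|\<alpha>|\<close> is its length.\<close>

primrec pdiffs :: "3 list \<Rightarrow> (real^3 \<Rightarrow> real) \<Rightarrow> real^3 \<Rightarrow> real" where
  "pdiffs [] f = f"
| "pdiffs (i # \<alpha>) f = pdiff i (pdiffs \<alpha> f)"

text \<open>For open \<open>U\<close> this is \<open>C\<^sup>\<infinity>\<close>: every iterated partial derivative is (Frechet) differentiable,
  hence exists and is continuous.  Only the values of \<open>f\<close> on \<open>U\<close> matter.\<close>

definition smooth_fun_on :: "(real^3) set \<Rightarrow> (real^3 \<Rightarrow> real) \<Rightarrow> bool" where
  "smooth_fun_on U f \<longleftrightarrow> (\<forall>\<alpha>. pdiffs \<alpha> f differentiable_on U)"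


section \<open>Riemannian 3-manifolds\<close>

type_synonym 'a chart = "'a set \<times> ('a \<Rightarrow> real^3)"

definition transition :: "'a chart \<Rightarrow> 'a chart \<Rightarrow> real^3 \<Rightarrow> real^3" where
  "transition c d y = snd d (inv_into (fst c) (snd c) y)"

definition jacobian_matrix :: "(real^3 \<Rightarrow> real^3) \<Rightarrow> real^3 \<Rightarrow> real^3^3" where
  "jacobian_matrix f y = (\<chi> k i. pdiff i (\<lambda>z. f z $ k) y)"

definition smooth_3manifold :: "'a topology \<Rightarrow> 'a chart set \<Rightarrow> bool" where
  "smooth_3manifold M A \<longleftrightarrow>
     Hausdorff_space M \<and> second_countable M \<and>
     (\<Union>c\<in>A. fst c) = topspace M \<and>
     (\<forall>c\<in>A. openin M (fst c) \<and> open (snd c ` fst c) \<and>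
        homeomorphic_map (subtopology M (fst c)) (top_of_set (snd c ` fst c)) (snd c)) \<and>
     (\<forall>c\<in>A. \<forall>d\<in>A. \<forall>k.
        smooth_fun_on (snd c ` (fst c \<inter> fst d)) (\<lambda>y. transition c d y $ k))"

text \<open>A metric is given by its component matrices \<open>g c y = (g\<^sub>i\<^sub>j(y))\<close> in the coordinates of each
  chart \<open>c\<close>; these are related by the transformation law of a covariant 2-tensor.\<close>

definition riemannian_3manifold ::
    "'a topology \<Rightarrow> 'a chart set \<Rightarrow> ('a chart \<Rightarrow> real^3 \<Rightarrow> real^3^3) \<Rightarrow> bool" where
  "riemannian_3manifold M A g \<longleftrightarrow>
     smooth_3manifold M A \<and>
     (\<forall>c\<in>A. \<forall>i j. smooth_fun_on (snd c ` fst c) (\<lambda>y. g c y $ i $ j)) \<and>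
     (\<forall>c\<in>A. \<forall>y \<in> snd c ` fst c.
        transpose (g c y) = g c y \<and> (\<forall>v. v \<noteq> 0 \<longrightarrow> v \<bullet> (g c y *v v) > 0)) \<and>
     (\<forall>c\<in>A. \<forall>d\<in>A. \<forall>y \<in> snd c ` (fst c \<inter> fst d).
        g c y = transpose (jacobian_matrix (transition c d) y) ** g d (transition c d y)
                  ** jacobian_matrix (transition c d) y)"

definition exterior_chart :: "'a topology \<Rightarrow> 'a chart set \<Rightarrow> 'a chart \<Rightarrow> real \<Rightarrow> bool" where
  "exterior_chart M A c R\<^sub>0 \<longleftrightarrow>
     c \<in> A \<and> R\<^sub>0 > 0 \<and> compactin M (topspace M - fst c) \<and> snd c ` fst c = {x. norm x > R\<^sub>0}"


section \<open>Curvature in coordinates\<close>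

definition metric_inv :: "(real^3 \<Rightarrow> real^3^3) \<Rightarrow> real^3 \<Rightarrow> real^3^3" where
  "metric_inv g x = matrix_inv (g x)"

text \<open>\<open>christoffel g k i j\<close> is \<open>\<Gamma>\<^sup>k\<^sub>i\<^sub>j\<close>.\<close>

definition christoffel :: "(real^3 \<Rightarrow> real^3^3) \<Rightarrow> 3 \<Rightarrow> 3 \<Rightarrow> 3 \<Rightarrow> real^3 \<Rightarrow> real" where
  "christoffel g k i j x =
     (\<Sum>l\<in>UNIV. metric_inv g x $ k $ l *
        (pdiff i (\<lambda>y. g y $ j $ l) x + pdiff j (\<lambda>y. g y $ i $ l) x
          - pdiff l (\<lambda>y. g y $ i $ j) x)) / 2"

definition ricci :: "(real^3 \<Rightarrow> real^3^3) \<Rightarrow> 3 \<Rightarrow> 3 \<Rightarrow> real^3 \<Rightarrow> real" where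
  "ricci g j k x =
     (\<Sum>i\<in>UNIV. pdiff i (christoffel g i j k) x - pdiff k (christoffel g i j i) x
       + (\<Sum>s\<in>UNIV. christoffel g i i s x * christoffel g s j k x
                  - christoffel g i k s x * christoffel g s j i x))"

definition scalar_curv :: "(real^3 \<Rightarrow> real^3^3) \<Rightarrow> real^3 \<Rightarrow> real" where
  "scalar_curv g x = (\<Sum>j\<in>UNIV. \<Sum>k\<in>UNIV. metric_inv g x $ j $ k * ricci g j k x)"

text \<open>\<open>div\<^sub>g V = \<nabla>\<^sub>i V\<^sup>i\<close>.\<close>

definition divergence :: "(real^3 \<Rightarrow> real^3^3) \<Rightarrow> (real^3 \<Rightarrow> real^3) \<Rightarrow> real^3 \<Rightarrow> real" where
  "divergence g V x =
     (\<Sum>i\<in>UNIV. pdiff i (\<lambda>y. V y $ i) x + (\<Sum>j\<in>UNIV. christoffel g i i j x * V x $ j))"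

text \<open>At \<open>x\<close> this is the outward \<open>g\<close>-unit normal to the coordinate sphere about \<open>p\<close> through \<open>x\<close>,
  i.e. the \<open>g\<close>-gradient of \<open>|x - p|\<close>, normalised in \<open>g\<close>.  Being a unit field near each sphere,
  its full divergence along the sphere is the mean curvature.\<close>

definition unit_normal :: "(real^3 \<Rightarrow> real^3^3) \<Rightarrow> real^3 \<Rightarrow> real^3 \<Rightarrow> real^3" where
  "unit_normal g p x =
     (1 / sqrt ((x - p) \<bullet> (metric_inv g x *v (x - p)))) *\<^sub>R (metric_inv g x *v (x - p))"

lemma unit_normal_characterization:
  fixes g :: "real^3 \<Rightarrow> real^3^3"
  assumes sym: "transpose (g x) = g x"
    and pos: "\<And>v. v \<noteq> 0 \<Longrightarrow> v \<bullet> (g x *v v) > 0"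
    and "x \<noteq> p"
  shows "unit_normal g p x \<bullet> (g x *v unit_normal g p x) = 1"
    and "\<And>v. v \<bullet> (x - p) = 0 \<Longrightarrow> v \<bullet> (g x *v unit_normal g p x) = 0"
    and "unit_normal g p x \<bullet> (x - p) > 0"
proof -
  define w where "w = metric_inv g x *v (x - p)"
  have "inj ((*v) (g x))"
  proof (rule injI)
    fix a b assume "g x *v a = g x *v b"
    then have "g x *v (a - b) = 0" by (simp add: matrix_vector_mult_diff_distrib)
    then have "(a - b) \<bullet> (g x *v (a - b)) = 0" by simp
    then show "a = b" using pos[of "a - b"] by auto
  qed
  then have "invertible (g x)"
    using invertible_left_inverse matrix_left_invertible_injective by blast
  then have "g x ** matrix_inv (g x) = mat 1"
    unfolding invertible_def matrix_inv_def by (rule someI2_ex) simp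
  then have gw: "g x *v w = x - p"
    by (simp add: w_def metric_inv_def matrix_vector_mul_assoc)
  then have "w \<noteq> 0" using \<open>x \<noteq> p\<close> by auto
  then have wpos: "(x - p) \<bullet> w > 0" using pos[of w] gw by (simp add: inner_commute)
  have nu: "unit_normal g p x = (1 / sqrt ((x - p) \<bullet> w)) *\<^sub>R w"
    by (simp add: unit_normal_def w_def)
  have gnu: "g x *v unit_normal g p x = (1 / sqrt ((x - p) \<bullet> w)) *\<^sub>R (x - p)"
    by (simp add: nu matrix_vector_mult_scaleR gw)
  show "unit_normal g p x \<bullet> (g x *v unit_normal g p x) = 1"
    unfolding gnu using wpos
    by (simp add: nu inner_commute[of w] real_div_sqrt del: scaleR_right_diff_distrib inner_diff_left inner_diff_right)
  show "v \<bullet> (g x *v unit_normal g p x) = 0" if "v \<bullet> (x - p) = 0" for v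
    unfolding gnu using that by simp
  show "unit_normal g p x \<bullet> (x - p) > 0"
    using wpos by (simp add: nu inner_commute)
qed

definition mean_curv :: "(real^3 \<Rightarrow> real^3^3) \<Rightarrow> real^3 \<Rightarrow> real^3 \<Rightarrow> real" where
  "mean_curv g p x = divergence g (unit_normal g p) x"

lemma mean_curv_euclidean:
  assumes "norm (x - p) = R" "R > 0"
  shows "mean_curv (\<lambda>_. mat 1) p x = 2 / R"
proof -
  define u where "u = x - p"
  have uu: "u \<bullet> u = R\<^sup>2" using assms by (simp add: u_def dot_square_norm)
  have "mat 1 ** matrix_inv (mat 1 :: real^3^3) = mat 1"
    unfolding matrix_inv_def by (rule someI2[where a = "mat 1"]) auto
  then have inv1: "matrix_inv (mat 1 :: real^3^3) = mat 1" by simp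
  have chr: "christoffel (\<lambda>_. mat 1) k i j y = 0" for k i j y
    by (simp add: christoffel_def pdiff_def)
  have un: "unit_normal (\<lambda>_. mat 1) p y = (1 / sqrt ((y - p) \<bullet> (y - p))) *\<^sub>R (y - p)" for y
    by (simp add: unit_normal_def metric_inv_def inv1)
  have pd: "pdiff i (\<lambda>y. unit_normal (\<lambda>_. mat 1) p y $ i) x = 1 / R - (u $ i)\<^sup>2 / R ^ 3" for i
  proof -
    have "(x + t *\<^sub>R axis i 1 - p) \<bullet> (x + t *\<^sub>R axis i 1 - p) = R\<^sup>2 + 2 * t * u $ i + t\<^sup>2" for t
    proof -
      have "x + t *\<^sub>R axis i 1 - p = u + t *\<^sub>R axis i 1" by (simp add: u_def)
      then show ?thesis
        by (simp only:) (simp add: inner_add_left inner_add_right uu inner_axis inner_axis' power2_eq_square algebra_simps)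
    qed
    then have eq: "unit_normal (\<lambda>_. mat 1) p (x + t *\<^sub>R axis i 1) $ i
        = (u $ i + t) / sqrt (R\<^sup>2 + 2 * t * u $ i + t\<^sup>2)" for t
      by (simp add: un u_def)
    have "((\<lambda>t. (u $ i + t) / sqrt (R\<^sup>2 + 2 * t * u $ i + t\<^sup>2))
        has_real_derivative (1 / R - (u $ i)\<^sup>2 / R ^ 3)) (at 0)"
      using \<open>R > 0\<close>
      by (auto intro!: derivative_eq_intros simp: field_simps power2_eq_square power3_eq_cube)
    then show ?thesis unfolding pdiff_def eq by (rule DERIV_imp_deriv)
  qed
  have "(\<Sum>i\<in>UNIV. (u $ i)\<^sup>2) = R\<^sup>2"
    using uu by (simp add: inner_vec_def power2_eq_square)
  then have "(\<Sum>i\<in>(UNIV :: 3 set). 1 / R - (u $ i)\<^sup>2 / R ^ 3) = 3 / R - R\<^sup>2 / R ^ 3"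
    by (simp add: sum_subtractf flip: sum_divide_distrib)
  then show ?thesis
    using \<open>R > 0\<close>
    by (simp add: mean_curv_def divergence_def chr pd power2_eq_square power3_eq_cube field_simps)
qed


section \<open>Asymptotic conditions\<close>

definition odd_part :: "(real^3 \<Rightarrow> real) \<Rightarrow> real^3 \<Rightarrow> real" where
  "odd_part f x = (f x - f (- x)) / 2"

definition asymptotically_flat :: "(real^3 \<Rightarrow> real^3^3) \<Rightarrow> real \<Rightarrow> bool" where
  "asymptotically_flat g q \<longleftrightarrow>
     (\<forall>i j \<alpha>. pdiffs \<alpha> (\<lambda>x. g x $ i $ j - mat 1 $ i $ j)
        \<in> O[at_infinity](\<lambda>x. norm x powr (- q - real (length \<alpha>)))) \<and>
     scalar_curv g \<in> O[at_infinity](\<lambda>x. norm x powr (- 2 - 2 * q))"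

definition regge_teitelboim :: "(real^3 \<Rightarrow> real^3^3) \<Rightarrow> real \<Rightarrow> bool" where
  "regge_teitelboim g q \<longleftrightarrow>
     (\<forall>i j \<alpha>. pdiffs \<alpha> (odd_part (\<lambda>x. g x $ i $ j))
        \<in> O[at_infinity](\<lambda>x. norm x powr (- 1 - q - real (length \<alpha>)))) \<and>
     odd_part (scalar_curv g) \<in> O[at_infinity](\<lambda>x. norm x powr (- 3 - 2 * q))"


section \<open>Mass and center of mass\<close>

definition sphere_point :: "real \<times> real \<Rightarrow> real^3" where
  "sphere_point = (\<lambda>(\<theta>, \<phi>). vector [sin \<theta> * cos \<phi>, sin \<theta> * sin \<phi>, cos \<theta>])"

text \<open>The integral of \<open>f\<close> over the coordinate sphere of radius \<open>r\<close> about \<open>p\<close> with respect to the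
  Euclidean area element \<open>r\<^sup>2 sin \<theta> d\<theta> d\<phi>\<close>.\<close>

definition sphere_integral :: "real^3 \<Rightarrow> real \<Rightarrow> (real^3 \<Rightarrow> real) \<Rightarrow> real" where
  "sphere_integral p r f =
     integral ({0..pi} \<times> {0..2 * pi})
       (\<lambda>(\<theta>, \<phi>). f (p + r *\<^sub>R sphere_point (\<theta>, \<phi>)) * (r\<^sup>2 * sin \<theta>))"

definition mass_density :: "(real^3 \<Rightarrow> real^3^3) \<Rightarrow> real \<Rightarrow> real^3 \<Rightarrow> real" where
  "mass_density g r x =
     (\<Sum>i\<in>UNIV. \<Sum>j\<in>UNIV.
        (pdiff i (\<lambda>y. g y $ i $ j) x - pdiff j (\<lambda>y. g y $ i $ i) x) * (x $ j / r))"

definition mass :: "(real^3 \<Rightarrow> real^3^3) \<Rightarrow> real" where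
  "mass g = 1 / (16 * pi) * Lim at_top (\<lambda>r. sphere_integral 0 r (mass_density g r))"

definition center_of_mass :: "(real^3 \<Rightarrow> real^3^3) \<Rightarrow> real^3" where
  "center_of_mass g = (\<chi> l. 1 / (16 * pi * mass g) *
     Lim at_top (\<lambda>r.
       sphere_integral 0 r (\<lambda>x. x $ l * mass_density g r x)
       - sphere_integral 0 r (\<lambda>x. \<Sum>i\<in>UNIV. g x $ i $ l * (x $ i / r) - g x $ i $ i * (x $ l / r))))"

end

theory Submission
  imports Defs
begin

text \<open>
  Write \<open>g = \<delta> + h\<close>.  All error terms are tracked together with their parity under \<open>x \<mapsto> -x\<close>: the
  perturbation \<open>h\<close> is even up to one order of decay, its first derivatives odd, and so on, so
  that a quadratic error integrated against the odd function \<open>x\<^sup>l - p\<^sup>l\<close> gains one order by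
  antipodal cancellation.  Translating by \<open>p\<close> also costs only one order, so parity may be taken
  about \<open>p\<close>.

  Modulo such errors, \<open>H - 2/R\<close> is linear in \<open>h\<close> and \<open>\<partial>h\<close>.  Integrating by parts on the sphere, its
  moment is exactly \<open>-1/2\<close> times the flux through \<open>S\<^sub>R(p)\<close> of \<open>X - p\<^sup>l Y\<close>, where
  \<open>Y\<^sub>j = h\<^sub>i\<^sub>j\<^sub>,\<^sub>i - h\<^sub>i\<^sub>i\<^sub>,\<^sub>j\<close> is the mass vector field and \<open>X\<^sub>j = x\<^sup>l Y\<^sub>j - h\<^sub>j\<^sub>l + \<delta>\<^sub>j\<^sub>l h\<^sub>i\<^sub>i\<close> that of the centre
  of mass.  Since \<open>div Y\<close> is the linear part of the scalar curvature and \<open>div X = x\<^sup>l div Y\<close>, the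
  decay and parity of the scalar curvature make both fluxes converge at the rate
  \<open>O(R\<^bsup>1-2q\<^esup>)\<close>, with limits independent of the centre \<open>p\<close> of the spheres.
\<close>

section \<open>Decay with parity\<close>

text \<open>Counting powers shows what parity has to achieve. The quadratic error of the mean
  curvature is O(R^(-1-2q)); the weight and the area turn it into O(R^(2-2q)), one power too much.
  Likewise the flux of X varies with the radius at the rate R^3 R^(-2-2q) = R^(1-2q), integrable
  only for q > 1; antipodal cancellation lowers this to R^(-2q), integrable for every q > 1/2.

  The centre p is handled in two ways. The mean curvature is expanded on spheres about 0 for the
  translated metric \<open>\<lambda>y. g (p + y)\<close>; the fluxes stay in the original
  coordinates and the centre is moved along s p, at a cost governed by the divergence on the spheres
  passed through.

  All integration rests on two facts read off from spherical coordinates: antipodal invariance, and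
  the divergence theorem on the sphere for a constant field times F, whose factor 2 is the mean
  curvature of the unit sphere. The dependence of fluxes on radius and centre follows by
  differentiating under the integral, so the interior of the coordinate ball is never
  touched.\<close>

lemma eventually_at_infinity_uminus:
  fixes P :: "'a::real_normed_vector \<Rightarrow> bool"
  assumes "eventually P at_infinity"
  shows "eventually (\<lambda>x. P (- x)) at_infinity"
  using assms unfolding eventually_at_infinity by (metis norm_minus_cancel)

lemma eventually_at_infinity_nhds:
  fixes P :: "'a::real_normed_vector \<Rightarrow> bool"
  assumes "eventually P at_infinity"
  shows "eventually (\<lambda>x. eventually P (nhds x)) at_infinity"
proof -
  obtain b where b: "\<And>x. b \<le> norm x \<Longrightarrow> P x"
    using assms unfolding eventually_at_infinity by blast
  have "eventually P (nhds x)" if "b + 1 \<le> norm x" for x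
  proof -
    have "open {x::'a. b < norm x}" by (intro open_Collect_less continuous_intros)
    then show ?thesis unfolding eventually_nhds using that b by (intro exI[of _ "{x. b < norm x}"]) auto
  qed
  then show ?thesis unfolding eventually_at_infinity by blast
qed

lemma filterlim_uminus_at_infinity: "filterlim (uminus :: 'a::real_normed_vector \<Rightarrow> 'a) at_infinity at_infinity"
  unfolding filterlim_iff using eventually_at_infinity_uminus by blast

text \<open>\<open>\<sigma> = 1\<close> for functions that are even to leading order and \<open>\<sigma> = -1\<close> for odd ones.  Continuity is
  part of the class so that integrability over large spheres is inherited by sums and products.\<close>

definition parity_decay :: "real \<Rightarrow> real \<Rightarrow> (real^3 \<Rightarrow> real) \<Rightarrow> bool" where
  "parity_decay \<sigma> a f \<longleftrightarrow> (\<forall>\<^sub>F x in at_infinity. isCont f x) \<and>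
     f \<in> O[at_infinity](\<lambda>x. norm x powr (- a)) \<and>
     (\<lambda>x. f x - \<sigma> * f (- x)) \<in> O[at_infinity](\<lambda>x. norm x powr (- a - 1))"

lemma par_cont: "parity_decay \<sigma> a f \<Longrightarrow> \<forall>\<^sub>F x in at_infinity. isCont f x"
  and par_bigo: "parity_decay \<sigma> a f \<Longrightarrow> f \<in> O[at_infinity](\<lambda>x. norm x powr (- a))"
  and par_parity: "parity_decay \<sigma> a f \<Longrightarrow> (\<lambda>x. f x - \<sigma> * f (- x)) \<in> O[at_infinity](\<lambda>x. norm x powr (- a - 1))"
  by (auto simp: parity_decay_def)

lemma bigo_reflect:
  fixes f :: "real^3 \<Rightarrow> real"
  assumes "f \<in> O[at_infinity](\<lambda>x. norm x powr b)"
  shows "(\<lambda>x. f (- x)) \<in> O[at_infinity](\<lambda>x. norm x powr b)"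
  using landau_o.big.compose[OF assms filterlim_uminus_at_infinity] by simp

lemma par_cong:
  assumes "\<forall>\<^sub>F x in at_infinity. f x = g x" and f: "parity_decay \<sigma> a f"
  shows "parity_decay \<sigma> a g"
proof -
  have 1: "\<forall>\<^sub>F x in at_infinity. f x - \<sigma> * f (- x) = g x - \<sigma> * g (- x)"
    using assms(1) eventually_at_infinity_uminus[OF assms(1)] by eventually_elim simp
  have "\<forall>\<^sub>F x in at_infinity. isCont g x"
    using eventually_at_infinity_nhds[OF assms(1)] par_cont[OF f]
    by eventually_elim (simp add: isCont_cong)
  then show ?thesis
    using f landau_o.big.in_cong[OF assms(1)] landau_o.big.in_cong[OF 1] unfolding parity_decay_def by blast
qed

lemma bigo_norm_powr_mono:
  fixes f :: "real^3 \<Rightarrow> real"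
  assumes "f \<in> O[at_infinity](\<lambda>x. norm x powr a)" "a \<le> b"
  shows "f \<in> O[at_infinity](\<lambda>x. norm x powr b)"
proof -
  have "(\<lambda>x::real^3. norm x powr a) \<in> O[at_infinity](\<lambda>x. norm x powr b)"
    using assms(2) by (intro bigoI[of _ 1])
      (auto simp: eventually_at_infinity intro!: exI[of _ 1] powr_mono)
  then show ?thesis using assms(1) landau_o.big_trans by blast
qed

lemma par_mono: "parity_decay \<sigma> a f \<Longrightarrow> b \<le> a \<Longrightarrow> parity_decay \<sigma> b f"
  unfolding parity_decay_def by (auto elim!: bigo_norm_powr_mono)

lemma par_weaken:
  assumes "parity_decay \<sigma> a f" "\<tau> = \<sigma>" "b \<le> a" "\<forall>\<^sub>F x in at_infinity. f x = g x"
  shows "parity_decay \<tau> b g"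
  using par_cong[OF assms(4)] par_mono[OF assms(1,3)] assms(2) by simp

text \<open>At the weaker rate both f(x) and f(-x) already fit into the parity error, so one order
  of decay buys any parity.\<close>

lemma par_flip: "parity_decay \<sigma> (a + 1) f \<Longrightarrow> parity_decay \<tau> a f"
  unfolding parity_decay_def
  by (auto intro!: sum_in_bigo landau_o.big.cmult_in_iff' elim!: bigo_norm_powr_mono simp: bigo_reflect)

lemma par_const: "parity_decay 1 0 (\<lambda>_. c)"
  by (auto simp: parity_decay_def intro!: bigoI[of _ "\<bar>c\<bar>"] eventually_at_infinityI[of 1])

lemma par_zero: "parity_decay \<sigma> a (\<lambda>_. 0)"
  by (simp add: parity_decay_def)

lemma par_add: "parity_decay \<sigma> a f \<Longrightarrow> parity_decay \<sigma> a g \<Longrightarrow> parity_decay \<sigma> a (\<lambda>x. f x + g x)"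
proof -
  assume f: "parity_decay \<sigma> a f" and g: "parity_decay \<sigma> a g"
  have "\<forall>\<^sub>F x in at_infinity. isCont (\<lambda>x. f x + g x) x"
    using par_cont[OF f] par_cont[OF g] by eventually_elim (intro continuous_intros)
  moreover have "(\<lambda>x. (f x + g x) - \<sigma> * (f (- x) + g (- x))) \<in> O[at_infinity](\<lambda>x. norm x powr (- a - 1))"
    using sum_in_bigo(1)[OF par_parity[OF f] par_parity[OF g]] by (simp add: algebra_simps)
  ultimately show ?thesis
    using sum_in_bigo(1)[OF par_bigo[OF f] par_bigo[OF g]] unfolding parity_decay_def by blast
qed

text \<open>Telescoping: f g - \<sigma>\<tau> f' g' = (f - \<sigma> f') g + \<sigma> f' (g - \<tau>
  g') for the reflected functions f', g'. Each summand has one factor that is an order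
  better.\<close>

lemma par_mult:
  assumes f: "parity_decay \<sigma> a f" and g: "parity_decay \<tau> b g"
  shows "parity_decay (\<sigma> * \<tau>) (a + b) (\<lambda>x. f x * g x)"
proof -
  have "\<forall>\<^sub>F x in at_infinity. isCont (\<lambda>x. f x * g x) x"
    using par_cont[OF f] par_cont[OF g] by eventually_elim (intro continuous_intros)
  moreover have "(\<lambda>x. f x * g x) \<in> O[at_infinity](\<lambda>x. norm x powr (- (a + b)))"
    using landau_o.big.mult[OF par_bigo[OF f] par_bigo[OF g]] by (simp flip: powr_add)
  moreover have "(\<lambda>x. (f x - \<sigma> * f (- x)) * g x + \<sigma> * (f (- x) * (g x - \<tau> * g (- x))))
      \<in> O[at_infinity](\<lambda>x. norm x powr (- (a + b) - 1))"
  proof (rule sum_in_bigo(1))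
    show "(\<lambda>x. (f x - \<sigma> * f (- x)) * g x) \<in> O[at_infinity](\<lambda>x. norm x powr (- (a + b) - 1))"
      using landau_o.big.mult[OF par_parity[OF f] par_bigo[OF g]]
      by (simp flip: powr_add add: algebra_simps)
    have "(\<lambda>x. f (- x) * (g x - \<tau> * g (- x))) \<in> O[at_infinity](\<lambda>x. norm x powr (- (a + b) - 1))"
      using landau_o.big.mult[OF bigo_reflect[OF par_bigo[OF f]] par_parity[OF g]]
      by (simp flip: powr_add add: algebra_simps)
    then show "(\<lambda>x. \<sigma> * (f (- x) * (g x - \<tau> * g (- x)))) \<in> O[at_infinity](\<lambda>x. norm x powr (- (a + b) - 1))"
      by (cases "\<sigma> = 0") auto
  qed
  ultimately show ?thesis unfolding parity_decay_def by (simp add: algebra_simps)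
qed

lemma par_cmult: "parity_decay \<sigma> a f \<Longrightarrow> parity_decay \<sigma> a (\<lambda>x. c * f x)"
  using par_mult[OF par_const] by force

lemma par_mult_le:
  "parity_decay \<sigma> a f \<Longrightarrow> parity_decay \<tau> b g \<Longrightarrow> \<rho> = \<sigma> * \<tau> \<Longrightarrow> c \<le> a + b \<Longrightarrow> parity_decay \<rho> c (\<lambda>x. f x * g x)"
  using par_mono[OF par_mult] by blast

lemma par_mult0: "parity_decay 1 0 f \<Longrightarrow> parity_decay 1 0 g \<Longrightarrow> parity_decay 1 0 (\<lambda>x. f x * g x)"
  using par_mult[of 1 0 f 1 0 g] by simp

lemma par_half: "parity_decay \<sigma> c f \<Longrightarrow> parity_decay \<sigma> c (\<lambda>x. f x / 2)"
  using par_cmult[of \<sigma> c f "1/2"] by simp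

lemma par_uminus: "parity_decay \<sigma> a f \<Longrightarrow> parity_decay \<sigma> a (\<lambda>x. - f x)"
  using par_cmult[of _ _ _ "-1"] by simp

lemma par_diff: "parity_decay \<sigma> a f \<Longrightarrow> parity_decay \<sigma> a g \<Longrightarrow> parity_decay \<sigma> a (\<lambda>x. f x - g x)"
  using par_add[OF _ par_uminus] by force

lemma par_sum:
  assumes "\<And>i. i \<in> I \<Longrightarrow> parity_decay \<sigma> a (f i)"
  shows "parity_decay \<sigma> a (\<lambda>x. \<Sum>i\<in>I. f i x)"
  using assms by (induction I rule: infinite_finite_induct) (auto intro: par_zero par_add)

text \<open>The lower bound makes inversion Lipschitz with constant 1/c^2 on the values of f, so the
  parity error passes through.\<close>

lemma par_inverse:
  assumes f: "parity_decay 1 0 f" and "c > 0" and c: "\<forall>\<^sub>F x in at_infinity. c \<le> f x"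
  shows "parity_decay 1 0 (\<lambda>x. 1 / f x)"
proof -
  have "\<forall>\<^sub>F x in at_infinity. isCont (\<lambda>x. 1 / f x) x"
    using par_cont[OF f] c by eventually_elim (use \<open>c > 0\<close> in \<open>auto intro!: continuous_intros\<close>)
  moreover have "(\<lambda>x. 1 / f x) \<in> O[at_infinity](\<lambda>x. norm x powr - 0)"
  proof (rule bigoI[of _ "1 / c"])
    show "\<forall>\<^sub>F x in at_infinity. norm (1 / f x) \<le> 1 / c * norm (norm x powr - 0)"
      using c eventually_not_equal_at_infinity[of 0]
      by eventually_elim (use \<open>c > 0\<close> in \<open>auto simp: field_simps\<close>)
  qed
  moreover have "(\<lambda>x. 1 / f x - 1 * (1 / f (- x))) \<in> O[at_infinity](\<lambda>x. norm x powr (- 0 - 1))"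
  proof -
    have "(\<lambda>x. 1 / f x - 1 * (1 / f (- x))) \<in> O[at_infinity](\<lambda>x. f x - 1 * f (- x))"
    proof (rule bigoI[of _ "1 / c\<^sup>2"])
      show "\<forall>\<^sub>F x in at_infinity. norm (1 / f x - 1 * (1 / f (- x))) \<le> 1 / c\<^sup>2 * norm (f x - 1 * f (- x))"
        using c eventually_at_infinity_uminus[OF c]
      proof eventually_elim
        case (elim x)
        have "c * c \<le> f x * f (- x)" using elim \<open>c > 0\<close> by (intro mult_mono) auto
        then have "c\<^sup>2 \<le> f x * f (- x)" by (simp add: power2_eq_square)
        have "norm (1 / f x - 1 * (1 / f (- x))) = \<bar>f x - f (- x)\<bar> / (f x * f (- x))"
          using elim \<open>c > 0\<close> by (simp add: diff_frac_eq abs_divide abs_mult abs_minus_commute)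
        also have "\<dots> \<le> \<bar>f x - f (- x)\<bar> / c\<^sup>2"
          using \<open>c\<^sup>2 \<le> f x * f (- x)\<close> \<open>c > 0\<close> elim by (intro divide_left_mono mult_pos_pos) auto
        finally show ?case by simp
      qed
    qed
    then show ?thesis using landau_o.big_trans par_parity[OF f] by blast
  qed
  ultimately show ?thesis unfolding parity_decay_def by blast
qed

text \<open>Above c the square root is Lipschitz with constant 1 / sqrt c; the size is controlled by
  sqrt t \<le> 1 + t.\<close>

lemma par_sqrt:
  assumes f: "parity_decay 1 0 f" and "c > 0" and c: "\<forall>\<^sub>F x in at_infinity. c \<le> f x"
  shows "parity_decay 1 0 (\<lambda>x. sqrt (f x))"
proof -
  have "\<forall>\<^sub>F x in at_infinity. isCont (\<lambda>x. sqrt (f x)) x"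
    using par_cont[OF f] by eventually_elim (intro continuous_intros)
  moreover have "(\<lambda>x. sqrt (f x)) \<in> O[at_infinity](\<lambda>x. norm x powr - 0)"
  proof -
    have "(\<lambda>x. sqrt (f x)) \<in> O[at_infinity](\<lambda>x. 1 + f x)"
    proof (rule bigoI[of _ 1])
      show "\<forall>\<^sub>F x in at_infinity. norm (sqrt (f x)) \<le> 1 * norm (1 + f x)"
        using c
      proof eventually_elim
        case (elim x)
        have "sqrt (f x) \<le> 1 + f x"
          using elim \<open>c > 0\<close> by (intro real_le_lsqrt) (auto simp: power2_eq_square algebra_simps)
        then show ?case using elim \<open>c > 0\<close> by simp
      qed
    qed
    also have "(\<lambda>x. 1 + f x) \<in> O[at_infinity](\<lambda>x. norm x powr - 0)"
      by (intro par_bigo[of 1] par_add par_const f)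
    finally show ?thesis .
  qed
  moreover have "(\<lambda>x. sqrt (f x) - 1 * sqrt (f (- x))) \<in> O[at_infinity](\<lambda>x. norm x powr (- 0 - 1))"
  proof -
    have "(\<lambda>x. sqrt (f x) - 1 * sqrt (f (- x))) \<in> O[at_infinity](\<lambda>x. f x - 1 * f (- x))"
    proof (rule bigoI[of _ "1 / sqrt c"])
      show "\<forall>\<^sub>F x in at_infinity. norm (sqrt (f x) - 1 * sqrt (f (- x))) \<le> 1 / sqrt c * norm (f x - 1 * f (- x))"
        using c eventually_at_infinity_uminus[OF c]
      proof eventually_elim
        case (elim x)
        have "f x - f (- x) = (sqrt (f x) - sqrt (f (- x))) * (sqrt (f x) + sqrt (f (- x)))"
          using elim \<open>c > 0\<close> by (simp add: algebra_simps)
        then have "\<bar>f x - f (- x)\<bar> = \<bar>sqrt (f x) - sqrt (f (- x))\<bar> * (sqrt (f x) + sqrt (f (- x)))"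
          using elim \<open>c > 0\<close> by (simp add: abs_mult)
        moreover have "sqrt c \<le> sqrt (f x) + sqrt (f (- x))"
          using elim \<open>c > 0\<close> by (simp add: add_increasing2)
        ultimately have "\<bar>sqrt (f x) - sqrt (f (- x))\<bar> * sqrt c \<le> \<bar>f x - f (- x)\<bar>"
          by (simp add: mult_left_mono)
        then show ?case using \<open>c > 0\<close> by (simp add: field_simps)
      qed
    qed
    then show ?thesis using landau_o.big_trans par_parity[OF f] by blast
  qed
  ultimately show ?thesis unfolding parity_decay_def by blast
qed

lemma par_inverse_norm: "parity_decay 1 1 (\<lambda>x. 1 / norm x)"
  unfolding parity_decay_def
proof (intro conjI)
  show "\<forall>\<^sub>F x::real^3 in at_infinity. isCont (\<lambda>x. 1 / norm x) x"
    using eventually_not_equal_at_infinity[of 0] by eventually_elim (auto intro!: continuous_intros)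
  show "(\<lambda>x::real^3. 1 / norm x) \<in> O[at_infinity](\<lambda>x. norm x powr - 1)"
    by (intro bigoI[of _ 1]) (auto simp: powr_minus divide_inverse)
qed simp

lemma par_coord: "parity_decay (- 1) (- 1) (\<lambda>x. x $ i)"
  by (auto simp: parity_decay_def component_le_norm_cart intro!: bigoI[of _ 1] always_eventually continuous_intros)

lemma par_direction: "parity_decay (- 1) 0 (\<lambda>x. x $ i / norm x)"
  using par_mult[OF par_coord par_inverse_norm] by simp

lemma par_tendsto_zero:
  assumes "parity_decay \<sigma> a f" "a > 0"
  shows "(f \<longlongrightarrow> 0) at_infinity"
proof -
  have "((\<lambda>x::real^3. norm x powr (- a)) \<longlongrightarrow> 0) at_infinity"
    using tendsto_neg_powr[of "- a" norm at_infinity] assms(2) filterlim_norm_at_top by auto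
  moreover obtain c where "\<forall>\<^sub>F x in at_infinity. norm (f x) \<le> c * norm (norm x powr (- a))"
    using par_bigo[OF assms(1)] by (elim landau_o.bigE)
  ultimately show ?thesis
    by (intro Lim_null_comparison[of f "\<lambda>x. c * norm (norm x powr (- a))"] tendsto_mult_right_zero) (auto)
qed

section \<open>Translations, partial derivatives and reflections\<close>

lemma norm_shift_ge_half:
  fixes p x :: "real^3" assumes "2 * norm p \<le> norm x"
  shows "norm x / 2 \<le> norm (p + x)"
proof -
  have "norm x \<le> norm (p + x) + norm p" using norm_triangle_ineq4[of "p + x" p] by simp
  then show ?thesis using assms by simp
qed

lemma filterlim_shift_at_infinity: "filterlim (\<lambda>x::real^3. p + x) at_infinity at_infinity"
  by (rule tendsto_add_filterlim_at_infinity[of _ p]) (auto simp: filterlim_ident)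

lemma bigo_norm_shift:
  fixes f :: "real^3 \<Rightarrow> real"
  assumes "f \<in> O[at_infinity](\<lambda>x. norm x powr (- a))" "a \<ge> 0"
  shows "(\<lambda>x. f (p + x)) \<in> O[at_infinity](\<lambda>x. norm x powr (- a))"
proof -
  have "(\<lambda>x. f (p + x)) \<in> O[at_infinity](\<lambda>x. norm (p + x) powr (- a))"
    by (rule landau_o.big.compose[OF assms(1) filterlim_shift_at_infinity])
  also have "(\<lambda>x. norm (p + x) powr (- a)) \<in> O[at_infinity](\<lambda>x. norm x powr (- a))"
  proof (rule bigoI[of _ "2 powr a"])
    show "\<forall>\<^sub>F x in at_infinity. norm (norm (p + x) powr - a) \<le> 2 powr a * norm (norm x powr - a)"
    proof (rule eventually_at_infinityI[of "2 * norm p + 1"])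
      fix x :: "real^3" assume x: "2 * norm p + 1 \<le> norm x"
      have "0 < norm x" using x norm_ge_zero[of p] by linarith
      then have "norm (p + x) powr - a \<le> (norm x / 2) powr - a"
        using norm_shift_ge_half[of p x] x assms(2) by (intro powr_mono2') auto
      also have "\<dots> = 2 powr a * norm x powr - a"
        by (simp add: powr_divide powr_minus field_simps)
      finally show "norm (norm (p + x) powr - a) \<le> 2 powr a * norm (norm x powr - a)" by simp
    qed
  qed
  finally show ?thesis .
qed

text \<open>Ties \<open>pdiff\<close>, a one-dimensional \<open>deriv\<close> along an axis, to the
  Frechet derivative; through it the chain rule and the mean value inequality become
  available.\<close>

lemma has_derivative_pdiff:
  assumes "f differentiable (at x)"
  shows "(f has_derivative (\<lambda>v. \<Sum>k\<in>UNIV. v $ k * pdiff k f x)) (at x)"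
proof -
  obtain D where D: "(f has_derivative D) (at x)" using assms unfolding differentiable_def by blast
  interpret D: bounded_linear D by (rule has_derivative_bounded_linear[OF D])
  have pd: "pdiff k f x = D (axis k 1)" for k
  proof -
    have "((\<lambda>t. f (x + t *\<^sub>R axis k 1)) has_derivative (\<lambda>t. D (t *\<^sub>R axis k 1))) (at 0)"
      by (rule has_derivative_compose[where g = f and g' = D and f="\<lambda>t. x + t *\<^sub>R axis k 1"])
         (auto intro!: derivative_eq_intros simp: D)
    then have "((\<lambda>t. f (x + t *\<^sub>R axis k 1)) has_derivative (\<lambda>t. D (axis k 1) * t)) (at 0)"
      by (simp add: D.scaleR mult.commute)
    then show ?thesis unfolding pdiff_def has_field_derivative_def[symmetric] by (rule DERIV_imp_deriv)
  qed
  have "D v = (\<Sum>k\<in>UNIV. v $ k * pdiff k f x)" for v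
  proof -
    have "D v = D (\<Sum>k\<in>UNIV. v $ k *\<^sub>R axis k 1)"
      by (metis basis_expansion scalar_mult_eq_scaleR)
    then show ?thesis by (simp add: D.sum D.scaleR pd)
  qed
  then show ?thesis using D by (metis (no_types, lifting) ext)
qed

lemma pdiff_has_derivative:
  assumes "f differentiable (at x)"
  shows "((\<lambda>t. f (x + t *\<^sub>R axis k 1)) has_real_derivative pdiff k f x) (at 0)"
proof -
  have "((\<lambda>t. f (x + t *\<^sub>R axis k 1)) has_derivative
      (\<lambda>t. \<Sum>j\<in>UNIV. (t *\<^sub>R axis k 1) $ j * pdiff j f x)) (at 0)"
    by (rule has_derivative_compose[where g = f and f="\<lambda>t. x + t *\<^sub>R axis k 1"])
       (auto intro!: derivative_eq_intros has_derivative_pdiff[OF assms, THEN has_derivative_at_withinI] simp: has_derivative_pdiff[OF assms])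
  moreover have "(\<Sum>j\<in>UNIV. (t *\<^sub>R axis k 1) $ j * pdiff j f x) = pdiff k f x * t" for t
    by (simp add: axis_def if_distrib if_distribR sum.delta cong: if_cong)
  ultimately show ?thesis by (simp add: has_field_derivative_def)
qed

lemma pdiff_eqI:
  "((\<lambda>t. f (x + t *\<^sub>R axis k 1)) has_real_derivative d) (at 0) \<Longrightarrow> pdiff k f x = d"
  unfolding pdiff_def by (rule DERIV_imp_deriv)

lemma pdiff_cong_nhds:
  assumes "eventually (\<lambda>y. f y = g y) (nhds x)"
  shows "pdiff k f x = pdiff k g x"
proof -
  have "filterlim (\<lambda>t::real. x + t *\<^sub>R axis k 1) (nhds x) (nhds 0)"
    by (rule filterlim_compose[of _ _ _ _ _]) (auto intro!: tendsto_eq_intros filterlim_ident)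
  then have "eventually (\<lambda>t. f (x + t *\<^sub>R axis k 1) = g (x + t *\<^sub>R axis k 1)) (nhds 0)"
    using assms unfolding filterlim_iff by blast
  then show ?thesis unfolding pdiff_def by (intro deriv_cong_ev) auto
qed

lemma pdiff_shift: "pdiff k (\<lambda>x. f (p + x)) = (\<lambda>x. pdiff k f (p + x))"
  by (simp add: pdiff_def fun_eq_iff add.assoc)

text \<open>Parity about p compares p + x with p - x, parity about 0 compares p + x with -p - x. The
  points p - x and -p - x are 2p apart and the gradient decays one order faster than f, so
  exchanging them costs no more than the parity error.\<close>

lemma par_shift:
  assumes f: "parity_decay \<sigma> a f" and "a \<ge> 0"
    and diff: "\<forall>\<^sub>F x in at_infinity. f differentiable (at x)"
    and df: "\<And>k. pdiff k f \<in> O[at_infinity](\<lambda>x. norm x powr (- a - 1))"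
  shows "parity_decay \<sigma> a (\<lambda>x. f (p + x))"
proof -
  have "\<forall>\<^sub>F x in at_infinity. isCont (\<lambda>x. f (p + x)) x"
  proof -
    have "\<forall>\<^sub>F x in at_infinity. isCont f (p + x)"
      using par_cont[OF f] filterlim_shift_at_infinity unfolding filterlim_iff by blast
    then show ?thesis
      by eventually_elim (rule isCont_o2[where g = f], auto)
  qed
  moreover have "(\<lambda>x. f (p + x)) \<in> O[at_infinity](\<lambda>x. norm x powr (- a))"
    by (rule bigo_norm_shift[OF par_bigo[OF f] \<open>a \<ge> 0\<close>])
  moreover have "(\<lambda>x. f (p + x) - \<sigma> * f (p + (- x))) \<in> O[at_infinity](\<lambda>x. norm x powr (- a - 1))"
  proof -
    have 1: "(\<lambda>x. f (p + x) - \<sigma> * f (- (p + x))) \<in> O[at_infinity](\<lambda>x. norm x powr (- a - 1))"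
      using bigo_norm_shift[of "\<lambda>x. f x - \<sigma> * f (- x)" "a + 1" p] par_parity[OF f] \<open>a \<ge> 0\<close> by simp
    have "\<exists>c. \<forall>\<^sub>F x in at_infinity. norm (pdiff k f x) \<le> c * norm (norm x powr (- a - 1))" for k
      using df[of k] by (elim landau_o.bigE) blast
    then obtain c where c: "\<And>k. \<forall>\<^sub>F x in at_infinity. norm (pdiff k f x) \<le> c k * norm (norm x powr (- a - 1))"
      by metis
    define C where "C = (\<Sum>k\<in>UNIV. \<bar>c k\<bar>)"
    have "\<forall>\<^sub>F x in at_infinity. (\<forall>k. \<bar>pdiff k f x\<bar> \<le> c k * norm x powr (- a - 1)) \<and> f differentiable (at x)"
      using c diff by (intro eventually_conj eventually_all_finite) auto
    then obtain K where K: "\<And>x k. K \<le> norm x \<Longrightarrow> \<bar>pdiff k f x\<bar> \<le> c k * norm x powr (- a - 1)"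
        "\<And>x. K \<le> norm x \<Longrightarrow> f differentiable (at x)"
      unfolding eventually_at_infinity by blast
    have "(\<lambda>x. f (p + (- x)) - f (- (p + x))) \<in> O[at_infinity](\<lambda>x. norm x powr (- a - 1))"
    proof (rule bigoI, rule eventually_at_infinityI)
      \<comment> \<open>Beyond this radius the whole segment stays in the region where the bounds
        hold, at distance at least |x| / 2 from the origin.\<close>
      fix x :: "real^3" assume x: "2 * \<bar>K\<bar> + 2 * norm p + 1 \<le> norm x"
      have "0 < norm x" using x norm_ge_zero[of p] abs_ge_zero[of K] by linarith
      then have "x \<noteq> 0" by simp
      define B where "B = C * (norm x / 2) powr (- a - 1)"
      have seg: "norm (f (p + (- x)) - f (- (p + x))) \<le> B * norm ((p + (- x)) - (- (p + x)))"
      proof (rule differentiable_bound[of "closed_segment (- (p + x)) (p + - x)"])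
        fix z assume "z \<in> closed_segment (- (p + x)) (p + - x)"
        moreover have "closed_segment (- (p + x)) (p + - x) \<subseteq> cball (- x) (norm p)"
          by (rule closed_segment_subset) (auto simp: dist_norm norm_minus_commute)
        ultimately have "norm (- x - z) \<le> norm p" by (auto simp: dist_norm)
        then have "norm x \<le> norm p + norm z"
          using norm_triangle_ineq[of "- x - z" z] by simp
        then have z: "norm x / 2 \<le> norm z" "K \<le> norm z"
          using x norm_ge_zero[of p] by (simp, smt (verit))
        show "(f has_derivative (\<lambda>v. \<Sum>k\<in>UNIV. v $ k * pdiff k f z)) (at z within closed_segment (- (p + x)) (p + - x))"
          by (rule has_derivative_at_withinI[OF has_derivative_pdiff[OF K(2)[OF z(2)]]])
        have dk: "\<bar>pdiff k f z\<bar> \<le> \<bar>c k\<bar> * (norm x / 2) powr (- a - 1)" for k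
        proof -
          have "\<bar>pdiff k f z\<bar> \<le> c k * norm z powr (- a - 1)" by (rule K(1)[OF z(2)])
          also have "\<dots> \<le> \<bar>c k\<bar> * (norm x / 2) powr (- a - 1)"
            using z \<open>x \<noteq> 0\<close> \<open>a \<ge> 0\<close> by (intro mult_mono powr_mono2') auto
          finally show ?thesis .
        qed
        show "onorm (\<lambda>v. \<Sum>k\<in>UNIV. v $ k * pdiff k f z) \<le> B"
        proof (rule onorm_le)
          fix v :: "real^3"
          have "norm (\<Sum>k\<in>UNIV. v $ k * pdiff k f z) \<le> (\<Sum>k\<in>UNIV. norm v * (\<bar>c k\<bar> * (norm x / 2) powr (- a - 1)))"
            using dk by (intro sum_norm_le) (auto simp: abs_mult intro!: mult_mono component_le_norm_cart)
          also have "\<dots> = B * norm v"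
            by (simp add: B_def C_def sum_distrib_left sum_distrib_right mult_ac)
          finally show "norm (\<Sum>k\<in>UNIV. v $ k * pdiff k f z) \<le> B * norm v" .
        qed
      qed auto
      also have "(p + (- x)) - (- (p + x)) = 2 *\<^sub>R p" by (simp add: scaleR_2)
      also have "norm (2 *\<^sub>R p) = 2 * norm p" by simp
      also have "B = (C * 2 powr (a + 1)) * norm x powr (- a - 1)"
        by (simp add: B_def powr_divide powr_minus powr_diff powr_add field_simps)
      finally show "norm (f (p + (- x)) - f (- (p + x)))
          \<le> (C * 2 powr (a + 1) * (2 * norm p)) * norm (norm x powr (- a - 1))" by (simp add: mult_ac)
    qed
    then have 2: "(\<lambda>x. \<sigma> * (f (p + (- x)) - f (- (p + x)))) \<in> O[at_infinity](\<lambda>x. norm x powr (- a - 1))"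
      by (cases "\<sigma> = 0") auto
    show ?thesis using sum_in_bigo(2)[OF 1 2] by (simp add: algebra_simps)
  qed
  ultimately show ?thesis unfolding parity_decay_def by blast
qed

text \<open>\<open>deriv\<close> chooses among the possible derivatives, and these are the same for
  f and f - c. Hence an equality of functions, valid also where nothing is differentiable, as
  iterating \<open>pdiff\<close> requires.\<close>

lemma pdiff_diff_const: "pdiff k (\<lambda>x. f x - c) = pdiff k f"
proof -
  have "((\<lambda>t. f (x + t *\<^sub>R axis k 1) - c) has_real_derivative d) (at 0)
    \<longleftrightarrow> ((\<lambda>t. f (x + t *\<^sub>R axis k 1)) has_real_derivative d) (at 0)" for x d
    by (simp add: DERIV_def)
  then show ?thesis by (simp add: pdiff_def deriv_def fun_eq_iff)
qed

lemma pdiffs_diff_const: "\<alpha> \<noteq> [] \<Longrightarrow> pdiffs \<alpha> (\<lambda>x. f x - c) = pdiffs \<alpha> f"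
proof (induction \<alpha>)
  case (Cons i \<alpha>)
  then show ?case by (cases "\<alpha> = []") (simp_all add: pdiff_diff_const)
qed simp

lemma pdiff_add:
  "f differentiable (at x) \<Longrightarrow> g differentiable (at x) \<Longrightarrow> pdiff k (\<lambda>x. f x + g x) x = pdiff k f x + pdiff k g x"
  by (intro pdiff_eqI DERIV_add pdiff_has_derivative)

lemma pdiff_diff:
  "f differentiable (at x) \<Longrightarrow> g differentiable (at x) \<Longrightarrow> pdiff k (\<lambda>x. f x - g x) x = pdiff k f x - pdiff k g x"
  by (intro pdiff_eqI DERIV_diff pdiff_has_derivative)

lemma pdiff_mult:
  assumes "f differentiable (at x)" "g differentiable (at x)"
  shows "pdiff k (\<lambda>x. f x * g x) x = pdiff k f x * g x + pdiff k g x * f x"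
  using DERIV_mult[OF pdiff_has_derivative[OF assms(1), of k] pdiff_has_derivative[OF assms(2), of k]]
  by (intro pdiff_eqI) simp

lemma pdiff_sum:
  "(\<And>i. i \<in> I \<Longrightarrow> f i differentiable (at x)) \<Longrightarrow> pdiff k (\<lambda>x. \<Sum>i\<in>I. f i x) x = (\<Sum>i\<in>I. pdiff k (f i) x)"
  by (intro pdiff_eqI DERIV_sum pdiff_has_derivative)

lemma pdiff_const [simp]: "pdiff k (\<lambda>x. c) x = 0"
  by (intro pdiff_eqI) simp

lemma pdiff_coord: "pdiff k (\<lambda>x. x $ l) x = mat 1 $ l $ k"
  by (intro pdiff_eqI) (auto simp: axis_def mat_def intro!: derivative_eq_intros)

lemma coord_differentiable: "(\<lambda>x::real^3. x $ l) differentiable (at x)"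
  unfolding differentiable_def using bounded_linear_imp_has_derivative[OF bounded_linear_vec_nth] by blast

text \<open>Each differentiation of f(-x) produces a factor -1. An equality can only be
  differentiated if it holds on a neighbourhood, so the induction runs over all x outside the ball
  at once.\<close>

lemma pdiffs_odd_part:
  assumes smooth: "\<And>\<alpha> x. K < norm x \<Longrightarrow> pdiffs \<alpha> f differentiable (at x)" and "K < norm x"
  shows "pdiffs \<alpha> (odd_part f) x = (pdiffs \<alpha> f x - (- 1) ^ length \<alpha> * pdiffs \<alpha> f (- x)) / 2"
  using assms(2)
proof (induction \<alpha> arbitrary: x)
  case Nil
  then show ?case by (simp add: odd_part_def)
next
  case (Cons i \<alpha>)
  define u where "u = pdiffs \<alpha> f"
  have "open {x::real^3. K < norm x}" by (intro open_Collect_less continuous_intros)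
  then have "\<forall>\<^sub>F y in nhds x. pdiffs \<alpha> (odd_part f) y = (u y - (- 1) ^ length \<alpha> * u (- y)) / 2"
    unfolding eventually_nhds using Cons by (intro exI[of _ "{x. K < norm x}"]) (auto simp: u_def)
  then have "pdiffs (i # \<alpha>) (odd_part f) x = pdiff i (\<lambda>y. (u y - (- 1) ^ length \<alpha> * u (- y)) / 2) x"
    by (simp add: pdiff_cong_nhds)
  also have "\<dots> = (pdiff i u x - (- 1) ^ length \<alpha> * (pdiff i u (- x) * - 1)) / 2"
  proof (rule pdiff_eqI)
    have u: "((\<lambda>t. u (x + t *\<^sub>R axis i 1)) has_real_derivative pdiff i u x) (at 0)"
      using Cons.prems unfolding u_def by (intro pdiff_has_derivative smooth)
    have "((\<lambda>t. u (- x + t *\<^sub>R axis i 1)) has_real_derivative pdiff i u (- x)) (at 0)"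
      using Cons.prems unfolding u_def by (intro pdiff_has_derivative smooth) simp
    then have "((\<lambda>t. u (- x + (- t) *\<^sub>R axis i 1)) has_real_derivative pdiff i u (- x) * - 1) (at 0)"
      by (intro DERIV_chain2[of "\<lambda>t. u (- x + t *\<^sub>R axis i 1)" _ uminus]) (auto intro!: derivative_eq_intros)
    then have u': "((\<lambda>t. u (- (x + t *\<^sub>R axis i 1))) has_real_derivative pdiff i u (- x) * - 1) (at 0)"
      by simp
    show "((\<lambda>t. (u (x + t *\<^sub>R axis i 1) - (- 1) ^ length \<alpha> * u (- (x + t *\<^sub>R axis i 1))) / 2)
        has_real_derivative (pdiff i u x - (- 1) ^ length \<alpha> * (pdiff i u (- x) * - 1)) / 2) (at 0)"
      by (intro DERIV_cdivide DERIV_diff DERIV_cmult u u')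
  qed
  finally show ?case by (simp add: u_def)
qed

text \<open>The entry point of the Regge-Teitelboim condition: twice the derivative of the odd part
  is exactly the parity error of the derivative of f, whose parity alternates with the
  order.\<close>

lemma par_pdiffs:
  assumes smooth: "\<And>\<alpha> x. K < norm x \<Longrightarrow> pdiffs \<alpha> f differentiable (at x)"
    and decay: "pdiffs \<alpha> f \<in> O[at_infinity](\<lambda>x. norm x powr (- q - real (length \<alpha>)))"
    and odd: "pdiffs \<alpha> (odd_part f) \<in> O[at_infinity](\<lambda>x. norm x powr (- 1 - q - real (length \<alpha>)))"
  shows "parity_decay ((- 1) ^ length \<alpha>) (q + real (length \<alpha>)) (pdiffs \<alpha> f)"
  unfolding parity_decay_def
proof (intro conjI)
  have ev: "\<forall>\<^sub>F x::real^3 in at_infinity. K < norm x"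
    by (rule eventually_at_infinityI[of "K + 1"]) simp
  show "\<forall>\<^sub>F x in at_infinity. isCont (pdiffs \<alpha> f) x"
    using ev by eventually_elim (auto intro: differentiable_imp_continuous_within smooth)
  show "pdiffs \<alpha> f \<in> O[at_infinity](\<lambda>x. norm x powr (- (q + real (length \<alpha>))))"
    using decay by simp
  have ev2: "\<forall>\<^sub>F x in at_infinity. 2 * pdiffs \<alpha> (odd_part f) x = pdiffs \<alpha> f x - (- 1) ^ length \<alpha> * pdiffs \<alpha> f (- x)"
    using ev by eventually_elim (simp add: pdiffs_odd_part[OF smooth])
  have "(\<lambda>x. 2 * pdiffs \<alpha> (odd_part f) x) \<in> O[at_infinity](\<lambda>x. norm x powr (- (q + real (length \<alpha>)) - 1))"
  proof -
    have e: "- (q + real (length \<alpha>)) - 1 = - 1 - q - real (length \<alpha>)" by simp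
    show ?thesis unfolding e using odd by (subst landau_o.big.cmult_in_iff) simp_all
  qed
  then show "(\<lambda>x. pdiffs \<alpha> f x - (- 1) ^ length \<alpha> * pdiffs \<alpha> f (- x))
      \<in> O[at_infinity](\<lambda>x. norm x powr (- (q + real (length \<alpha>)) - 1))"
    using landau_o.big.in_cong[OF ev2] by blast
qed

section \<open>Integration over the unit sphere\<close>

text \<open>Splitting off the factor r^2 leaves a fixed domain and a fixed measure, so that radius
  and centre enter only through the integrand.\<close>

definition usphere :: "(real^3 \<Rightarrow> real) \<Rightarrow> real" where
  "usphere F = integral (cbox (0, 0) (pi, 2 * pi)) (\<lambda>z. F (sphere_point z) * sin (fst z))"

lemma sphere_integral_usphere: "sphere_integral p r f = r\<^sup>2 * usphere (\<lambda>w. f (p + r *\<^sub>R w))"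
  unfolding sphere_integral_def usphere_def integral_mult_right[symmetric]
  by (simp add: case_prod_unfold mult_ac cbox_Pair_eq)

lemma sphere_point_nth [simp]:
  "sphere_point (\<theta>, \<phi>) $ 1 = sin \<theta> * cos \<phi>"
  "sphere_point (\<theta>, \<phi>) $ 2 = sin \<theta> * sin \<phi>"
  "sphere_point (\<theta>, \<phi>) $ 3 = cos \<theta>"
  by (simp_all add: sphere_point_def vector_3)

lemma norm_sphere_point [simp]: "norm (sphere_point z) = 1"
proof (cases z)
  case (Pair \<theta> \<phi>)
  have "(sin \<theta> * cos \<phi>)\<^sup>2 + (sin \<theta> * sin \<phi>)\<^sup>2 + (cos \<theta>)\<^sup>2
      = (sin \<theta>)\<^sup>2 * ((sin \<phi>)\<^sup>2 + (cos \<phi>)\<^sup>2) + (cos \<theta>)\<^sup>2"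
    by (simp add: power_mult_distrib algebra_simps del: sin_cos_squared_add sin_cos_squared_add2)
  then have "(sphere_point z) \<bullet> (sphere_point z) = 1"
    by (simp add: Pair inner_vec_def sum_3 power2_eq_square[symmetric])
  then show ?thesis by (simp add: norm_eq_sqrt_inner)
qed

lemma continuous_sphere_point [continuous_intros]: "continuous_on A sphere_point"
proof -
  have "continuous_on A (\<lambda>z. sphere_point z $ i)" for i :: 3
    using exhaust_3[of i]
    by (elim disjE) (simp_all add: sphere_point_def case_prod_unfold vector_3 continuous_intros)
  then have "continuous_on A (\<lambda>z. \<chi> i. sphere_point z $ i)" by (rule continuous_on_vec_lambda)
  then show ?thesis by simp
qed

lemma usphere_integrand_continuous:
  assumes "continuous_on (sphere 0 1) F"
  shows "continuous_on A (\<lambda>z. F (sphere_point z) * sin (fst z))"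
proof -
  have "continuous_on A (\<lambda>z. F (sphere_point z))"
    by (rule continuous_on_compose2[OF assms]) (auto intro!: continuous_intros)
  then show ?thesis by (intro continuous_intros)
qed

lemma usphere_integrable:
  assumes "continuous_on (sphere 0 1) F"
  shows "(\<lambda>z. F (sphere_point z) * sin (fst z)) integrable_on cbox (0, 0) (pi, 2 * pi)"
  by (intro integrable_continuous usphere_integrand_continuous assms)

lemma usphere_cong:
  assumes "\<And>w. norm w = 1 \<Longrightarrow> F w = G w" shows "usphere F = usphere G"
  unfolding usphere_def by (simp add: assms)

lemma usphere_add:
  assumes "continuous_on (sphere 0 1) F" "continuous_on (sphere 0 1) G"
  shows "usphere (\<lambda>w. F w + G w) = usphere F + usphere G"
  unfolding usphere_def integral_add[OF usphere_integrable[OF assms(1)] usphere_integrable[OF assms(2)], symmetric]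
  by (simp add: distrib_right)

lemma usphere_diff:
  assumes "continuous_on (sphere 0 1) F" "continuous_on (sphere 0 1) G"
  shows "usphere (\<lambda>w. F w - G w) = usphere F - usphere G"
  unfolding usphere_def integral_diff[OF usphere_integrable[OF assms(1)] usphere_integrable[OF assms(2)], symmetric]
  by (simp add: left_diff_distrib)

lemma usphere_cmult: "usphere (\<lambda>w. c * F w) = c * usphere F"
  unfolding usphere_def integral_mult_right[symmetric] by (simp add: mult.assoc)

lemma usphere_sum:
  assumes "finite I" "\<And>i. i \<in> I \<Longrightarrow> continuous_on (sphere 0 1) (F i)"
  shows "usphere (\<lambda>w. \<Sum>i\<in>I. F i w) = (\<Sum>i\<in>I. usphere (F i))"
  using assms
proof (induction I rule: finite_induct)
  case empty
  show ?case using usphere_cmult[of 0 "\<lambda>_. 0"] by simp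
next
  case (insert i I)
  have "usphere (\<lambda>w. F i w + (\<Sum>i\<in>I. F i w)) = usphere (F i) + usphere (\<lambda>w. \<Sum>i\<in>I. F i w)"
    using insert by (intro usphere_add continuous_intros) auto
  then show ?case using insert by simp
qed

text \<open>The constant is the area of the parameter rectangle, with the sine bounded by 1; it is
  cruder than 4 pi, which is harmless for orders of growth.\<close>

lemma usphere_bound:
  assumes "continuous_on (sphere 0 1) F" "\<And>w. norm w = 1 \<Longrightarrow> \<bar>F w\<bar> \<le> B"
  shows "\<bar>usphere F\<bar> \<le> 2 * pi\<^sup>2 * B"
proof -
  have "0 \<le> \<bar>F (sphere_point 0)\<bar>" by simp
  also have "\<dots> \<le> B" by (rule assms(2)) simp
  finally have "0 \<le> B" .
  have "norm (usphere F) \<le> B * measure lborel (cbox (0, 0) (pi, 2 * pi))"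
    using usphere_integrable[OF assms(1)] \<open>0 \<le> B\<close> unfolding usphere_def
  proof (intro has_integral_bound[OF _ integrable_integral])
    fix z :: "real \<times> real" assume "z \<in> cbox (0, 0) (pi, 2 * pi)"
    have "\<bar>F (sphere_point z) * sin (fst z)\<bar> \<le> B * 1"
      unfolding abs_mult using \<open>0 \<le> B\<close> by (intro mult_mono assms(2)) auto
    then show "norm (F (sphere_point z) * sin (fst z)) \<le> B" by simp
  qed
  also have "measure lborel (cbox (0, 0) (pi, 2 * pi)) = 2 * pi\<^sup>2"
    by (simp add: content_Pair power2_eq_square)
  finally show ?thesis by (simp add: mult_ac)
qed

lemma usphere_iterated:
  assumes "continuous_on (sphere 0 1) F"
  shows "usphere F = integral {0..pi} (\<lambda>\<theta>. integral {0..2 * pi} (\<lambda>\<phi>. F (sphere_point (\<theta>, \<phi>)) * sin \<theta>))"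
  unfolding usphere_def
  by (subst integral_prod_continuous[OF usphere_integrand_continuous[OF assms]]) simp

text \<open>The antipode of (\<theta>, \<phi>) is (pi - \<theta>, \<phi> + pi). The sine is
  invariant under the first change, and the shifted interval of \<phi> is brought back by
  periodicity.\<close>

lemma usphere_uminus:
  assumes "continuous_on (sphere 0 1) F"
  shows "usphere (\<lambda>w. F (- w)) = usphere F"
proof -
  have F': "continuous_on (sphere 0 1) (\<lambda>w. F (- w))"
    by (rule continuous_on_compose2[OF assms]) (auto intro!: continuous_intros)
  define k where "k \<theta> = integral {0..2 * pi} (\<lambda>\<phi>. F (sphere_point (\<theta>, \<phi>)) * sin \<theta>)" for \<theta>
  have pt: "- sphere_point (\<theta>, \<phi>) = sphere_point (pi - \<theta>, \<phi> + pi)" for \<theta> \<phi>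
    by (simp add: vec_eq_iff forall_3)
  have shift: "integral {0..2 * pi} (\<lambda>\<phi>. F (- sphere_point (\<theta>, \<phi>)) * sin \<theta>) = k (pi - \<theta>)" for \<theta>
  proof -
    define g where "g \<phi> = F (sphere_point (pi - \<theta>, \<phi>)) * sin \<theta>" for \<phi>
    have "continuous_on A (\<lambda>\<phi>. F (sphere_point (pi - \<theta>, \<phi>)))" for A
      by (rule continuous_on_compose2[OF assms])
         (auto intro!: continuous_intros continuous_on_compose2[OF continuous_sphere_point])
    then have g: "g integrable_on {a..b}" for a b
      unfolding g_def by (intro integrable_continuous_real continuous_intros)
    have per: "g (\<phi> + 2 * pi) = g \<phi>" for \<phi>
    proof -
      have "sphere_point (pi - \<theta>, \<phi> + 2 * pi) = sphere_point (pi - \<theta>, \<phi>)"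
        by (simp add: vec_eq_iff forall_3)
      then show ?thesis by (simp add: g_def)
    qed
    have "integral {0..2 * pi} (\<lambda>\<phi>. g (\<phi> + pi)) = integral {pi..3 * pi} g"
      using integral_shift_Icc_real[of 0 "2 * pi" g pi] by (simp add: o_def add.commute)
    also have "\<dots> = integral {pi..2 * pi} g + integral {2 * pi..3 * pi} g"
      by (rule Henstock_Kurzweil_Integration.integral_combine[symmetric]) (auto intro: g)
    also have "integral {2 * pi..3 * pi} g = integral {0..pi} (\<lambda>\<phi>. g (\<phi> + 2 * pi))"
      using integral_shift_Icc_real[of 0 "pi" g "2 * pi"] by (simp add: o_def add.commute)
    also have "\<dots> = integral {0..pi} g" by (simp add: per)
    also have "integral {pi..2 * pi} g + integral {0..pi} g = integral {0..2 * pi} g"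
      by (subst add.commute, rule Henstock_Kurzweil_Integration.integral_combine) (auto intro: g)
    finally show ?thesis unfolding pt g_def k_def sin_pi_minus .
  qed
  have "usphere (\<lambda>w. F (- w)) = integral {0..pi} (\<lambda>\<theta>. k (pi - \<theta>))"
    unfolding usphere_iterated[OF F'] shift ..
  also have "\<dots> = integral {- pi..- 0} (\<lambda>\<theta>. k (pi - (- \<theta>)))"
    by (rule Henstock_Kurzweil_Integration.integral_reflect_real[symmetric])
  also have "(\<lambda>\<theta>. k (pi - (- \<theta>))) = k \<circ> (+) pi" by (simp add: fun_eq_iff)
  also have "integral {- pi..- 0} (k \<circ> (+) pi) = integral {- pi + pi..- 0 + pi} k"
    by (rule integral_shift_Icc_real)
  also have "\<dots> = integral {0..pi} k" by simp
  also have "\<dots> = usphere F" unfolding usphere_iterated[OF assms] k_def ..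
  finally show ?thesis .
qed

text \<open>In spherical coordinates the integrand times \<open>sin \<theta>\<close> is
  \<open>\<partial>\<^sub>\<theta> (sin \<theta> e\<^sub>\<theta> F) + \<partial>\<^sub>\<phi> (e\<^sub>\<phi> F)\<close>, whose boundary terms vanish or cancel.\<close>

lemma usphere_tangential:
  assumes D: "\<And>w. norm w = 1 \<Longrightarrow> (F has_derivative (\<lambda>v. D w \<bullet> v)) (at w)"
    and cont: "continuous_on (sphere 0 1) D"
  shows "usphere (\<lambda>w. D w $ i - w $ i * (D w \<bullet> w) - 2 * w $ i * F w) = 0"
proof -
  define et :: "real \<times> real \<Rightarrow> real^3" where
    "et = (\<lambda>(\<theta>, \<phi>). vector [cos \<theta> * cos \<phi>, cos \<theta> * sin \<phi>, - sin \<theta>])"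
  define ep :: "real \<times> real \<Rightarrow> real^3" where
    "ep = (\<lambda>(\<theta>, \<phi>). vector [- sin \<phi>, cos \<phi>, 0])"
  have et [simp]: "et (\<theta>, \<phi>) $ 1 = cos \<theta> * cos \<phi>" "et (\<theta>, \<phi>) $ 2 = cos \<theta> * sin \<phi>"
    "et (\<theta>, \<phi>) $ 3 = - sin \<theta>" and ep [simp]: "ep (\<theta>, \<phi>) $ 1 = - sin \<phi>"
    "ep (\<theta>, \<phi>) $ 2 = cos \<phi>" "ep (\<theta>, \<phi>) $ 3 = 0" for \<theta> \<phi>
    by (simp_all add: et_def ep_def vector_3)
  let ?G = "\<lambda>\<theta> \<phi>. F (sphere_point (\<theta>, \<phi>))" and ?D = "\<lambda>\<theta> \<phi>. D (sphere_point (\<theta>, \<phi>))"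
  define P where "P \<theta> \<phi> = cos \<theta> * et (\<theta>, \<phi>) $ i * ?G \<theta> \<phi> - sin \<theta> * sphere_point (\<theta>, \<phi>) $ i * ?G \<theta> \<phi>
     + sin \<theta> * et (\<theta>, \<phi>) $ i * (?D \<theta> \<phi> \<bullet> et (\<theta>, \<phi>))" for \<theta> \<phi>
  define Q where "Q \<theta> \<phi> = ep (\<theta>, \<phi>) $ i * (sin \<theta> * (?D \<theta> \<phi> \<bullet> ep (\<theta>, \<phi>)))
     - (sin \<theta> * sphere_point (\<theta>, \<phi>) $ i + cos \<theta> * et (\<theta>, \<phi>) $ i) * ?G \<theta> \<phi>" for \<theta> \<phi>
  have Fc: "continuous_on (sphere 0 1) F"
    by (intro continuous_at_imp_continuous_on ballI has_derivative_continuous[OF D]) simp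
  have vec: "continuous_on A et" "continuous_on A ep" for A
  proof -
    have "continuous_on A (\<lambda>z. et z $ i)" "continuous_on A (\<lambda>z. ep z $ i)" for i :: 3
      using exhaust_3[of i]
      by (elim disjE; simp add: et_def ep_def case_prod_unfold vector_3 continuous_intros)+
    then have "continuous_on A (\<lambda>z. \<chi> i. et z $ i)" "continuous_on A (\<lambda>z. \<chi> i. ep z $ i)"
      using continuous_on_vec_lambda[of A "\<lambda>i z. et z $ i"] continuous_on_vec_lambda[of A "\<lambda>i z. ep z $ i"] by blast+
    then show "continuous_on A et" "continuous_on A ep" by simp_all
  qed
  have comp: "continuous_on A (\<lambda>z. F (sphere_point z))" "continuous_on A (\<lambda>z. D (sphere_point z))" for A
    by (auto intro!: continuous_on_compose2[OF Fc] continuous_on_compose2[OF cont] continuous_intros)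
  have Pc: "continuous_on A (\<lambda>(\<theta>, \<phi>). P \<theta> \<phi>)" and Qc: "continuous_on A (\<lambda>(\<theta>, \<phi>). Q \<theta> \<phi>)" for A
    unfolding P_def Q_def case_prod_unfold prod.collapse
    by (intro continuous_intros vec comp)+
  have dsp: "((\<lambda>\<theta>. sphere_point (\<theta>, \<phi>)) has_vector_derivative et (\<theta>, \<phi>)) (at \<theta>)"
            "((\<lambda>\<phi>. sphere_point (\<theta>, \<phi>)) has_vector_derivative sin \<theta> *\<^sub>R ep (\<theta>, \<phi>)) (at \<phi>)" for \<theta> \<phi>
  proof -
    have "((\<lambda>\<theta>. sphere_point (\<theta>, \<phi>) $ i) has_real_derivative et (\<theta>, \<phi>) $ i) (at \<theta>)"
         "((\<lambda>\<phi>. sphere_point (\<theta>, \<phi>) $ i) has_real_derivative sin \<theta> * ep (\<theta>, \<phi>) $ i) (at \<phi>)" for i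
      using exhaust_3[of i] by (auto intro!: derivative_eq_intros)
    then show "((\<lambda>\<theta>. sphere_point (\<theta>, \<phi>)) has_vector_derivative et (\<theta>, \<phi>)) (at \<theta>)"
      "((\<lambda>\<phi>. sphere_point (\<theta>, \<phi>)) has_vector_derivative sin \<theta> *\<^sub>R ep (\<theta>, \<phi>)) (at \<phi>)"
      unfolding has_vector_derivative_def has_field_derivative_def
      by (subst has_derivative_componentwise_within, auto simp: Basis_vec_def inner_axis mult_ac mult_commute_abs)+
  qed
  have dF: "((\<lambda>\<theta>. ?G \<theta> \<phi>) has_real_derivative ?D \<theta> \<phi> \<bullet> et (\<theta>, \<phi>)) (at \<theta>)"
           "((\<lambda>\<phi>. ?G \<theta> \<phi>) has_real_derivative sin \<theta> * (?D \<theta> \<phi> \<bullet> ep (\<theta>, \<phi>))) (at \<phi>)" for \<theta> \<phi>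
    using has_derivative_compose[OF dsp(1)[unfolded has_vector_derivative_def] D[OF norm_sphere_point]]
      has_derivative_compose[OF dsp(2)[unfolded has_vector_derivative_def] D[OF norm_sphere_point]]
    by (simp_all add: has_field_derivative_def mult_commute_abs mult_ac)
  have dP: "((\<lambda>\<theta>. sin \<theta> * et (\<theta>, \<phi>) $ i * ?G \<theta> \<phi>) has_real_derivative P \<theta> \<phi>) (at \<theta>)" for \<theta> \<phi>
  proof -
    have "((\<lambda>\<theta>. et (\<theta>, \<phi>) $ i) has_real_derivative - sphere_point (\<theta>, \<phi>) $ i) (at \<theta>)"
      using exhaust_3[of i] by (auto intro!: derivative_eq_intros)
    from this dF(1) show ?thesis by (auto simp: P_def algebra_simps intro!: derivative_eq_intros)
  qed
  have dQ: "((\<lambda>\<phi>. ep (\<theta>, \<phi>) $ i * ?G \<theta> \<phi>) has_real_derivative Q \<theta> \<phi>) (at \<phi>)" for \<theta> \<phi>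
  proof -
    \<comment> \<open>The \<phi>-derivative of \<open>ep\<close> is the inward horizontal unit
      vector; these relations express it through the position vector and \<open>et\<close>.\<close>
    have "cos \<phi> = sin \<theta> * (sin \<theta> * cos \<phi>) + cos \<theta> * (cos \<theta> * cos \<phi>)"
         "sin \<phi> = sin \<theta> * (sin \<theta> * sin \<phi>) + cos \<theta> * (cos \<theta> * sin \<phi>)"
      by (simp_all flip: mult.assoc distrib_right add: sin_squared_eq power2_eq_square[symmetric])
    then have "((\<lambda>\<phi>. ep (\<theta>, \<phi>) $ i) has_real_derivative
        - (sin \<theta> * sphere_point (\<theta>, \<phi>) $ i + cos \<theta> * et (\<theta>, \<phi>) $ i)) (at \<phi>)"
      using exhaust_3[of i] by (auto intro!: derivative_eq_intros)
    from this dF(2) show ?thesis by (auto simp: Q_def algebra_simps intro!: derivative_eq_intros)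
  qed
  have intP: "integral {0..pi} (\<lambda>\<theta>. P \<theta> \<phi>) = 0" for \<phi>
  proof -
    have "((\<lambda>\<theta>. P \<theta> \<phi>) has_integral (sin pi * et (pi, \<phi>) $ i * ?G pi \<phi> - sin 0 * et (0, \<phi>) $ i * ?G 0 \<phi>)) {0..pi}"
      by (rule fundamental_theorem_of_calculus)
         (auto intro!: dP has_field_derivative_at_within simp flip: has_real_derivative_iff_has_vector_derivative)
    then show ?thesis by (simp add: integral_unique)
  qed
  have intQ: "integral {0..2 * pi} (\<lambda>\<phi>. Q \<theta> \<phi>) = 0" for \<theta>
  proof -
    have "((\<lambda>\<phi>. Q \<theta> \<phi>) has_integral (ep (\<theta>, 2 * pi) $ i * ?G \<theta> (2 * pi) - ep (\<theta>, 0) $ i * ?G \<theta> 0)) {0..2 * pi}"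
      by (rule fundamental_theorem_of_calculus)
         (auto intro!: dQ has_field_derivative_at_within simp flip: has_real_derivative_iff_has_vector_derivative)
    moreover have "ep (\<theta>, 2 * pi) = ep (\<theta>, 0)" "sphere_point (\<theta>, 2 * pi) = sphere_point (\<theta>, 0)"
      by (simp_all add: vec_eq_iff forall_3)
    ultimately show ?thesis by (simp add: integral_unique)
  qed
  have key: "(?D \<theta> \<phi> $ i - sphere_point (\<theta>, \<phi>) $ i * (?D \<theta> \<phi> \<bullet> sphere_point (\<theta>, \<phi>))
      - 2 * sphere_point (\<theta>, \<phi>) $ i * ?G \<theta> \<phi>) * sin \<theta> = P \<theta> \<phi> + Q \<theta> \<phi>" for \<theta> \<phi>
  proof -
    \<comment> \<open>Expansion of the tangential part of u in the orthonormal frame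
      \<open>et\<close>, \<open>ep\<close>.\<close>
    have "u $ i - sphere_point (\<theta>, \<phi>) $ i * (u \<bullet> sphere_point (\<theta>, \<phi>))
        = et (\<theta>, \<phi>) $ i * (u \<bullet> et (\<theta>, \<phi>)) + ep (\<theta>, \<phi>) $ i * (u \<bullet> ep (\<theta>, \<phi>))" for u :: "real^3"
    proof -
      have 1: "sin \<theta> * sin \<theta> + cos \<theta> * cos \<theta> = 1" "sin \<phi> * sin \<phi> + cos \<phi> * cos \<phi> = 1"
        by (simp_all flip: power2_eq_square)
      have id1: "a - s * d * (a * (s * d) + b * (s * t) + e * c)
            = c * d * (a * (c * d) + b * (c * t) - e * s) - t * (b * d - a * t)"
        and id2: "b - s * t * (a * (s * d) + b * (s * t) + e * c)
            = c * t * (a * (c * d) + b * (c * t) - e * s) + d * (b * d - a * t)"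
        and id3: "e - c * (a * (s * d) + b * (s * t) + e * c)
            = - (s * (a * (c * d) + b * (c * t) - e * s))"
        if "s * s + c * c = 1" "t * t + d * d = 1" for a b e s c t d :: real
      proof -
        \<comment> \<open>In each of the three cases the defect is a combination of the two
          Pythagorean relations, displayed so that it vanishes by substitution.\<close>
        have "a - s * d * (a * (s * d) + b * (s * t) + e * c)
            - (c * d * (a * (c * d) + b * (c * t) - e * s) - t * (b * d - a * t))
            = a * (1 - (t * t + d * d)) + d * (a * d + b * t) * (1 - (s * s + c * c))"
          by (simp add: algebra_simps)
        then show "a - s * d * (a * (s * d) + b * (s * t) + e * c)
            = c * d * (a * (c * d) + b * (c * t) - e * s) - t * (b * d - a * t)"
          using that by simp
        have "b - s * t * (a * (s * d) + b * (s * t) + e * c)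
            - (c * t * (a * (c * d) + b * (c * t) - e * s) + d * (b * d - a * t))
            = b * (1 - (t * t + d * d)) + t * (a * d + b * t) * (1 - (s * s + c * c))"
          by (simp add: algebra_simps)
        then show "b - s * t * (a * (s * d) + b * (s * t) + e * c)
            = c * t * (a * (c * d) + b * (c * t) - e * s) + d * (b * d - a * t)"
          using that by simp
        have "e - c * (a * (s * d) + b * (s * t) + e * c) + s * (a * (c * d) + b * (c * t) - e * s)
            = e * (1 - (s * s + c * c))"
          by (simp add: algebra_simps)
        then show "e - c * (a * (s * d) + b * (s * t) + e * c)
            = - (s * (a * (c * d) + b * (c * t) - e * s))"
          using that by simp
      qed
      show ?thesis
        using exhaust_3[of i] id1[OF 1] id2[OF 1] id3[OF 1]
        by (elim disjE) (simp_all add: inner_vec_def sum_3)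
    qed
    note e = this[of "?D \<theta> \<phi>"]
    show ?thesis unfolding P_def Q_def e by (simp only: algebra_simps)
  qed
  have "(D (sphere_point z) $ i - sphere_point z $ i * (D (sphere_point z) \<bullet> sphere_point z)
      - 2 * sphere_point z $ i * F (sphere_point z)) * sin (fst z) = P (fst z) (snd z) + Q (fst z) (snd z)" for z
    using key[of "fst z" "snd z"] by simp
  then have "usphere (\<lambda>w. D w $ i - w $ i * (D w \<bullet> w) - 2 * w $ i * F w)
      = integral (cbox (0, 0) (pi, 2 * pi)) (\<lambda>z. (\<lambda>(\<theta>, \<phi>). P \<theta> \<phi>) z + (\<lambda>(\<theta>, \<phi>). Q \<theta> \<phi>) z)"
    unfolding usphere_def by (simp add: case_prod_unfold)
  also have "\<dots> = integral (cbox (0, 0) (pi, 2 * pi)) (\<lambda>(\<theta>, \<phi>). P \<theta> \<phi>) + integral (cbox (0, 0) (pi, 2 * pi)) (\<lambda>(\<theta>, \<phi>). Q \<theta> \<phi>)"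
    by (intro integral_add integrable_continuous Pc Qc)
  also have "integral (cbox (0, 0) (pi, 2 * pi)) (\<lambda>(\<theta>, \<phi>). Q \<theta> \<phi>) = 0"
    by (subst integral_prod_continuous[OF Qc]) (simp add: intQ)
  \<comment> \<open>The inner variable of the iterated integral is \<phi>, whereas P is a
    \<theta>-derivative; the order of integration is exchanged first.\<close>
  also have "integral (cbox (0, 0) (pi, 2 * pi)) (\<lambda>(\<theta>, \<phi>). P \<theta> \<phi>) = 0"
    by (subst integral_prod_continuous[OF Pc], subst integral_swap_continuous) (simp_all add: intP Pc)
  finally show ?thesis by simp
qed

lemma usphere_coord: "usphere (\<lambda>w. w $ l) = 0"
proof -
  have "usphere (\<lambda>w. (- w) $ l) = usphere (\<lambda>w. w $ l)"
    by (rule usphere_uminus) (intro continuous_intros)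
  then show ?thesis using usphere_cmult[of "-1" "\<lambda>w. w $ l"] by simp
qed

section \<open>Fluxes through large spheres\<close>

text \<open>The rotation field is tangential and divergence free. It arises by antisymmetrizing the
  tangential identity for w_j F in direction k: the radial and zeroth order terms are symmetric in j
  and k and cancel.\<close>

lemma usphere_rotation:
  assumes D: "\<And>w. norm w = 1 \<Longrightarrow> (F has_derivative (\<lambda>v. D w \<bullet> v)) (at w)"
    and cont: "continuous_on (sphere 0 1) D"
  shows "usphere (\<lambda>w. w $ j * D w $ k - w $ k * D w $ j) = 0"
proof -
  have Fc: "continuous_on (sphere 0 1) F"
    by (intro continuous_at_imp_continuous_on ballI has_derivative_continuous[OF D]) simp
  define E where "E i w = F w *\<^sub>R axis i 1 + w $ i *\<^sub>R D w" for i w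
  have E: "((\<lambda>w. w $ i * F w) has_derivative (\<lambda>v. E i w \<bullet> v)) (at w)" if "norm w = 1" for i w
    using D[OF that] unfolding E_def
    by (auto intro!: derivative_eq_intros bounded_linear_imp_has_derivative[OF bounded_linear_vec_nth]
        simp: inner_add_left inner_axis' algebra_simps)
  have Ec: "continuous_on (sphere 0 1) (E i)" for i
    unfolding E_def by (intro continuous_intros Fc cont)
  define T where "T i k w = E i w $ k - w $ k * (E i w \<bullet> w) - 2 * w $ k * (w $ i * F w)" for i k w
  have "usphere (\<lambda>w. T j k w - T k j w) = usphere (T j k) - usphere (T k j)"
    unfolding T_def by (intro usphere_diff continuous_intros Ec Fc)
  also have "\<dots> = 0"
    using usphere_tangential[OF E Ec] unfolding T_def by simp
  finally have "usphere (\<lambda>w. T j k w - T k j w) = 0" .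
  moreover have "T j k w - T k j w = w $ j * D w $ k - w $ k * D w $ j" for w
    unfolding T_def E_def
    by (simp add: inner_add_left inner_axis' algebra_simps) (simp add: axis_def)
  ultimately show ?thesis by simp
qed

text \<open>Derivatives are taken within \<open>U\<close> so that one statement serves the closed
  parameter interval of a moving centre as well as the open half-line of radii.\<close>

lemma usphere_leibniz:
  assumes deriv: "\<And>s w. s \<in> U \<Longrightarrow> norm w = 1 \<Longrightarrow>
      ((\<lambda>s. f s w) has_real_derivative f' s w) (at s within U)"
    and f: "\<And>s. s \<in> U \<Longrightarrow> continuous_on (sphere 0 1) (f s)"
    and f': "continuous_on (U \<times> sphere 0 1) (\<lambda>(s, w). f' s w)"
    and U: "s\<^sub>0 \<in> U" "convex U"
  shows "((\<lambda>s. usphere (f s)) has_real_derivative usphere (f' s\<^sub>0)) (at s\<^sub>0 within U)"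
  unfolding usphere_def
proof (rule leibniz_rule_field_derivative[OF _ _ _ U])
  show "((\<lambda>s. f s (sphere_point z) * sin (fst z)) has_real_derivative
      f' s (sphere_point z) * sin (fst z)) (at s within U)" if "s \<in> U" for s z
    by (intro DERIV_cmult_right deriv that) simp
  show "(\<lambda>z. f s (sphere_point z) * sin (fst z)) integrable_on cbox (0, 0) (pi, 2 * pi)" if "s \<in> U" for s
    by (intro usphere_integrable f that)
  have "continuous_on (U \<times> cbox (0, 0) (pi, 2 * pi)) (\<lambda>y. (\<lambda>(s, w). f' s w) (fst y, sphere_point (snd y)))"
    by (rule continuous_on_compose2[OF f'])
       (auto intro!: continuous_intros continuous_on_compose2[OF continuous_sphere_point])
  then show "continuous_on (U \<times> cbox (0, 0) (pi, 2 * pi)) (\<lambda>(s, z). f' s (sphere_point z) * sin (fst z))"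
    by (auto simp: case_prod_unfold intro!: continuous_intros)
qed

section \<open>Functions of class C^1 outside a ball\<close>

definition c1_outside :: "real \<Rightarrow> (real^3 \<Rightarrow> real) \<Rightarrow> bool" where
  "c1_outside K f \<longleftrightarrow> (\<forall>x. K < norm x \<longrightarrow> f differentiable (at x) \<and> (\<forall>k. isCont (pdiff k f) x))"

lemma c1_outside_continuous:
  assumes "c1_outside K f"
  shows "continuous_on {x. K < norm x} f" "continuous_on {x. K < norm x} (pdiff k f)"
  using assms unfolding c1_outside_def
  by (auto intro!: continuous_at_imp_continuous_on intro: differentiable_imp_continuous_within)

lemma c1_outsideI:
  assumes "\<And>x. K < norm x \<Longrightarrow> f differentiable (at x)"
    and "\<And>x k. K < norm x \<Longrightarrow> pdiff k f x = f' k x"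
    and "\<And>x k. K < norm x \<Longrightarrow> isCont (f' k) x"
  shows "c1_outside K f"
  unfolding c1_outside_def
proof (intro allI impI conjI)
  fix x :: "real^3" and k assume x: "K < norm x"
  show "f differentiable (at x)" by (rule assms(1)[OF x])
  have "open {x::real^3. K < norm x}" by (intro open_Collect_less continuous_intros)
  then have "\<forall>\<^sub>F y in nhds x. pdiff k f y = f' k y"
    unfolding eventually_nhds using x assms(2) by (intro exI[of _ "{x. K < norm x}"]) auto
  then show "isCont (pdiff k f) x" using assms(3)[OF x] by (simp add: isCont_cong)
qed

lemma c1_outsideD:
  assumes "c1_outside K f" "K < norm x"
  shows "f differentiable (at x)" "isCont (pdiff k f) x" "isCont f x"
  using assms unfolding c1_outside_def
  by (auto intro: differentiable_imp_continuous_within)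

lemma c1_outside_add: "c1_outside K f \<Longrightarrow> c1_outside K g \<Longrightarrow> c1_outside K (\<lambda>x. f x + g x)"
  by (rule c1_outsideI[where f' = "\<lambda>k x. pdiff k f x + pdiff k g x"])
     (auto intro!: pdiff_add differentiable_add continuous_intros dest: c1_outsideD)

lemma c1_outside_mult: "c1_outside K f \<Longrightarrow> c1_outside K g \<Longrightarrow> c1_outside K (\<lambda>x. f x * g x)"
  by (rule c1_outsideI[where f' = "\<lambda>k x. pdiff k f x * g x + pdiff k g x * f x"])
     (auto intro!: pdiff_mult differentiable_mult continuous_intros dest: c1_outsideD)

lemma c1_outside_const: "c1_outside K (\<lambda>x. c)"
  by (rule c1_outsideI[where f' = "\<lambda>k x. 0"]) auto

lemma c1_outside_coord: "c1_outside K (\<lambda>x. x $ l)"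
  by (rule c1_outsideI[where f' = "\<lambda>k x. mat 1 $ l $ k"]) (auto simp: pdiff_coord coord_differentiable)

lemma c1_outside_diff: "c1_outside K f \<Longrightarrow> c1_outside K g \<Longrightarrow> c1_outside K (\<lambda>x. f x - g x)"
  using c1_outside_add[OF _ c1_outside_mult[OF c1_outside_const[of K "-1"]]] by force

lemma c1_outside_sum:
  "finite I \<Longrightarrow> (\<And>i. i \<in> I \<Longrightarrow> c1_outside K (f i)) \<Longrightarrow> c1_outside K (\<lambda>x. \<Sum>i\<in>I. f i x)"
  by (induction I rule: finite_induct) (auto intro: c1_outside_const c1_outside_add)

section \<open>Dependence of the flux on radius and centre\<close>

definition flux :: "(3 \<Rightarrow> real^3 \<Rightarrow> real) \<Rightarrow> real^3 \<Rightarrow> real \<Rightarrow> real" where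
  "flux X p r = r\<^sup>2 * usphere (\<lambda>w. \<Sum>j\<in>UNIV. X j (p + r *\<^sub>R w) * w $ j)"

definition divg :: "(3 \<Rightarrow> real^3 \<Rightarrow> real) \<Rightarrow> real^3 \<Rightarrow> real" where
  "divg X x = (\<Sum>j\<in>UNIV. pdiff j (X j) x)"

lemma norm_add_sphere_gt:
  fixes p w :: "'a::real_normed_vector"
  assumes "K + norm p < r" "norm w = 1" shows "K < norm (p + r *\<^sub>R w)"
proof -
  have "\<bar>r\<bar> = norm (r *\<^sub>R w)" using assms(2) by simp
  also have "\<dots> \<le> norm (p + r *\<^sub>R w) + norm p"
    using norm_triangle_ineq4[of "p + r *\<^sub>R w" p] by simp
  finally show ?thesis using assms(1) by linarith
qed

lemma continuous_on_sphere_compose: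
  assumes "continuous_on {x. K < norm x} f" "K + norm p < r"
  shows "continuous_on (sphere 0 1) (\<lambda>w. f (p + r *\<^sub>R w))"
  by (rule continuous_on_compose2[OF assms(1)])
     (auto intro!: continuous_intros norm_add_sphere_gt assms(2))

lemma has_derivative_on_sphere:
  assumes "c1_outside K f" "K + norm p < r" "norm w = 1"
  shows "((\<lambda>w. f (p + r *\<^sub>R w)) has_derivative (\<lambda>v. (\<chi> k. r * pdiff k f (p + r *\<^sub>R w)) \<bullet> v)) (at w)"
proof -
  have "f differentiable (at (p + r *\<^sub>R w))"
    using assms(1) norm_add_sphere_gt[OF assms(2,3)] unfolding c1_outside_def by blast
  note df = has_derivative_pdiff[OF this]
  have "((\<lambda>w. p + r *\<^sub>R w) has_derivative (\<lambda>v. r *\<^sub>R v)) (at w)"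
    by (auto intro!: derivative_eq_intros)
  from has_derivative_compose[of "\<lambda>w. p + r *\<^sub>R w" "\<lambda>v. r *\<^sub>R v" w UNIV f, OF this df]
  have "((\<lambda>w. f (p + r *\<^sub>R w)) has_derivative (\<lambda>v. \<Sum>k\<in>UNIV. (r *\<^sub>R v) $ k * pdiff k f (p + r *\<^sub>R w))) (at w)" .
  then show ?thesis by (simp add: inner_vec_def mult_ac)
qed

lemma continuous_grad_on_sphere:
  assumes "c1_outside K f" "K + norm p < r"
  shows "continuous_on (sphere 0 1) (\<lambda>w. \<chi> k. r * pdiff k f (p + r *\<^sub>R w))"
  by (intro continuous_on_vec_lambda continuous_intros
      continuous_on_sphere_compose[OF c1_outside_continuous(2)[OF assms(1)] assms(2)])

text \<open>The two integrands differ by rotational derivatives of the components X_j, which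
  integrate to zero by \<open>usphere_rotation\<close>. The left side is the change of the flux when
  the sphere is translated along v.\<close>

lemma usphere_directional_divergence:
  assumes X: "\<And>j. c1_outside K (X j)" and r: "K + norm p < r" "r \<noteq> 0"
  shows "usphere (\<lambda>w. \<Sum>j\<in>UNIV. \<Sum>k\<in>UNIV. v $ k * pdiff k (X j) (p + r *\<^sub>R w) * w $ j)
       = usphere (\<lambda>w. divg X (p + r *\<^sub>R w) * (v \<bullet> w))" (is "usphere ?L = usphere ?R")
proof -
  note c = continuous_on_sphere_compose[OF c1_outside_continuous(2)[OF X] r(1)]
  have z: "usphere (\<lambda>w. w $ j * pdiff k (X j) (p + r *\<^sub>R w) - w $ k * pdiff j (X j) (p + r *\<^sub>R w)) = 0" for j k
  proof -
    have "usphere (\<lambda>w. r * (w $ j * pdiff k (X j) (p + r *\<^sub>R w) - w $ k * pdiff j (X j) (p + r *\<^sub>R w))) = 0"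
      using usphere_rotation[where j = j and k = k, OF has_derivative_on_sphere[OF X[of j] r(1)]
          continuous_grad_on_sphere[OF X[of j] r(1)]]
      by (simp add: algebra_simps)
    then show ?thesis using r(2) by (simp add: usphere_cmult)
  qed
  have "usphere ?L - usphere ?R = usphere (\<lambda>w. ?L w - ?R w)"
    unfolding divg_def by (rule usphere_diff[symmetric]; intro continuous_intros c)
  also have "\<dots> = usphere (\<lambda>w. \<Sum>j\<in>UNIV. \<Sum>k\<in>UNIV. v $ k *
      (w $ j * pdiff k (X j) (p + r *\<^sub>R w) - w $ k * pdiff j (X j) (p + r *\<^sub>R w)))"
    by (intro usphere_cong)
       (simp add: divg_def inner_vec_def sum_subtractf sum_distrib_left sum_distrib_right algebra_simps)
  also have "\<dots> = (\<Sum>j\<in>UNIV. \<Sum>k\<in>UNIV. v $ k *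
      usphere (\<lambda>w. w $ j * pdiff k (X j) (p + r *\<^sub>R w) - w $ k * pdiff j (X j) (p + r *\<^sub>R w)))"
    unfolding usphere_cmult[symmetric]
    by (subst usphere_sum, simp, intro continuous_intros c)
       (intro sum.cong refl usphere_sum finite continuous_intros c)
  finally show ?thesis by (simp add: z)
qed

text \<open>Sum of the tangential identities for X_j in direction j: the full divergence is the
  tangential one plus the radial derivative of the radial component, and the 2 is the mean curvature
  of the unit sphere.\<close>

lemma usphere_radial_divergence:
  assumes X: "\<And>j. c1_outside K (X j)" and r: "K + norm p < r"
  shows "usphere (\<lambda>w. r * (\<Sum>j\<in>UNIV. \<Sum>k\<in>UNIV. w $ k * pdiff k (X j) (p + r *\<^sub>R w) * w $ j)
           + 2 * (\<Sum>j\<in>UNIV. X j (p + r *\<^sub>R w) * w $ j))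
       = r * usphere (\<lambda>w. divg X (p + r *\<^sub>R w))" (is "usphere ?L = _")
proof -
  note c = continuous_on_sphere_compose[OF c1_outside_continuous(1)[OF X] r]
           continuous_on_sphere_compose[OF c1_outside_continuous(2)[OF X] r]
  define T where "T j w = r * pdiff j (X j) (p + r *\<^sub>R w)
    - w $ j * (\<Sum>k\<in>UNIV. r * pdiff k (X j) (p + r *\<^sub>R w) * w $ k) - 2 * w $ j * X j (p + r *\<^sub>R w)" for j w
  have T0: "usphere (T j) = 0" for j
    using usphere_tangential[where i = j, OF has_derivative_on_sphere[OF X[of j] r] continuous_grad_on_sphere[OF X[of j] r]]
    by (simp add: inner_vec_def T_def[abs_def])
  have "usphere (\<lambda>w. r * divg X (p + r *\<^sub>R w)) - usphere ?L = usphere (\<lambda>w. r * divg X (p + r *\<^sub>R w) - ?L w)"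
    unfolding divg_def by (rule usphere_diff[symmetric]; intro continuous_intros c)
  also have "\<dots> = usphere (\<lambda>w. \<Sum>j\<in>UNIV. T j w)"
    by (intro usphere_cong)
       (simp add: T_def divg_def sum_subtractf sum.distrib sum_distrib_left algebra_simps)
  also have "\<dots> = (\<Sum>j\<in>UNIV. usphere (T j))"
    unfolding T_def by (intro usphere_sum finite continuous_intros c)
  finally show ?thesis by (simp add: T0 usphere_cmult)
qed

text \<open>The points \<open>s b + (\<alpha> + s \<beta>) w\<close> cover both the dilations and the translations of a sphere.\<close>

lemma usphere_flux_derivative:
  fixes b :: "real^3" and \<alpha> \<beta> :: real
  defines "N \<equiv> \<lambda>s w. s *\<^sub>R b + (\<alpha> + s * \<beta>) *\<^sub>R w"
  assumes X: "\<And>j. c1_outside K (X j)"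
    and N: "\<And>s w. s \<in> U \<Longrightarrow> norm w = 1 \<Longrightarrow> K < norm (N s w)"
    and U: "s\<^sub>0 \<in> U" "convex U"
  shows "((\<lambda>s. usphere (\<lambda>w. \<Sum>j\<in>UNIV. X j (N s w) * w $ j)) has_real_derivative
      usphere (\<lambda>w. \<Sum>j\<in>UNIV. \<Sum>k\<in>UNIV. (b + \<beta> *\<^sub>R w) $ k * pdiff k (X j) (N s\<^sub>0 w) * w $ j)) (at s\<^sub>0 within U)"
proof (rule usphere_leibniz[OF _ _ _ U])
  fix s w assume s: "s \<in> U" "norm (w :: real^3) = 1"
  have "((\<lambda>s. X j (N s w)) has_real_derivative (\<Sum>k\<in>UNIV. (b + \<beta> *\<^sub>R w) $ k * pdiff k (X j) (N s w))) (at s within U)" for j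
  proof -
    have "X j differentiable (at (N s w))"
      using X N[OF s] unfolding c1_outside_def by blast
    moreover have "((\<lambda>s. N s w) has_derivative (\<lambda>t. t *\<^sub>R (b + \<beta> *\<^sub>R w))) (at s within U)"
      unfolding N_def by (auto intro!: derivative_eq_intros simp: algebra_simps)
    ultimately have "((\<lambda>s. X j (N s w)) has_derivative
        (\<lambda>t. \<Sum>k\<in>UNIV. (t *\<^sub>R (b + \<beta> *\<^sub>R w)) $ k * pdiff k (X j) (N s w))) (at s within U)"
      using has_derivative_compose has_derivative_pdiff by blast
    moreover have "(\<lambda>t. \<Sum>k\<in>UNIV. (t *\<^sub>R (b + \<beta> *\<^sub>R w)) $ k * pdiff k (X j) (N s w))
        = (*) (\<Sum>k\<in>UNIV. (b + \<beta> *\<^sub>R w) $ k * pdiff k (X j) (N s w))"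
      by (simp add: fun_eq_iff sum_distrib_left mult_ac)
    ultimately show ?thesis by (simp only: has_field_derivative_def)
  qed
  then have "((\<lambda>s. \<Sum>j\<in>UNIV. X j (N s w) * w $ j) has_real_derivative
      (\<Sum>j\<in>UNIV. (\<Sum>k\<in>UNIV. (b + \<beta> *\<^sub>R w) $ k * pdiff k (X j) (N s w)) * w $ j)) (at s within U)"
    by (intro DERIV_sum DERIV_cmult_right)
  then show "((\<lambda>s. \<Sum>j\<in>UNIV. X j (N s w) * w $ j) has_real_derivative
      (\<Sum>j\<in>UNIV. \<Sum>k\<in>UNIV. (b + \<beta> *\<^sub>R w) $ k * pdiff k (X j) (N s w) * w $ j)) (at s within U)"
    by (simp only: sum_distrib_right)
next
  fix s assume s: "s \<in> U"
  have "continuous_on (sphere 0 1) (\<lambda>w. X j (N s w))" for j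
    by (rule continuous_on_compose2[OF c1_outside_continuous(1)[OF X]])
       (auto simp: N_def intro!: continuous_intros N[OF s, unfolded N_def])
  then show "continuous_on (sphere 0 1) (\<lambda>w. \<Sum>j\<in>UNIV. X j (N s w) * w $ j)"
    by (intro continuous_intros)
next
  have "continuous_on (U \<times> sphere 0 1) (\<lambda>y. pdiff k (X j) (N (fst y) (snd y)))" for j k
    by (rule continuous_on_compose2[OF c1_outside_continuous(2)[OF X]])
       (auto simp: N_def intro!: continuous_intros N[unfolded N_def])
  then show "continuous_on (U \<times> sphere 0 1) (\<lambda>(s, w). \<Sum>j\<in>UNIV. \<Sum>k\<in>UNIV.
      (b + \<beta> *\<^sub>R w) $ k * pdiff k (X j) (N s w) * w $ j)"
    unfolding case_prod_unfold by (intro continuous_intros)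
qed

text \<open>Differentiating the field and differentiating r^2 give exactly the two terms of
  \<open>usphere_radial_divergence\<close>: the divergence theorem on an infinitesimal
  shell.\<close>

lemma flux_derivative_radius:
  assumes X: "\<And>j. c1_outside K (X j)" and r: "K < r" "0 < r"
  shows "((\<lambda>r. flux X 0 r) has_real_derivative r\<^sup>2 * usphere (\<lambda>w. divg X (r *\<^sub>R w))) (at r)"
proof -
  have r': "K + norm (0::real^3) < r" using r by simp
  note c = continuous_on_sphere_compose[OF c1_outside_continuous(1)[OF X] r', simplified]
           continuous_on_sphere_compose[OF c1_outside_continuous(2)[OF X] r', simplified]
  define Q where "Q w = (\<Sum>j\<in>UNIV. \<Sum>k\<in>UNIV. w $ k * pdiff k (X j) (r *\<^sub>R w) * w $ j)" for w
  define P where "P r w = (\<Sum>j\<in>UNIV. X j (r *\<^sub>R w) * w $ j)" for r w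
  \<comment> \<open>Dilation is the case of velocity 0 for the centre and radius s itself; the open
    half-line keeps all spheres outside the ball.\<close>
  have "((\<lambda>r. usphere (P r)) has_real_derivative usphere Q) (at r within {max K 0<..})"
    using usphere_flux_derivative[of K X "{max K 0<..}" 0 0 1 r, OF X] r
    by (simp add: P_def[abs_def] Q_def[abs_def])
  moreover have "at r within {max K 0<..} = at r"
    using r by (intro at_within_open) auto
  ultimately have "((\<lambda>r. usphere (P r)) has_real_derivative usphere Q) (at r)"
    by simp
  then have "((\<lambda>r. r\<^sup>2 * usphere (P r)) has_real_derivative r * (r * usphere Q + 2 * usphere (P r))) (at r)"
    by (auto intro!: derivative_eq_intros simp: power2_eq_square algebra_simps)
  moreover have "r * usphere Q + 2 * usphere (P r) = usphere (\<lambda>w. r * Q w + 2 * P r w)"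
    unfolding usphere_cmult[symmetric] unfolding Q_def P_def
    by (rule usphere_add[symmetric]; intro continuous_intros c)
  moreover have "\<dots> = r * usphere (\<lambda>w. divg X (r *\<^sub>R w))"
    using usphere_radial_divergence[OF X r'] by (simp add: Q_def P_def)
  ultimately show ?thesis by (simp add: flux_def P_def[abs_def] power2_eq_square mult.assoc)
qed

text \<open>The sphere moves rigidly, so its surface element sweeps out volume at the normal speed p
  . w. The lower bound on r keeps every intermediate sphere outside the ball.\<close>

lemma flux_derivative_center:
  assumes X: "\<And>j. c1_outside K (X j)" and r: "K + norm p < r" "0 < r" and s: "s \<in> {0..1}"
  shows "((\<lambda>s. flux X (s *\<^sub>R p) r) has_real_derivative
      r\<^sup>2 * usphere (\<lambda>w. divg X (s *\<^sub>R p + r *\<^sub>R w) * (p \<bullet> w))) (at s within {0..1})"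
proof -
  have K: "K + norm (s *\<^sub>R p) < r" if "s \<in> {0..1}" for s
  proof -
    have "norm (s *\<^sub>R p) \<le> norm p" using that by (auto intro: mult_left_le_one_le)
    then show ?thesis using r by linarith
  qed
  have "((\<lambda>s. usphere (\<lambda>w. \<Sum>j\<in>UNIV. X j (s *\<^sub>R p + r *\<^sub>R w) * w $ j)) has_real_derivative
      usphere (\<lambda>w. \<Sum>j\<in>UNIV. \<Sum>k\<in>UNIV. p $ k * pdiff k (X j) (s *\<^sub>R p + r *\<^sub>R w) * w $ j)) (at s within {0..1})"
    using usphere_flux_derivative[of K X "{0..1}" p r 0 s, OF X] norm_add_sphere_gt[OF K] s by simp
  then have "((\<lambda>s. usphere (\<lambda>w. \<Sum>j\<in>UNIV. X j (s *\<^sub>R p + r *\<^sub>R w) * w $ j)) has_real_derivative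
      usphere (\<lambda>w. divg X (s *\<^sub>R p + r *\<^sub>R w) * (p \<bullet> w))) (at s within {0..1})"
    using usphere_directional_divergence[OF X K[OF s]] r(2) by simp
  then show ?thesis unfolding flux_def by (rule DERIV_cmult)
qed

section \<open>Rates of convergence\<close>

lemma bigo_at_topE:
  fixes f :: "real \<Rightarrow> real"
  assumes "f \<in> O[at_top](\<lambda>r. r powr a)"
  obtains C K where "C > 0" "K > 0" "\<And>r. K \<le> r \<Longrightarrow> \<bar>f r\<bar> \<le> C * r powr a"
proof -
  obtain C where C: "C > 0" "\<forall>\<^sub>F r in at_top. norm (f r) \<le> C * norm (r powr a)"
    using assms by (elim landau_o.bigE)
  then obtain K where "\<And>r. K \<le> r \<Longrightarrow> \<bar>f r\<bar> \<le> C * r powr a"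
    by (auto simp: eventually_at_top_linorder)
  then show ?thesis using that[of C "max K 1"] C(1) by simp
qed

lemma bigo_at_infinityE:
  fixes f :: "real^3 \<Rightarrow> real"
  assumes "f \<in> O[at_infinity](\<lambda>x. norm x powr a)"
  obtains C K where "C > 0" "K > 0" "\<And>x. K \<le> norm x \<Longrightarrow> \<bar>f x\<bar> \<le> C * norm x powr a"
proof -
  obtain C where C: "C > 0" "\<forall>\<^sub>F x in at_infinity. norm (f x) \<le> C * norm (norm x powr a)"
    using assms by (elim landau_o.bigE)
  then obtain K where "\<And>x. K \<le> norm x \<Longrightarrow> \<bar>f x\<bar> \<le> C * norm x powr a"
    by (auto simp: eventually_at_infinity)
  then show ?thesis using that[of C "max K 1"] C(1) by simp
qed

text \<open>\<open>F \<plusminus> C R\<^sup>1\<^sup>-\<^sup>s / (s - 1)\<close> is monotone.\<close>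

lemma convergent_rate_of_derivative_bound:
  fixes F F' :: "real \<Rightarrow> real"
  assumes deriv: "\<And>r. K < r \<Longrightarrow> (F has_real_derivative F' r) (at r)"
    and F': "F' \<in> O[at_top](\<lambda>r. r powr (- s))" and s: "s > 1"
  shows "\<exists>L. (\<lambda>r. F r - L) \<in> O[at_top](\<lambda>r. r powr (1 - s))"
proof -
  obtain C K' where C: "C > 0" "K' > 0" "\<And>r. K' \<le> r \<Longrightarrow> \<bar>F' r\<bar> \<le> C * r powr (- s)"
    using bigo_at_topE[OF F'] by blast
  define M where "M = max (K + 1) K'"
  \<comment> \<open>The integral of C t^(-s) over t from r to infinity.\<close>
  define P where "P r = C / (s - 1) * r powr (1 - s)" for r
  have M: "M > 0" "M > K" "M \<ge> K'" using C(2) by (auto simp: M_def)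
  have dP: "(P has_real_derivative - (C * r powr (- s))) (at r)" if "M \<le> r" for r
  proof -
    have "(P has_real_derivative C / (s - 1) * ((1 - s) * r powr (1 - s - 1))) (at r)"
      unfolding P_def using that M by (intro DERIV_cmult has_real_derivative_powr) auto
    moreover have "C / (s - 1) * ((1 - s) * x) = - (C * x)" for x
      using s by (simp add: divide_simps) (simp add: algebra_simps)
    ultimately show ?thesis by simp
  qed
  have up: "F r - P r \<le> F r' - P r'" and down: "F r' + P r' \<le> F r + P r" if "M \<le> r" "r \<le> r'" for r r'
  proof -
    show "F r - P r \<le> F r' - P r'"
    proof (rule DERIV_nonneg_imp_nondecreasing[OF that(2)])
      fix x assume x: "r \<le> x" "x \<le> r'"
      have "((\<lambda>r. F r - P r) has_real_derivative F' x - - (C * x powr (- s))) (at x)"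
        using x that M by (intro DERIV_diff deriv dP) auto
      moreover have "\<bar>F' x\<bar> \<le> C * x powr (- s)" using x that M by (intro C(3)) auto
      ultimately show "\<exists>y. ((\<lambda>r. F r - P r) has_real_derivative y) (at x) \<and> 0 \<le> y"
        by (intro exI conjI) (assumption, linarith)
    qed
    show "F r' + P r' \<le> F r + P r"
    proof (rule DERIV_nonpos_imp_nonincreasing[OF that(2)])
      fix x assume x: "r \<le> x" "x \<le> r'"
      have "((\<lambda>r. F r + P r) has_real_derivative F' x + - (C * x powr (- s))) (at x)"
        using x that M by (intro DERIV_add deriv dP) auto
      moreover have "\<bar>F' x\<bar> \<le> C * x powr (- s)" using x that M by (intro C(3)) auto
      ultimately show "\<exists>y. ((\<lambda>r. F r + P r) has_real_derivative y) (at x) \<and> y \<le> 0"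
        by (intro exI conjI) (assumption, linarith)
    qed
  qed
  define L where "L = (SUP r\<in>{M..}. F r - P r)"
  have P0: "P r \<ge> 0" for r using C(1) s by (simp add: P_def)
  \<comment> \<open>Every lower value lies below every upper value, so the supremum L of the lower
    ones separates the two families.\<close>
  have le: "F r - P r \<le> F r' + P r'" if "M \<le> r" "M \<le> r'" for r r'
  proof (cases "r \<le> r'")
    case True then show ?thesis using up[of r r'] P0[of r'] that by simp
  next
    case False then show ?thesis using down[of r' r] P0[of r] that by simp
  qed
  have "F r - P r \<le> L" if "M \<le> r" for r
    unfolding L_def using that by (intro cSUP_upper bdd_aboveI2[where M = "F M + P M"] le) auto
  moreover have "L \<le> F r + P r" if "M \<le> r" for r
    unfolding L_def using that by (intro cSUP_least le) auto
  ultimately have "\<bar>F r - L\<bar> \<le> P r" if "M \<le> r" for r using that by (simp add: abs_le_iff) (smt (verit))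
  then have "(\<lambda>r. F r - L) \<in> O[at_top](\<lambda>r. r powr (1 - s))"
    by (intro bigoI[of _ "C / (s - 1)"]) (auto simp: eventually_at_top_linorder P_def intro!: exI[of _ M])
  then show ?thesis ..
qed

lemma eventually_par_continuous:
  assumes "parity_decay \<sigma> a f"
  shows "\<forall>\<^sub>F R in at_top. continuous_on (sphere 0 1) (\<lambda>w. f (R *\<^sub>R w))"
proof -
  obtain K where K: "\<And>x. K \<le> norm x \<Longrightarrow> isCont f x"
    using par_cont[OF assms] unfolding eventually_at_infinity by blast
  have "continuous_on (sphere 0 1) (\<lambda>w. f (R *\<^sub>R w))" if "K < R" for R
    by (rule continuous_on_sphere_compose[of K _ 0, simplified])
       (use that K in \<open>auto intro!: continuous_at_imp_continuous_on\<close>)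
  then show ?thesis by (intro eventually_mono[OF eventually_gt_at_top[of K]])
qed

text \<open>Antipodal points cancel to leading order.\<close>

lemma usphere_odd_decay:
  assumes f: "parity_decay (- 1) b f"
  shows "(\<lambda>R. usphere (\<lambda>w. f (R *\<^sub>R w))) \<in> O[at_top](\<lambda>R. R powr (- b - 1))"
proof -
  obtain C K where C: "C > 0" "K > 0" "\<And>x. K \<le> norm x \<Longrightarrow> \<bar>f x - (-1) * f (- x)\<bar> \<le> C * norm x powr (- b - 1)"
    using bigo_at_infinityE[OF par_parity[OF f]] by blast
  show ?thesis
  proof (rule bigoI)
    show "\<forall>\<^sub>F R in at_top. norm (usphere (\<lambda>w. f (R *\<^sub>R w))) \<le> (pi\<^sup>2 * C) * norm (R powr (- b - 1))"
      using eventually_par_continuous[OF f] eventually_ge_at_top[of K]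
    proof eventually_elim
      case (elim R)
      have c: "continuous_on (sphere 0 1) (\<lambda>w. f (R *\<^sub>R (- w)))"
        by (rule continuous_on_compose2[OF elim(1)]) (auto intro!: continuous_intros)
      have "2 * usphere (\<lambda>w. f (R *\<^sub>R w)) = usphere (\<lambda>w. f (R *\<^sub>R w)) + usphere (\<lambda>w. f (R *\<^sub>R (- w)))"
        using usphere_uminus[OF elim(1)] by simp
      also have "\<dots> = usphere (\<lambda>w. f (R *\<^sub>R w) + f (R *\<^sub>R (- w)))"
        by (rule usphere_add[OF elim(1) c, symmetric])
      finally have "\<bar>2 * usphere (\<lambda>w. f (R *\<^sub>R w))\<bar> = \<bar>usphere (\<lambda>w. f (R *\<^sub>R w) + f (R *\<^sub>R (- w)))\<bar>"
        by simp
      also have "\<dots> \<le> 2 * pi\<^sup>2 * (C * R powr (- b - 1))"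
      proof (rule usphere_bound)
        fix w :: "real^3" assume "norm w = 1"
        then show "\<bar>f (R *\<^sub>R w) + f (R *\<^sub>R (- w))\<bar> \<le> C * R powr (- b - 1)"
          using C(3)[of "R *\<^sub>R w"] elim(2) C(2) by simp
      qed (intro continuous_intros elim(1) c)
      finally show ?case by simp
    qed
  qed
qed

text \<open>The radial derivative is of order r^2 r^(-(2q+1)-1) = r^(-2q), the last -1 being the
  gain from oddness; q > 1/2 makes this integrable. Moving the centre is estimated without
  cancellation, at r^2 r^(-(2q+1)) = r^(1-2q), which is just the rate of convergence.\<close>

lemma flux_limit:
  assumes X: "\<And>j. c1_outside K (X j)" and div: "parity_decay (- 1) (2 * q + 1) (divg X)" and q: "q > 1 / 2"
  shows "\<exists>L. \<forall>p. (\<lambda>R. flux X p R - L) \<in> O[at_top](\<lambda>R. R powr (1 - 2 * q))"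
proof -
  have "(\<lambda>r. r\<^sup>2 * usphere (\<lambda>w. divg X (r *\<^sub>R w))) \<in> O[at_top](\<lambda>r. r\<^sup>2 * r powr (- (2 * q + 1) - 1))"
    by (intro landau_o.big.mult_left usphere_odd_decay div)
  also have "(\<lambda>r::real. r\<^sup>2 * r powr (- (2 * q + 1) - 1)) \<in> O[at_top](\<lambda>r. r powr (- (2 * q)))"
    by (intro bigoI[of _ 1] eventually_mono[OF eventually_gt_at_top[of 0]])
       (auto simp: powr_add[symmetric] simp flip: powr_numeral)
  finally have "\<exists>L. (\<lambda>r. flux X 0 r - L) \<in> O[at_top](\<lambda>r. r powr (1 - 2 * q))"
    using q by (intro convergent_rate_of_derivative_bound[of "max K 0"])
      (auto intro!: flux_derivative_radius[OF X])
  then obtain L where L: "(\<lambda>r. flux X 0 r - L) \<in> O[at_top](\<lambda>r. r powr (1 - 2 * q))" ..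
  have "(\<lambda>R. flux X p R - L) \<in> O[at_top](\<lambda>R. R powr (1 - 2 * q))" for p
  proof -
    obtain C K' where C: "C > 0" "K' > 0" "\<And>x. K' \<le> norm x \<Longrightarrow> \<bar>divg X x\<bar> \<le> C * norm x powr (- (2 * q + 1))"
      using bigo_at_infinityE[OF par_bigo[OF div]] by blast
    define B where "B = 2 * pi\<^sup>2 * (C * 2 powr (2 * q + 1) * norm p)"
    have "(\<lambda>R. flux X p R - flux X 0 R) \<in> O[at_top](\<lambda>R. R powr (1 - 2 * q))"
    proof (rule bigoI)
      \<comment> \<open>For such R all spheres about s p stay at distance at least R / 2 \<ge> K'
        from the origin; the power of 2 in B pays for the half.\<close>
      have "\<bar>flux X p R - flux X 0 R\<bar> \<le> B * R powr (1 - 2 * q)" if R: "R > max K 0 + 2 * K' + 2 * norm p" for R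
      proof -
        have R': "K + norm p < R" "0 < R" "2 * K' \<le> R" "2 * norm p \<le> R" using R C(2) norm_ge_zero[of p] by linarith+
        have "norm (flux X (1 *\<^sub>R p) R - flux X (0 *\<^sub>R p) R) \<le> (B * R powr (1 - 2 * q)) * norm (1 - (0::real))"
        proof (rule field_differentiable_bound[of "{0..1}" "\<lambda>s. flux X (s *\<^sub>R p) R", OF _ flux_derivative_center[OF X R'(1,2)]])
          fix s :: real assume s: "s \<in> {0..1}"
          have sp: "norm (s *\<^sub>R p) \<le> norm p" using s by (auto intro: mult_left_le_one_le)
          have "\<bar>usphere (\<lambda>w. divg X (s *\<^sub>R p + R *\<^sub>R w) * (p \<bullet> w))\<bar>
              \<le> 2 * pi\<^sup>2 * (C * (R / 2) powr (- (2 * q + 1)) * norm p)"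
          proof (rule usphere_bound)
            show "continuous_on (sphere 0 1) (\<lambda>w. divg X (s *\<^sub>R p + R *\<^sub>R w) * (p \<bullet> w))"
              unfolding divg_def using R'(1) sp
              by (intro continuous_intros continuous_on_sphere_compose[OF c1_outside_continuous(2)[OF X]]) simp
            fix w :: "real^3" assume w: "norm w = 1"
            have "norm (R *\<^sub>R w) / 2 \<le> norm (s *\<^sub>R p + R *\<^sub>R w)"
              using sp R' w by (intro norm_shift_ge_half) simp
            then have x: "R / 2 \<le> norm (s *\<^sub>R p + R *\<^sub>R w)" using w R' by simp
            have "\<bar>divg X (s *\<^sub>R p + R *\<^sub>R w)\<bar> \<le> C * norm (s *\<^sub>R p + R *\<^sub>R w) powr (- (2 * q + 1))"
              using x R' by (intro C(3)) simp
            also have "\<dots> \<le> C * (R / 2) powr (- (2 * q + 1))"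
              using x R' C(1) q by (intro mult_left_mono powr_mono2') auto
            finally show "\<bar>divg X (s *\<^sub>R p + R *\<^sub>R w) * (p \<bullet> w)\<bar> \<le> C * (R / 2) powr (- (2 * q + 1)) * norm p"
              unfolding abs_mult using C(1) Cauchy_Schwarz_ineq2[of p w] w
              by (intro mult_mono) auto
          qed
          then have "norm (R\<^sup>2 * usphere (\<lambda>w. divg X (s *\<^sub>R p + R *\<^sub>R w) * (p \<bullet> w)))
              \<le> R\<^sup>2 * (2 * pi\<^sup>2 * (C * (R / 2) powr (- (2 * q + 1)) * norm p))"
            by (simp add: abs_mult mult_left_mono)
          also have "\<dots> = B * (R powr 2 * R powr (- (2 * q + 1)))"
          proof -
            have "(R / 2) powr (- a) = 2 powr a * R powr (- a)" for a
              using R'(2) by (simp add: powr_divide powr_minus field_simps)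
            from this[of "2 * q + 1"] show ?thesis using R'(2) by (simp add: B_def mult_ac)
          qed
          also have "\<dots> = B * R powr (1 - 2 * q)"
            unfolding powr_add[symmetric] by (simp add: algebra_simps)
          finally show "norm (R\<^sup>2 * usphere (\<lambda>w. divg X (s *\<^sub>R p + R *\<^sub>R w) * (p \<bullet> w))) \<le> B * R powr (1 - 2 * q)" .
        qed auto
        then show ?thesis by simp
      qed
      then show "\<forall>\<^sub>F R in at_top. norm (flux X p R - flux X 0 R) \<le> B * norm (R powr (1 - 2 * q))"
        by (intro eventually_mono[OF eventually_gt_at_top[of "max K 0 + 2 * K' + 2 * norm p"]]) simp
    qed
    from sum_in_bigo(1)[OF this L] show ?thesis by simp
  qed
  then show ?thesis by blast
qed

text \<open>The rate gives convergence, and this determines the value of \<open>Lim\<close> in the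
  definitions of mass and centre.\<close>

lemma Lim_of_rate:
  fixes f F :: "real \<Rightarrow> real"
  assumes "(\<lambda>R. F R - L) \<in> O[at_top](\<lambda>R. R powr (- s))" "s > 0" "\<forall>\<^sub>F R in at_top. f R = F R"
  shows "Lim at_top f = L"
proof -
  obtain C M where C: "\<And>r. M \<le> r \<Longrightarrow> \<bar>F r - L\<bar> \<le> C * r powr (- s)"
    using bigo_at_topE[OF assms(1)] by metis
  have "((\<lambda>r. r powr (- s)) \<longlongrightarrow> 0) at_top"
    using tendsto_neg_powr[of "- s" "\<lambda>x. x" at_top] assms(2) filterlim_ident by auto
  then have "((\<lambda>r. C * r powr (- s)) \<longlongrightarrow> 0) at_top" by (rule tendsto_mult_right_zero)
  then have "((\<lambda>r. F r - L) \<longlongrightarrow> 0) at_top"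
    by (rule Lim_null_comparison[rotated]) (auto simp: eventually_at_top_linorder intro!: exI[of _ M] C)
  then have "(F \<longlongrightarrow> L) at_top" by (simp add: LIM_zero_iff)
  then have "(f \<longlongrightarrow> L) at_top" using tendsto_cong[OF assms(3)] by blast
  then show ?thesis by (intro tendsto_Lim) auto
qed

section \<open>The inverse metric and the Christoffel symbols\<close>

lemma matrix_inv_eqs:
  fixes A :: "'a::field^'n^'n"
  assumes "det A \<noteq> 0"
  shows "A ** matrix_inv A = mat 1" "matrix_inv A ** A = mat 1"
proof -
  have "invertible A" using assms by (simp add: invertible_det_nz)
  then have "A ** matrix_inv A = mat 1 \<and> matrix_inv A ** A = mat 1"
    unfolding invertible_def matrix_inv_def by (rule someI_ex)
  then show "A ** matrix_inv A = mat 1" "matrix_inv A ** A = mat 1" by auto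
qed

text \<open>As quotients of polynomials in the entries of A, the entries of the inverse come within
  reach of the calculus of parity and decay.\<close>

lemma matrix_inv_cramer:
  fixes A :: "'a::field^'n^'n"
  assumes "det A \<noteq> 0"
  shows "matrix_inv A $ k $ j = det (\<chi> i m. if m = k then (if i = j then 1 else 0) else A $ i $ m) / det A"
proof -
  have "(A *v column j (matrix_inv A)) $ i = axis j 1 $ i" for i
  proof -
    have "(A ** matrix_inv A) $ i $ j = mat 1 $ i $ j" by (simp add: matrix_inv_eqs[OF assms])
    then show ?thesis
      by (simp add: matrix_matrix_mult_def matrix_vector_mult_def column_def mat_def axis_def eq_commute)
  qed
  then have "A *v column j (matrix_inv A) = axis j 1" by (simp add: vec_eq_iff)
  then have "column j (matrix_inv A) = (\<chi> k. det (\<chi> i m. if m = k then axis j 1 $ i else A $ i $ m) / det A)"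
    using cramer[OF assms] by blast
  then have "column j (matrix_inv A) $ k = det (\<chi> i m. if m = k then axis j 1 $ i else A $ i $ m) / det A"
    by simp
  then show ?thesis by (simp add: column_def axis_def cong: if_cong)
qed

lemma matrix_inv_symmetric:
  fixes A :: "'a::field^'n^'n"
  assumes "det A \<noteq> 0" "transpose A = A"
  shows "transpose (matrix_inv A) = matrix_inv A"
proof -
  have "transpose (matrix_inv A) = transpose (matrix_inv A) ** (A ** matrix_inv A)"
    by (simp add: matrix_inv_eqs[OF assms(1)])
  also have "\<dots> = transpose (A ** matrix_inv A) ** matrix_inv A"
    using assms(2) by (simp add: matrix_mul_assoc matrix_transpose_mul)
  finally show ?thesis by (simp add: matrix_inv_eqs[OF assms(1)])
qed

lemma transpose_eq_nth:
  assumes "transpose A = A" shows "A $ i $ j = A $ j $ i"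
proof -
  have "A $ i $ j = transpose A $ i $ j" using assms by simp
  also have "\<dots> = A $ j $ i" by (simp add: transpose_def)
  finally show ?thesis .
qed

text \<open>The resolvent identity; it lets the inverse metric be differentiated knowing only its
  continuity.\<close>

lemma matrix_inv_difference:
  fixes A B :: "'a::field^'n^'n"
  assumes "det A \<noteq> 0" "det B \<noteq> 0"
  shows "matrix_inv B - matrix_inv A = matrix_inv B ** (A - B) ** matrix_inv A"
proof -
  have l: "C ** (A - B) = C ** A - C ** B" for C :: "'a^'n^'n"
    by (vector matrix_matrix_mult_def sum_subtractf right_diff_distrib)
  have r: "(A - B) ** C = A ** C - B ** C" for A B C :: "'a^'n^'n"
    by (vector matrix_matrix_mult_def sum_subtractf left_diff_distrib)
  have "matrix_inv B ** (A - B) ** matrix_inv A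
      = matrix_inv B ** (A ** matrix_inv A) - (matrix_inv B ** B) ** matrix_inv A"
    by (simp add: matrix_mul_assoc l r)
  then show ?thesis using assms by (simp add: matrix_inv_eqs)
qed

lemma par_det:
  fixes B :: "real^3 \<Rightarrow> real^3^3"
  assumes "\<And>i j. parity_decay 1 0 (\<lambda>x. B x $ i $ j)"
  shows "parity_decay 1 0 (\<lambda>x. det (B x))"
  unfolding det_3 by (intro par_add par_diff par_mult0 assms)

lemma sum_mat_1 [simp]:
  "(\<Sum>k\<in>UNIV. (mat 1 :: 'a::comm_semiring_1^'n^'n) $ i $ k * f k) = f i"
  "(\<Sum>k\<in>UNIV. f k * (mat 1 :: 'a::comm_semiring_1^'n^'n) $ k $ i) = f i"
  by (simp_all add: mat_def if_distrib if_distribR cong: if_cong)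

text \<open>The first-order asymptotics behind the mean curvature expansion. Being stable under
  translation, they can be instantiated with \<open>\<lambda>y. g (p + y)\<close> for any centre
  p.\<close>

locale decaying_metric =
  fixes g :: "real^3 \<Rightarrow> real^3^3" and q :: real
  assumes q_pos: "q > 0"
    and sym: "\<forall>\<^sub>F x in at_infinity. transpose (g x) = g x"
    and diff: "\<forall>\<^sub>F x in at_infinity. \<forall>i j. (\<lambda>x. g x $ i $ j) differentiable (at x)"
    and decay_metric: "\<And>i j. parity_decay 1 q (\<lambda>x. g x $ i $ j - mat 1 $ i $ j)"
    and decay_deriv: "\<And>k i j. parity_decay (- 1) (q + 1) (pdiff k (\<lambda>x. g x $ i $ j))"
begin

definition h where "h i j x = g x $ i $ j - mat 1 $ i $ j"
definition dg where "dg k i j x = pdiff k (\<lambda>x. g x $ i $ j) x"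
definition a where "a i j x = metric_inv g x $ i $ j"
definition b where "b i j x = a i j x - mat 1 $ i $ j"

lemma par_h: "parity_decay 1 q (h i j)" using decay_metric by (simp add: h_def[abs_def])
lemma par_dg: "parity_decay (- 1) (q + 1) (dg k i j)" using decay_deriv by (simp add: dg_def[abs_def])

lemma par_g: "parity_decay 1 0 (\<lambda>x. g x $ i $ j)"
proof -
  have "parity_decay 1 0 (\<lambda>x. h i j x + mat 1 $ i $ j)"
    using q_pos by (intro par_add par_const par_mono[OF par_h]) simp
  then show ?thesis by (simp add: h_def)
qed

text \<open>The determinant tends to det 1 = 1; any constant strictly between 0 and 1 would serve as
  the lower bound that \<open>par_inverse\<close> asks for.\<close>

lemma det_ge: "\<forall>\<^sub>F x in at_infinity. 1 / 2 \<le> det (g x)"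
proof -
  have "((\<lambda>x. g x $ i $ j) \<longlongrightarrow> mat 1 $ i $ j) at_infinity" for i j
    using tendsto_add[OF par_tendsto_zero[OF par_h q_pos, of i j] tendsto_const[of "mat 1 $ i $ j"]]
    by (simp add: h_def)
  then have "((\<lambda>x. det (g x)) \<longlongrightarrow> det (mat 1 :: real^3^3)) at_infinity"
    unfolding det_3 by (intro tendsto_add tendsto_diff tendsto_mult)
  then have "\<forall>\<^sub>F x in at_infinity. 1 / 2 < det (g x)"
    by (rule order_tendstoD) simp
  then show ?thesis by (auto elim: eventually_mono)
qed

lemma par_a: "parity_decay 1 0 (a i j)"
proof (rule par_cong)
  let ?C = "\<lambda>x. \<chi> r s. if s = i then (if r = j then 1 else 0) else g x $ r $ s"
  have "parity_decay 1 0 (\<lambda>x. ?C x $ r $ s)" for r s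
    by (cases "s = i") (auto intro: par_const par_g)
  then show "parity_decay 1 0 (\<lambda>x. det (?C x) * (1 / det (g x)))"
    by (intro par_mult0 par_det par_inverse[OF _ _ det_ge] par_g) auto
  show "\<forall>\<^sub>F x in at_infinity. det (?C x) * (1 / det (g x)) = a i j x"
    using det_ge by eventually_elim (simp add: a_def metric_inv_def matrix_inv_cramer)
qed

text \<open>This is g^-1 g = 1 with g = \<delta> + h. It transfers the decay of h to the
  perturbation b of the inverse.\<close>

lemma b_eq: "\<forall>\<^sub>F x in at_infinity. b i j x = - (\<Sum>k\<in>UNIV. a i k x * h k j x)"
  using det_ge
proof eventually_elim
  case (elim x)
  then have "(metric_inv g x ** g x) $ i $ j = mat 1 $ i $ j"
    unfolding metric_inv_def by (subst matrix_inv_eqs) auto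
  then have "(\<Sum>k\<in>UNIV. a i k x * (h k j x + mat 1 $ k $ j)) = mat 1 $ i $ j"
    by (simp add: matrix_matrix_mult_def a_def h_def)
  then show ?case by (simp add: distrib_left sum.distrib b_def)
qed

lemma a_eq: "a i j x = mat 1 $ i $ j + b i j x" by (simp add: b_def)

lemma par_b: "parity_decay 1 q (b i j)"
proof (rule par_weaken)
  show "parity_decay 1 q (\<lambda>x. - (\<Sum>k\<in>UNIV. a i k x * h k j x))"
    using par_mult[OF par_a par_h] by (intro par_uminus par_sum) simp
  show "\<forall>\<^sub>F x in at_infinity. - (\<Sum>k\<in>UNIV. a i k x * h k j x) = b i j x"
    using b_eq[of i j] by eventually_elim simp
qed auto

text \<open>Inserting a = \<delta> + b into \<open>b_eq\<close> gives b + h = - b h, which is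
  quadratic in the perturbation.\<close>

lemma par_bh: "parity_decay 1 (2 * q) (\<lambda>x. b i j x + h i j x)"
proof (rule par_weaken)
  show "parity_decay 1 (q + q) (\<lambda>x. - (\<Sum>k\<in>UNIV. b i k x * h k j x))"
    using par_mult[OF par_b par_h] by (intro par_uminus par_sum) simp
  show "\<forall>\<^sub>F x in at_infinity. - (\<Sum>k\<in>UNIV. b i k x * h k j x) = b i j x + h i j x"
    using b_eq[of i j] by eventually_elim (simp add: a_eq distrib_right sum.distrib)
qed auto

lemma a_sym: "\<forall>\<^sub>F x in at_infinity. \<forall>i j. a i j x = a j i x"
  using det_ge sym
proof eventually_elim
  case (elim x)
  then have "transpose (metric_inv g x) = metric_inv g x"
    unfolding metric_inv_def by (intro matrix_inv_symmetric) auto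
  then show ?case unfolding a_def by (blast intro: transpose_eq_nth)
qed

text \<open>The classical formula for the derivative of an inverse matrix, taken as definition: its
  decay is then pure algebra, and \<open>a_has_derivative\<close> identifies it with the actual
  derivative near infinity.\<close>

definition da where
  "da m i j x = - (\<Sum>k\<in>UNIV. \<Sum>l\<in>UNIV. a i k x * dg m k l x * a l j x)"

text \<open>By the resolvent identity the difference quotient of the inverse is a sum of products of
  inverse entries, continuous at x, with difference quotients of g.\<close>

lemma a_has_derivative:
  "\<forall>\<^sub>F x in at_infinity. \<forall>m i j. ((\<lambda>t. a i j (x + t *\<^sub>R axis m 1)) has_real_derivative da m i j x) (at 0)"
proof -
  have cont: "\<forall>\<^sub>F x in at_infinity. \<forall>i j. isCont (a i j) x"
    by (intro eventually_all_finite par_cont[OF par_a])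
  show ?thesis
    using cont diff eventually_at_infinity_nhds[OF det_ge]
  proof eventually_elim
    case (elim x)
    show ?case
    proof (intro allI)
      fix m i j
      define X where "X t = x + t *\<^sub>R axis m 1" for t
      have X: "(X \<longlongrightarrow> x) (at 0)"
        unfolding X_def by (auto intro!: tendsto_eq_intros)
      have det_x: "1 / 2 \<le> det (g x)" using elim(3) by (rule eventually_nhds_x_imp_x)
      from X have "\<forall>\<^sub>F t in at 0. 1 / 2 \<le> det (g (X t))"
        using elim(3) unfolding filterlim_iff by blast
      then have ev: "\<forall>\<^sub>F t in at 0. - (\<Sum>k\<in>UNIV. \<Sum>l\<in>UNIV. a i k (X t) *
          ((g (X t) $ k $ l - g x $ k $ l) / t) * a l j x) = (a i j (X t) - a i j x) / t"
      proof eventually_elim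
        case (elim t)
        have "metric_inv g (X t) - metric_inv g x = metric_inv g (X t) ** (g x - g (X t)) ** metric_inv g x"
          unfolding metric_inv_def by (rule matrix_inv_difference) (use elim det_x in auto)
        then have "(metric_inv g (X t) - metric_inv g x) $ i $ j = (metric_inv g (X t) ** (g x - g (X t)) ** metric_inv g x) $ i $ j"
          by simp
        then have "a i j (X t) - a i j x = (\<Sum>l\<in>UNIV. (\<Sum>k\<in>UNIV. a i k (X t) * (g x $ k $ l - g (X t) $ k $ l)) * a l j x)"
          by (simp add: a_def matrix_matrix_mult_def)
        also have "\<dots> = - (\<Sum>k\<in>UNIV. \<Sum>l\<in>UNIV. a i k (X t) * (g (X t) $ k $ l - g x $ k $ l) * a l j x)"
          unfolding sum_distrib_right
          by (subst sum.swap) (simp add: sum_negf[symmetric] algebra_simps)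
        finally show ?case
          by (simp add: sum_divide_distrib)
      qed
      have "((\<lambda>t. - (\<Sum>k\<in>UNIV. \<Sum>l\<in>UNIV. a i k (X t) *
          ((g (X t) $ k $ l - g x $ k $ l) / t) * a l j x)) \<longlongrightarrow> da m i j x) (at 0)"
        unfolding da_def
      proof (intro tendsto_intros)
        fix k l
        show "((\<lambda>t. a i k (X t)) \<longlongrightarrow> a i k x) (at 0)"
          using elim(1) X by (auto intro: isCont_tendsto_compose)
        have "(\<lambda>x. g x $ k $ l) differentiable (at x)" using elim(2) by blast
        from pdiff_has_derivative[OF this, of m]
        show "((\<lambda>t. (g (X t) $ k $ l - g x $ k $ l) / t) \<longlongrightarrow> dg m k l x) (at 0)"
          by (simp add: DERIV_def X_def dg_def)
      qed
      then have "((\<lambda>t. (a i j (X t) - a i j x) / t) \<longlongrightarrow> da m i j x) (at 0)"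
        using tendsto_cong[OF ev] by blast
      then show "((\<lambda>t. a i j (x + t *\<^sub>R axis m 1)) has_real_derivative da m i j x) (at 0)"
        by (simp add: DERIV_def X_def)
    qed
  qed
qed

lemma par_da: "parity_decay (- 1) (q + 1) (da m i j)"
proof -
  have "parity_decay (- 1) (q + 1) (\<lambda>x. a i k x * dg m k l x * a l j x)" for k l
    using par_mult[OF par_mult[OF par_a par_dg] par_a] by simp
  then show ?thesis unfolding da_def[abs_def] by (intro par_uminus par_sum)
qed

text \<open>Splitting a = \<delta> + b in one factor after the other removes the linear part -dg of
  da; what remains carries a factor b.\<close>

lemma par_dadg: "parity_decay (- 1) (2 * q + 1) (\<lambda>x. da m i j x + dg m i j x)"
proof -
  have "parity_decay (- 1) (2 * q + 1) (\<lambda>x. - (\<Sum>k\<in>UNIV. \<Sum>l\<in>UNIV. b i k x * dg m k l x * a l j x) - (\<Sum>l\<in>UNIV. dg m i l x * b l j x))"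
  proof (intro par_diff par_uminus par_sum)
    show "parity_decay (- 1) (2 * q + 1) (\<lambda>x. b i k x * dg m k l x * a l j x)" for k l
      by (rule par_mult_le[OF par_mult[OF par_b par_dg] par_a]) auto
    show "parity_decay (- 1) (2 * q + 1) (\<lambda>x. dg m i l x * b l j x)" for l
      by (rule par_mult_le[OF par_dg par_b]) auto
  qed
  moreover have "- (\<Sum>k\<in>UNIV. \<Sum>l\<in>UNIV. b i k x * dg m k l x * a l j x) - (\<Sum>l\<in>UNIV. dg m i l x * b l j x)
      = da m i j x + dg m i j x" for x
  proof -
    have "(\<Sum>k\<in>UNIV. \<Sum>l\<in>UNIV. a i k x * dg m k l x * a l j x)
       = (\<Sum>k\<in>UNIV. \<Sum>l\<in>UNIV. b i k x * dg m k l x * a l j x) + (\<Sum>k\<in>UNIV. mat 1 $ i $ k * (\<Sum>l\<in>UNIV. dg m k l x * a l j x))"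
      unfolding sum.distrib[symmetric] sum_distrib_left
      by (intro sum.cong refl) (simp add: a_eq[of i] algebra_simps)
    also have "(\<Sum>k\<in>UNIV. mat 1 $ i $ k * (\<Sum>l\<in>UNIV. dg m k l x * a l j x)) = (\<Sum>l\<in>UNIV. dg m i l x * a l j x)"
      by simp
    also have "\<dots> = (\<Sum>l\<in>UNIV. dg m i l x * mat 1 $ l $ j) + (\<Sum>l\<in>UNIV. dg m i l x * b l j x)"
      unfolding sum.distrib[symmetric] by (intro sum.cong refl) (simp add: a_eq algebra_simps)
    finally show ?thesis by (simp add: da_def)
  qed
  ultimately show ?thesis by simp
qed

text \<open>Twice the Christoffel symbol of the first kind, with \<open>l\<close> the lowered
  index.\<close>

definition cc where "cc l i j x = dg i j l x + dg j i l x - dg l i j x"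
definition \<Gamma> where "\<Gamma> k i j x = (\<Sum>l\<in>UNIV. a k l x * cc l i j x) / 2"

lemma christoffel_eq: "christoffel g k i j = \<Gamma> k i j"
  by (simp add: fun_eq_iff christoffel_def \<Gamma>_def cc_def a_def dg_def)

lemma par_cc: "parity_decay (- 1) (q + 1) (cc l i j)"
  unfolding cc_def[abs_def] by (intro par_diff par_add par_dg)

lemma par_\<Gamma>: "parity_decay (- 1) (q + 1) (\<Gamma> k i j)"
proof -
  have "parity_decay (- 1) (q + 1) (\<lambda>x. a k l x * cc l i j x)" for l
    using par_mult[OF par_a par_cc] by simp
  then show ?thesis unfolding \<Gamma>_def[abs_def] by (intro par_half par_sum)
qed

lemma \<Gamma>_lin: "\<Gamma> k i j x = cc k i j x / 2 + (\<Sum>l\<in>UNIV. b k l x * cc l i j x) / 2"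
  by (simp add: \<Gamma>_def a_eq distrib_right sum.distrib add_divide_distrib)

lemma par_\<Gamma>cc: "parity_decay (- 1) (2 * q + 1) (\<lambda>x. \<Gamma> k i j x - cc k i j x / 2)"
proof -
  have "parity_decay (- 1) (2 * q + 1) (\<lambda>x. b k l x * cc l i j x)" for l
    by (rule par_mult_le[OF par_b par_cc]) auto
  then have "parity_decay (- 1) (2 * q + 1) (\<lambda>x. (\<Sum>l\<in>UNIV. b k l x * cc l i j x) / 2)"
    by (intro par_half par_sum)
  then show ?thesis by (simp add: \<Gamma>_lin)
qed

end

section \<open>Linearization of the curvatures\<close>

context decaying_metric
begin

definition \<omega> where "\<omega> i x = x $ i / norm x" for i :: 3 and x :: "real^3"
text \<open>The correction when \<omega> is raised with g: the vector g^-1 \<omega> is \<omega> +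
  \<beta>.\<close>

definition \<beta> where "\<beta> i x = (\<Sum>k\<in>UNIV. b i k x * \<omega> k x)"
definition \<epsilon> where "\<epsilon> x = (\<Sum>i\<in>UNIV. \<omega> i x * \<beta> i x)"
text \<open>The contribution of the varying metric to the i-th derivative of the squared length of
  \<omega>, with \<omega> held fixed.\<close>

definition dN where "dN i x = (\<Sum>j\<in>UNIV. \<Sum>k\<in>UNIV. \<omega> j x * \<omega> k x * da i j k x)"
text \<open>As \<open>1 + \<epsilon> = g\<^sup>i\<^sup>j \<omega>\<^sub>i \<omega>\<^sub>j\<close>, the factor \<open>\<tau>\<close> normalises the covector \<open>\<omega>\<close> in \<open>g\<close>.\<close>

definition \<tau> where "\<tau> x = 1 / sqrt (1 + \<epsilon> x)"

text \<open>In the divergence of the normal some terms carry \<tau> and others, from differentiating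
  the normalization, -\<tau>^3 / 2. \<open>A1\<close> and \<open>B1\<close> are what these two
  groups add to their Euclidean values 3 / |x| and 2 / |x|.\<close>

definition A1 where
  "A1 x = (\<Sum>i\<in>UNIV. b i i x) * (1 / norm x) + (\<Sum>i\<in>UNIV. \<Sum>k\<in>UNIV. da i i k x * \<omega> k x)
     + (\<Sum>i\<in>UNIV. \<Sum>j\<in>UNIV. \<Gamma> i i j x * (\<omega> j x + \<beta> j x))"

definition B1 where
  "B1 x = 2 * ((2 * \<epsilon> x + (\<Sum>i\<in>UNIV. \<beta> i x * \<beta> i x)) * (1 / norm x)) + (\<Sum>i\<in>UNIV. (\<omega> i x + \<beta> i x) * dN i x)"

text \<open>Here and in \<open>B1_lin\<close>, b is replaced by -h, da by -dg, \<Gamma> by cc / 2,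
  and products of perturbations are dropped.\<close>

definition A1_lin where
  "A1_lin x = - (\<Sum>i\<in>UNIV. h i i x) * (1 / norm x) - (\<Sum>i\<in>UNIV. \<Sum>k\<in>UNIV. dg i i k x * \<omega> k x)
     + (\<Sum>i\<in>UNIV. \<Sum>j\<in>UNIV. cc i i j x / 2 * \<omega> j x)"

definition B1_lin where
  "B1_lin x = - 4 * ((\<Sum>i\<in>UNIV. \<omega> i x * (\<Sum>k\<in>UNIV. h i k x * \<omega> k x)) * (1 / norm x))
     - (\<Sum>i\<in>UNIV. \<omega> i x * (\<Sum>j\<in>UNIV. \<Sum>k\<in>UNIV. \<omega> j x * \<omega> k x * dg i j k x))"

lemma par_\<omega>: "parity_decay (- 1) 0 (\<omega> i)"
  unfolding \<omega>_def[abs_def] by (rule par_direction)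

lemma par_\<beta>: "parity_decay (- 1) q (\<beta> i)"
proof -
  have "parity_decay (- 1) q (\<lambda>x. b i k x * \<omega> k x)" for k by (rule par_mult_le[OF par_b par_\<omega>]) auto
  then show ?thesis unfolding \<beta>_def[abs_def] by (intro par_sum)
qed

lemma par_\<epsilon>: "parity_decay 1 q \<epsilon>"
proof -
  have "parity_decay 1 q (\<lambda>x. \<omega> i x * \<beta> i x)" for i by (rule par_mult_le[OF par_\<omega> par_\<beta>]) auto
  then show ?thesis unfolding \<epsilon>_def[abs_def] by (intro par_sum)
qed

lemma par_dN: "parity_decay (- 1) (q + 1) (dN i)"
proof -
  have "parity_decay (- 1) (q + 1) (\<lambda>x. \<omega> j x * \<omega> k x * da i j k x)" for j k
    by (rule par_mult_le[OF par_mult[OF par_\<omega> par_\<omega>] par_da]) auto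
  then show ?thesis unfolding dN_def[abs_def] by (intro par_sum)
qed

lemma \<epsilon>_ge: "\<forall>\<^sub>F x in at_infinity. 1 / 2 \<le> 1 + \<epsilon> x"
proof -
  have "((\<lambda>x. 1 + \<epsilon> x) \<longlongrightarrow> 1 + 0) at_infinity"
    using q_pos by (intro tendsto_intros par_tendsto_zero[OF par_\<epsilon>])
  then have "\<forall>\<^sub>F x in at_infinity. 1 / 2 < 1 + \<epsilon> x"
    by (rule order_tendstoD) simp
  then show ?thesis by (auto elim: eventually_mono)
qed

lemma par_\<epsilon>1: "parity_decay 1 0 (\<lambda>x. 1 + \<epsilon> x)"
  using q_pos by (intro par_add par_const par_mono[OF par_\<epsilon>]) simp

lemma par_\<tau>: "parity_decay 1 0 \<tau>"
proof -
  have ge: "\<forall>\<^sub>F x in at_infinity. sqrt (1 / 2) \<le> sqrt (1 + \<epsilon> x)"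
    using \<epsilon>_ge by eventually_elim (rule real_sqrt_le_mono)
  show ?thesis
    unfolding \<tau>_def[abs_def] by (intro par_inverse[OF _ _ ge] par_sqrt[OF par_\<epsilon>1 _ \<epsilon>_ge]) auto
qed

text \<open>Rationalizing the root writes \<tau> - 1 as \<epsilon> times an even bounded factor, so
  it inherits the decay of \<epsilon>.\<close>

lemma par_\<tau>1: "parity_decay 1 q (\<lambda>x. \<tau> x - 1)"
proof (rule par_weaken)
  have ge: "\<forall>\<^sub>F x in at_infinity. 1 \<le> 1 + sqrt (1 + \<epsilon> x)"
    using \<epsilon>_ge by eventually_elim simp
  have "parity_decay 1 0 (\<lambda>x. 1 / (1 + sqrt (1 + \<epsilon> x)))"
    by (intro par_inverse[OF _ _ ge] par_add par_const par_sqrt[OF par_\<epsilon>1 _ \<epsilon>_ge]) auto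
  then have "parity_decay 1 q (\<lambda>x. \<epsilon> x * \<tau> x * (1 / (1 + sqrt (1 + \<epsilon> x))))"
    by (intro par_mult_le[OF par_mult[OF par_\<epsilon> par_\<tau>]]) auto
  then show "parity_decay 1 q (\<lambda>x. - (\<epsilon> x * \<tau> x * (1 / (1 + sqrt (1 + \<epsilon> x)))))" by (rule par_uminus)
  show "\<forall>\<^sub>F x in at_infinity. - (\<epsilon> x * \<tau> x * (1 / (1 + sqrt (1 + \<epsilon> x)))) = \<tau> x - 1"
    using \<epsilon>_ge
  proof eventually_elim
    case (elim x)
    define r where "r = sqrt (1 + \<epsilon> x)"
    have r: "r > 0" "\<epsilon> x = r * r - 1" using elim by (auto simp: r_def)
    have "- ((r * r - 1) * (1 / r) * (1 / (1 + r))) = - ((r - 1) * (1 / r) * ((1 + r) * (1 / (1 + r))))"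
    proof -
      have "r * r - 1 = (r - 1) * (1 + r)" by (simp add: algebra_simps)
      then show ?thesis by (simp only: mult_ac)
    qed
    also have "(1 + r) * (1 / (1 + r)) = 1" using r(1) by simp
    also have "- ((r - 1) * (1 / r) * 1) = 1 / r - 1" using r(1) by (simp add: field_simps)
    finally have "- (\<epsilon> x * (1 / r) * (1 / (1 + r))) = 1 / r - 1" unfolding r(2) .
    then show ?case unfolding \<tau>_def r_def .
  qed
qed auto

lemma par_A1: "parity_decay 1 (q + 1) A1"
proof -
  have "parity_decay 1 (q + 1) (\<lambda>x. (\<Sum>i\<in>UNIV. b i i x) * (1 / norm x))"
    by (rule par_mult_le[OF par_sum[OF par_b] par_inverse_norm]) auto
  moreover have "parity_decay 1 (q + 1) (\<lambda>x. da i i k x * \<omega> k x)" for i k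
    by (rule par_mult_le[OF par_da par_\<omega>]) auto
  moreover have "parity_decay 1 (q + 1) (\<lambda>x. \<Gamma> i i j x * (\<omega> j x + \<beta> j x))" for i j
    using q_pos by (intro par_mult_le[OF par_\<Gamma> par_add[OF par_\<omega> par_mono[OF par_\<beta>]]]) auto
  ultimately show ?thesis unfolding A1_def[abs_def] by (intro par_add par_sum)
qed

lemma par_\<beta>\<beta>: "parity_decay 1 (2 * q) (\<lambda>x. \<Sum>i\<in>UNIV. \<beta> i x * \<beta> i x)"
  by (intro par_sum par_mult_le[OF par_\<beta> par_\<beta>]) auto

lemma par_B1: "parity_decay 1 (q + 1) B1"
proof -
  have "parity_decay 1 q (\<lambda>x. 2 * \<epsilon> x + (\<Sum>i\<in>UNIV. \<beta> i x * \<beta> i x))"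
    using q_pos by (intro par_add par_cmult par_\<epsilon> par_mono[OF par_\<beta>\<beta>]) auto
  from par_mult_le[OF this par_inverse_norm]
  have "parity_decay 1 (q + 1) (\<lambda>x. (2 * \<epsilon> x + (\<Sum>i\<in>UNIV. \<beta> i x * \<beta> i x)) * (1 / norm x))"
    by auto
  moreover have "parity_decay 1 (q + 1) (\<lambda>x. (\<omega> i x + \<beta> i x) * dN i x)" for i
    using q_pos by (intro par_mult_le[OF par_add[OF par_\<omega> par_mono[OF par_\<beta>]] par_dN]) auto
  ultimately show ?thesis unfolding B1_def[abs_def] by (intro par_add par_cmult par_sum)
qed

text \<open>Every term of the difference contains b + h, da + dg, \<Gamma> - cc / 2 or the product
  of \<Gamma> with \<beta>, each of them quadratic.\<close>

lemma par_A1_lin: "parity_decay 1 (2 * q + 1) (\<lambda>x. A1 x - A1_lin x)"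
proof -
  have 1: "parity_decay 1 (2 * q + 1) (\<lambda>x. (\<Sum>i\<in>UNIV. b i i x + h i i x) * (1 / norm x))"
    by (rule par_mult_le[OF par_sum[OF par_bh] par_inverse_norm]) auto
  have 2: "parity_decay 1 (2 * q + 1) (\<lambda>x. (da i i k x + dg i i k x) * \<omega> k x)" for i k
    by (rule par_mult_le[OF par_dadg par_\<omega>]) auto
  have 3: "parity_decay 1 (2 * q + 1) (\<lambda>x. (\<Gamma> i i j x - cc i i j x / 2) * \<omega> j x + \<Gamma> i i j x * \<beta> j x)" for i j
    by (intro par_add par_mult_le[OF par_\<Gamma>cc par_\<omega>] par_mult_le[OF par_\<Gamma> par_\<beta>]) auto
  have "parity_decay 1 (2 * q + 1) (\<lambda>x. (\<Sum>i\<in>UNIV. b i i x + h i i x) * (1 / norm x)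
      + (\<Sum>i\<in>UNIV. \<Sum>k\<in>UNIV. (da i i k x + dg i i k x) * \<omega> k x)
      + (\<Sum>i\<in>UNIV. \<Sum>j\<in>UNIV. (\<Gamma> i i j x - cc i i j x / 2) * \<omega> j x + \<Gamma> i i j x * \<beta> j x))"
    by (intro par_add par_sum 1 2 3)
  moreover have "(\<Sum>i\<in>UNIV. b i i x + h i i x) * (1 / norm x)
      + (\<Sum>i\<in>UNIV. \<Sum>k\<in>UNIV. (da i i k x + dg i i k x) * \<omega> k x)
      + (\<Sum>i\<in>UNIV. \<Sum>j\<in>UNIV. (\<Gamma> i i j x - cc i i j x / 2) * \<omega> j x + \<Gamma> i i j x * \<beta> j x) = A1 x - A1_lin x" for x
    unfolding A1_def A1_lin_def by (simp add: sum.distrib sum_subtractf algebra_simps)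
  ultimately show ?thesis by simp
qed

lemma par_B1_lin: "parity_decay 1 (2 * q + 1) (\<lambda>x. B1 x - B1_lin x)"
proof -
  have "parity_decay (- 1) (2 * q) (\<lambda>x. (b i k x + h i k x) * \<omega> k x)" for i k
    by (rule par_mult_le[OF par_bh par_\<omega>]) auto
  then have "parity_decay 1 (2 * q) (\<lambda>x. \<omega> i x * (\<Sum>k\<in>UNIV. (b i k x + h i k x) * \<omega> k x))" for i
    by (intro par_mult_le[OF par_\<omega> par_sum]) auto
  then have "parity_decay 1 (2 * q) (\<lambda>x. 4 * (\<Sum>i\<in>UNIV. \<omega> i x * (\<Sum>k\<in>UNIV. (b i k x + h i k x) * \<omega> k x))
      + 2 * (\<Sum>i\<in>UNIV. \<beta> i x * \<beta> i x))"
    by (intro par_add par_cmult par_sum par_\<beta>\<beta>) 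
  then have 1: "parity_decay 1 (2 * q + 1) (\<lambda>x. (4 * (\<Sum>i\<in>UNIV. \<omega> i x * (\<Sum>k\<in>UNIV. (b i k x + h i k x) * \<omega> k x))
      + 2 * (\<Sum>i\<in>UNIV. \<beta> i x * \<beta> i x)) * (1 / norm x))"
    by (intro par_mult_le[OF _ par_inverse_norm]) auto
  have "parity_decay (- 1) (2 * q + 1) (\<lambda>x. \<omega> j x * \<omega> k x * (da i j k x + dg i j k x))" for i j k
    by (rule par_mult_le[OF par_mult[OF par_\<omega> par_\<omega>] par_dadg]) auto
  then have 2: "parity_decay 1 (2 * q + 1) (\<lambda>x. \<omega> i x * (\<Sum>j\<in>UNIV. \<Sum>k\<in>UNIV. \<omega> j x * \<omega> k x * (da i j k x + dg i j k x)))" for i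
    by (intro par_mult_le[OF par_\<omega> par_sum[OF par_sum]]) auto
  have 3: "parity_decay 1 (2 * q + 1) (\<lambda>x. \<beta> i x * dN i x)" for i
    by (rule par_mult_le[OF par_\<beta> par_dN]) auto
  have "parity_decay 1 (2 * q + 1) (\<lambda>x. (4 * (\<Sum>i\<in>UNIV. \<omega> i x * (\<Sum>k\<in>UNIV. (b i k x + h i k x) * \<omega> k x))
      + 2 * (\<Sum>i\<in>UNIV. \<beta> i x * \<beta> i x)) * (1 / norm x)
      + (\<Sum>i\<in>UNIV. \<omega> i x * (\<Sum>j\<in>UNIV. \<Sum>k\<in>UNIV. \<omega> j x * \<omega> k x * (da i j k x + dg i j k x)))
      + (\<Sum>i\<in>UNIV. \<beta> i x * dN i x))"
    by (intro par_add par_sum 1 2 3)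
  moreover have "(4 * (\<Sum>i\<in>UNIV. \<omega> i x * (\<Sum>k\<in>UNIV. (b i k x + h i k x) * \<omega> k x))
      + 2 * (\<Sum>i\<in>UNIV. \<beta> i x * \<beta> i x)) * (1 / norm x)
      + (\<Sum>i\<in>UNIV. \<omega> i x * (\<Sum>j\<in>UNIV. \<Sum>k\<in>UNIV. \<omega> j x * \<omega> k x * (da i j k x + dg i j k x)))
      + (\<Sum>i\<in>UNIV. \<beta> i x * dN i x) = B1 x - B1_lin x" for x
    unfolding B1_def B1_lin_def \<epsilon>_def \<beta>_def dN_def
    by (simp only: sum.distrib distrib_left distrib_right sum_distrib_left[symmetric])
  ultimately show ?thesis by simp
qed

lemma \<omega>_square_sum: "x \<noteq> 0 \<Longrightarrow> (\<Sum>i\<in>UNIV. \<omega> i x * \<omega> i x) = 1"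
proof -
  assume "x \<noteq> 0"
  have "(\<Sum>i\<in>UNIV. x $ i * x $ i) = norm x * norm x"
    by (simp add: inner_vec_def[symmetric, where 'a = real, simplified] dot_square_norm power2_eq_square)
  then show ?thesis using \<open>x \<noteq> 0\<close>
    by (simp add: \<omega>_def sum_divide_distrib[symmetric])
qed

text \<open>Quotient rule for w / sqrt N with w = g^-1 x and N = x . w, which at x equal n (\<omega>
  + \<beta>) and n^2 (1 + \<epsilon>) for n = |x|. By symmetry of the inverse metric the two factors
  x in N contribute equally, hence the 2 in front of \<omega> + \<beta>.\<close>

lemma unit_normal_derivative:
  assumes da: "\<And>m i j. ((\<lambda>t. a i j (x + t *\<^sub>R axis m 1)) has_real_derivative da m i j x) (at 0)"
    and sym: "\<And>i j. a i j x = a j i x" and x: "x \<noteq> 0" and e: "0 < 1 + \<epsilon> x"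
  shows "pdiff i (\<lambda>y. unit_normal g 0 y $ i) x
      = \<tau> x * ((\<Sum>k\<in>UNIV. da i i k x * \<omega> k x) + a i i x / norm x)
        - (\<tau> x)^3 / 2 * ((\<omega> i x + \<beta> i x) * (2 * (\<omega> i x + \<beta> i x) / norm x + dN i x))"
    and "unit_normal g 0 x $ j = (\<omega> j x + \<beta> j x) * \<tau> x"
proof -
  define n where "n = norm x"
  have n: "n > 0" using x by (simp add: n_def)
  have xn: "x $ k = n * \<omega> k x" for k using n by (simp add: \<omega>_def n_def)
  define w where "w i y = (\<Sum>k\<in>UNIV. a i k y * y $ k)" for i y
  define N where "N y = (\<Sum>j\<in>UNIV. y $ j * w j y)" for y
  have V: "unit_normal g 0 y $ j = w j y / sqrt (N y)" for j y
    by (simp add: unit_normal_def inner_vec_def matrix_vector_mult_def w_def N_def a_def)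
  have wx: "w j x = n * (\<omega> j x + \<beta> j x)" for j
  proof -
    have "w j x = n * ((\<Sum>k\<in>UNIV. mat 1 $ j $ k * \<omega> k x) + (\<Sum>k\<in>UNIV. b j k x * \<omega> k x))"
      unfolding w_def xn a_eq sum.distrib[symmetric] sum_distrib_left
      by (intro sum.cong refl) (simp add: algebra_simps)
    then show ?thesis by (simp add: \<beta>_def)
  qed
  have Nx: "N x = n\<^sup>2 * (1 + \<epsilon> x)"
    using \<omega>_square_sum[OF x]
    by (simp add: N_def wx xn \<epsilon>_def sum.distrib distrib_left power2_eq_square mult.assoc mult.left_commute
        sum_distrib_left[symmetric])
  define r where "r = sqrt (1 + \<epsilon> x)"
  have r: "r > 0" "1 + \<epsilon> x = r\<^sup>2" "\<tau> x = 1 / r" using e by (auto simp: r_def \<tau>_def)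
  have sN: "sqrt (N x) = n * r" using n by (simp add: Nx r_def real_sqrt_mult)
  show "unit_normal g 0 x $ j = (\<omega> j x + \<beta> j x) * \<tau> x"
    using n r(1) by (simp add: V wx sN r(3))
  define X where "X t = x + t *\<^sub>R axis i 1" for t
  have X0: "X 0 = x" by (simp add: X_def)
  have dX: "((\<lambda>t. X t $ k) has_real_derivative mat 1 $ k $ i) (at 0)" for k
    by (auto simp: X_def axis_def mat_def intro!: derivative_eq_intros)
  define P where "P j = (\<Sum>k\<in>UNIV. da i j k x * \<omega> k x)" for j
  have dw: "((\<lambda>t. w j (X t)) has_real_derivative n * P j + a j i x) (at 0)" for j
  proof -
    have "((\<lambda>t. \<Sum>k\<in>UNIV. a j k (X t) * X t $ k) has_real_derivative
        (\<Sum>k\<in>UNIV. da i j k x * X 0 $ k + mat 1 $ k $ i * a j k (X 0))) (at 0)"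
      by (intro DERIV_sum DERIV_mult dX da[of j _ i, folded X_def])
    moreover have "(\<Sum>k\<in>UNIV. da i j k x * X 0 $ k + mat 1 $ k $ i * a j k (X 0)) = n * P j + a j i x"
      unfolding X0 xn P_def sum.distrib sum_distrib_left
      by (simp add: mult_ac)
    ultimately show ?thesis by (simp add: w_def)
  qed
  have dNN: "((\<lambda>t. N (X t)) has_real_derivative n * (2 * (\<omega> i x + \<beta> i x) + n * dN i x)) (at 0)"
  proof -
    have "((\<lambda>t. N (X t)) has_real_derivative
        (\<Sum>j\<in>UNIV. mat 1 $ j $ i * w j (X 0) + (n * P j + a j i x) * X 0 $ j)) (at 0)"
      unfolding N_def by (intro DERIV_sum DERIV_mult dX dw)
    also have "(\<Sum>j\<in>UNIV. mat 1 $ j $ i * w j (X 0) + (n * P j + a j i x) * X 0 $ j)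
        = w i x + n * n * (\<Sum>j\<in>UNIV. \<omega> j x * P j) + (\<Sum>j\<in>UNIV. a j i x * x $ j)"
    proof -
      have "(\<Sum>j\<in>UNIV. mat 1 $ j $ i * w j (X 0) + (n * P j + a j i x) * X 0 $ j)
          = (\<Sum>j\<in>UNIV. mat 1 $ j $ i * w j x) + n * n * (\<Sum>j\<in>UNIV. \<omega> j x * P j) + (\<Sum>j\<in>UNIV. a j i x * x $ j)"
        unfolding X0 sum.distrib[symmetric] sum_distrib_left
        by (intro sum.cong refl) (simp add: xn algebra_simps)
      then show ?thesis by (simp add: mult.commute[of "mat 1 $ _ $ _"])
    qed
    also have "(\<Sum>j\<in>UNIV. a j i x * x $ j) = w i x" using sym by (simp add: w_def)
    also have "(\<Sum>j\<in>UNIV. \<omega> j x * P j) = dN i x"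
      by (simp add: P_def dN_def sum_distrib_left mult_ac)
    finally show ?thesis by (simp add: wx algebra_simps)
  qed
  have Npos: "N x > 0" using n e by (simp add: Nx)
  have "((\<lambda>t. w i (X t) / sqrt (N (X t))) has_real_derivative
      ((n * P i + a i i x) * sqrt (N (X 0)) - w i (X 0) * (inverse (sqrt (N (X 0))) / 2 * (n * (2 * (\<omega> i x + \<beta> i x) + n * dN i x))))
        / (sqrt (N (X 0)) * sqrt (N (X 0)))) (at 0)"
    using Npos by (intro DERIV_divide dw DERIV_chain2[OF DERIV_real_sqrt dNN]) (auto simp: X0)
  then have "pdiff i (\<lambda>y. unit_normal g 0 y $ i) x =
      ((n * P i + a i i x) * sqrt (N x) - w i x * (inverse (sqrt (N x)) / 2 * (n * (2 * (\<omega> i x + \<beta> i x) + n * dN i x))))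
        / (sqrt (N x) * sqrt (N x))"
    unfolding V X_def by (intro pdiff_eqI) (simp add: X_def)
  also have "\<dots> = \<tau> x * (P i + a i i x / n) - (\<tau> x)^3 / 2 * ((\<omega> i x + \<beta> i x) * (2 * (\<omega> i x + \<beta> i x) / n + dN i x))"
    unfolding sN wx r(3) using n r(1) by (simp add: field_simps power3_eq_cube)
  finally show "pdiff i (\<lambda>y. unit_normal g 0 y $ i) x
      = \<tau> x * ((\<Sum>k\<in>UNIV. da i i k x * \<omega> k x) + a i i x / norm x)
        - (\<tau> x)^3 / 2 * ((\<omega> i x + \<beta> i x) * (2 * (\<omega> i x + \<beta> i x) / norm x + dN i x))"
    by (simp add: P_def n_def)
qed

text \<open>The trace of g^-1 supplies the 3 / |x|, and |\<omega> + \<beta>|^2 = 1 + 2 \<epsilon> +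
  |\<beta>|^2 supplies the 2 / |x|. For \<tau> = 1 and no perturbation they combine to 3 / |x| - 1 /
  |x|.\<close>

lemma mean_curv_expansion:
  "\<forall>\<^sub>F x in at_infinity. mean_curv g 0 x = \<tau> x * (3 / norm x + A1 x) - (\<tau> x)^3 / 2 * (2 / norm x + B1 x)"
  using a_has_derivative a_sym eventually_not_equal_at_infinity[of 0] \<epsilon>_ge
proof eventually_elim
  case (elim x)
  have da: "((\<lambda>t. a i j (x + t *\<^sub>R axis m 1)) has_real_derivative da m i j x) (at 0)" for m i j
    using elim(1) by blast
  have sym: "a i j x = a j i x" for i j using elim(2) by blast
  have e: "0 < 1 + \<epsilon> x" using elim(4) by linarith
  note N = unit_normal_derivative[OF da sym elim(3) e]
  define \<alpha> where "\<alpha> i = \<omega> i x + \<beta> i x" for i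
  have tr: "(\<Sum>i\<in>UNIV. a i i x) = 3 + (\<Sum>i\<in>UNIV. b i i x)"
    by (simp add: a_eq sum.distrib mat_def)
  have sq: "(\<Sum>i\<in>UNIV. \<alpha> i * \<alpha> i) = 1 + 2 * \<epsilon> x + (\<Sum>i\<in>UNIV. \<beta> i x * \<beta> i x)"
  proof -
    have "(\<Sum>i\<in>UNIV. \<alpha> i * \<alpha> i) = (\<Sum>i\<in>UNIV. \<omega> i x * \<omega> i x) + 2 * (\<Sum>i\<in>UNIV. \<omega> i x * \<beta> i x) + (\<Sum>i\<in>UNIV. \<beta> i x * \<beta> i x)"
      by (simp add: \<alpha>_def algebra_simps sum.distrib sum_distrib_left)
    then show ?thesis by (simp add: \<omega>_square_sum[OF elim(3)] \<epsilon>_def)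
  qed
  have "mean_curv g 0 x = (\<Sum>i\<in>UNIV. \<tau> x * ((\<Sum>k\<in>UNIV. da i i k x * \<omega> k x) + a i i x / norm x)
        - (\<tau> x)^3 / 2 * (\<alpha> i * (2 * \<alpha> i / norm x + dN i x)) + (\<Sum>j\<in>UNIV. \<Gamma> i i j x * (\<alpha> j * \<tau> x)))"
    by (simp add: mean_curv_def divergence_def christoffel_eq N \<alpha>_def)
  also have "\<dots> = \<tau> x * ((\<Sum>i\<in>UNIV. \<Sum>k\<in>UNIV. da i i k x * \<omega> k x) + (\<Sum>i\<in>UNIV. a i i x) / norm x
          + (\<Sum>i\<in>UNIV. \<Sum>j\<in>UNIV. \<Gamma> i i j x * \<alpha> j))
        - (\<tau> x)^3 / 2 * (2 * (\<Sum>i\<in>UNIV. \<alpha> i * \<alpha> i) / norm x + (\<Sum>i\<in>UNIV. \<alpha> i * dN i x))"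
    by (simp add: sum.distrib sum_subtractf sum_distrib_left sum_divide_distrib distrib_left mult_ac)
  also have "\<dots> = \<tau> x * (3 / norm x + A1 x) - (\<tau> x)^3 / 2 * (2 / norm x + B1 x)"
    unfolding tr sq A1_def B1_def \<alpha>_def[symmetric]
    by (simp add: add_divide_distrib distrib_left algebra_simps)
  finally show ?case .
qed

definition H_lin where "H_lin x = A1_lin x - B1_lin x / 2"

text \<open>The part of the normalisation linear in \<open>\<epsilon>\<close> drops out, since
  \<open>3 \<tau> - \<tau>\<^sup>3 - 2 = - (\<tau> - 1)\<^sup>2 (\<tau> + 2)\<close>.\<close>

theorem mean_curv_linearization:
  "parity_decay 1 (2 * q + 1) (\<lambda>x. mean_curv g 0 x - 2 / norm x - H_lin x)"
proof (rule par_weaken)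
  have "parity_decay 1 (2 * q) (\<lambda>x. (\<tau> x - 1) * (\<tau> x - 1) * (\<tau> x + 2))"
    by (rule par_mult_le[OF par_mult[OF par_\<tau>1 par_\<tau>1] par_add[OF par_\<tau> par_const]]) auto
  then have 1: "parity_decay 1 (2 * q + 1) (\<lambda>x. - ((\<tau> x - 1) * (\<tau> x - 1) * (\<tau> x + 2) * (1 / norm x)))"
    by (intro par_uminus par_mult_le[OF _ par_inverse_norm]) auto
  have 2: "parity_decay 1 (2 * q + 1) (\<lambda>x. (\<tau> x - 1) * A1 x)"
    by (rule par_mult_le[OF par_\<tau>1 par_A1]) auto
  \<comment> \<open>This factor comes from \<tau>^3 - 1 = (\<tau> - 1) (\<tau>^2 + \<tau> + 1), so
    replacing \<tau>^3 by 1 in front of \<open>B1\<close> costs only a quadratic term.\<close>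
  have "parity_decay 1 0 (\<lambda>x. \<tau> x * \<tau> x + \<tau> x + 1)"
    by (intro par_add par_mult0 par_\<tau> par_const)
  then have "parity_decay 1 (2 * q + 1) (\<lambda>x. (\<tau> x - 1) * (\<tau> x * \<tau> x + \<tau> x + 1) * B1 x)"
    by (intro par_mult_le[OF par_mult[OF par_\<tau>1] par_B1]) auto
  then have 3: "parity_decay 1 (2 * q + 1) (\<lambda>x. (\<tau> x - 1) * (\<tau> x * \<tau> x + \<tau> x + 1) * B1 x / 2)"
    by (rule par_half)
  show "parity_decay 1 (2 * q + 1) (\<lambda>x. - ((\<tau> x - 1) * (\<tau> x - 1) * (\<tau> x + 2) * (1 / norm x)) + (\<tau> x - 1) * A1 x
      - (\<tau> x - 1) * (\<tau> x * \<tau> x + \<tau> x + 1) * B1 x / 2 + (A1 x - A1_lin x) - (B1 x - B1_lin x) / 2)"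
    by (intro par_add par_diff 1 2 3 par_A1_lin par_half par_B1_lin)
  show "\<forall>\<^sub>F x in at_infinity. - ((\<tau> x - 1) * (\<tau> x - 1) * (\<tau> x + 2) * (1 / norm x)) + (\<tau> x - 1) * A1 x
      - (\<tau> x - 1) * (\<tau> x * \<tau> x + \<tau> x + 1) * B1 x / 2 + (A1 x - A1_lin x) - (B1 x - B1_lin x) / 2
      = mean_curv g 0 x - 2 / norm x - H_lin x"
    using mean_curv_expansion
  proof eventually_elim
    case (elim x)
    define n where "n = 1 / norm x"
    have "mean_curv g 0 x = \<tau> x * (3 * n + A1 x) - (\<tau> x)^3 / 2 * (2 * n + B1 x)"
      using elim by (simp add: n_def)
    moreover have "2 / norm x = 2 * n" "1 / norm x = n" by (simp_all add: n_def)
    ultimately show ?case unfolding H_lin_def by (simp add: field_simps power3_eq_cube)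
  qed
qed auto

end

section \<open>Expansion of the scalar curvature\<close>

locale decaying_metric_C2 = decaying_metric +
  assumes diff2: "\<forall>\<^sub>F x in at_infinity. \<forall>k i j. pdiff k (\<lambda>x. g x $ i $ j) differentiable (at x)"
    and decay_deriv2: "\<And>m k i j. parity_decay 1 (q + 2) (pdiff m (pdiff k (\<lambda>x. g x $ i $ j)))"
begin

definition ddg where "ddg m k i j x = pdiff m (dg k i j) x"
definition dcc where "dcc m l i j x = ddg m i j l x + ddg m j i l x - ddg m l i j x"
text \<open>The quadratic part of the derivative of \<Gamma>, left over once the linear part
  \<open>dcc / 2\<close> is removed.\<close>

definition GE where
  "GE m k i j x = (\<Sum>l\<in>UNIV. da m k l x * cc l i j x + b k l x * dcc m l i j x) / 2"

lemma par_ddg: "parity_decay 1 (q + 2) (ddg m k i j)"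
  using decay_deriv2 by (simp add: ddg_def[abs_def] dg_def[abs_def])

lemma par_dcc: "parity_decay 1 (q + 2) (dcc m l i j)"
  unfolding dcc_def[abs_def] by (intro par_diff par_add par_ddg)

lemma par_GE: "parity_decay 1 (2 * q + 2) (GE m k i j)"
  unfolding GE_def[abs_def]
  by (intro par_half par_sum par_add par_mult_le[OF par_da par_cc] par_mult_le[OF par_b par_dcc]) auto

lemma pdiff_\<Gamma>:
  "\<forall>\<^sub>F x in at_infinity. \<forall>m k i j. pdiff m (\<Gamma> k i j) x = dcc m k i j x / 2 + GE m k i j x"
  using a_has_derivative diff2
proof eventually_elim
  case (elim x)
  show ?case
  proof (intro allI)
    fix m k i j
    define X where "X t = x + t *\<^sub>R axis m 1" for t
    have X0: "X 0 = x" by (simp add: X_def)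
    have ddg: "((\<lambda>t. dg k i j (X t)) has_real_derivative ddg m k i j x) (at 0)" for k i j
      using elim(2) pdiff_has_derivative unfolding X_def ddg_def dg_def[abs_def] by blast
    have dcc: "((\<lambda>t. cc l i j (X t)) has_real_derivative dcc m l i j x) (at 0)" for l i j
      unfolding cc_def dcc_def by (intro DERIV_add DERIV_diff ddg)
    have da: "((\<lambda>t. a i j (X t)) has_real_derivative da m i j x) (at 0)" for i j
      using elim(1) unfolding X_def by blast
    have "((\<lambda>t. \<Gamma> k i j (X t)) has_real_derivative
        (\<Sum>l\<in>UNIV. da m k l x * cc l i j (X 0) + dcc m l i j x * a k l (X 0)) / 2) (at 0)"
      unfolding \<Gamma>_def by (intro DERIV_cdivide DERIV_sum DERIV_mult da dcc)
    then have "pdiff m (\<Gamma> k i j) x = (\<Sum>l\<in>UNIV. da m k l x * cc l i j x + dcc m l i j x * a k l x) / 2"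
      unfolding X0 unfolding X_def by (rule pdiff_eqI)
    also have "(\<Sum>l\<in>UNIV. da m k l x * cc l i j x + dcc m l i j x * a k l x)
        = (\<Sum>l\<in>UNIV. mat 1 $ k $ l * dcc m l i j x) + (\<Sum>l\<in>UNIV. da m k l x * cc l i j x + b k l x * dcc m l i j x)"
      unfolding sum.distrib[symmetric] by (intro sum.cong refl) (simp add: a_eq algebra_simps)
    finally show "pdiff m (\<Gamma> k i j) x = dcc m k i j x / 2 + GE m k i j x"
      by (simp add: GE_def add_divide_distrib)
  qed
qed

definition Ric1 where "Ric1 j k x = (\<Sum>i\<in>UNIV. dcc i i j k x / 2 - dcc k i j i x / 2)"
definition Ric2 where "Ric2 j k x = (\<Sum>i\<in>UNIV. GE i i j k x - GE k i j i x
    + (\<Sum>s\<in>UNIV. \<Gamma> i i s x * \<Gamma> s j k x - \<Gamma> i k s x * \<Gamma> s j i x))"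
text \<open>The linearized scalar curvature, the double divergence of h minus the Laplacian of its
  trace, with the index of the outer derivative arranged so that it is literally the divergence of
  the mass field.\<close>

definition D where "D x = (\<Sum>j\<in>UNIV. \<Sum>i\<in>UNIV. ddg j i i j x - ddg j j i i x)"

theorem scalar_curv_linearization: "parity_decay 1 (2 * q + 2) (\<lambda>x. scalar_curv g x - D x)"
proof (rule par_weaken)
  have r1: "parity_decay 1 (q + 2) (Ric1 j k)" for j k
    unfolding Ric1_def[abs_def] by (intro par_sum par_diff par_half par_dcc)
  have r2: "parity_decay 1 (2 * q + 2) (Ric2 j k)" for j k
    unfolding Ric2_def[abs_def]
    by (intro par_sum par_add par_diff par_GE par_mult_le[OF par_\<Gamma> par_\<Gamma>]) auto
  have r: "parity_decay 1 (q + 2) (\<lambda>x. Ric1 j k x + Ric2 j k x)" for j k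
    using q_pos by (intro par_add r1 par_mono[OF r2]) auto
  show "parity_decay 1 (2 * q + 2) (\<lambda>x. (\<Sum>j\<in>UNIV. Ric2 j j x) + (\<Sum>j\<in>UNIV. \<Sum>k\<in>UNIV. b j k x * (Ric1 j k x + Ric2 j k x)))"
    by (intro par_add par_sum r2 par_mult_le[OF par_b r]) auto
  show "\<forall>\<^sub>F x in at_infinity. (\<Sum>j\<in>UNIV. Ric2 j j x) + (\<Sum>j\<in>UNIV. \<Sum>k\<in>UNIV. b j k x * (Ric1 j k x + Ric2 j k x))
      = scalar_curv g x - D x"
    using pdiff_\<Gamma>
  proof eventually_elim
    case (elim x)
    have ric: "ricci g j k x = Ric1 j k x + Ric2 j k x" for j k
      using elim unfolding ricci_def christoffel_eq Ric1_def Ric2_def sum.distrib[symmetric]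
      by (intro sum.cong refl) simp
    have "scalar_curv g x = (\<Sum>j\<in>UNIV. \<Sum>k\<in>UNIV. mat 1 $ j $ k * (Ric1 j k x + Ric2 j k x))
        + (\<Sum>j\<in>UNIV. \<Sum>k\<in>UNIV. b j k x * (Ric1 j k x + Ric2 j k x))"
      unfolding scalar_curv_def ric a_def[symmetric] sum.distrib[symmetric]
      by (intro sum.cong refl) (simp add: a_eq algebra_simps)
    also have "(\<Sum>j\<in>UNIV. \<Sum>k\<in>UNIV. mat 1 $ j $ k * (Ric1 j k x + Ric2 j k x))
        = (\<Sum>j\<in>UNIV. Ric1 j j x) + (\<Sum>j\<in>UNIV. Ric2 j j x)"
      by (simp add: sum.distrib)
    also have "(\<Sum>j\<in>UNIV. Ric1 j j x) = D x"
    proof -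
      \<comment> \<open>Two of the three terms of \<open>dcc j i j i\<close> cancel. Afterwards
        exchanging the names i and j suffices, so partial derivatives are never commuted.\<close>
      have "(\<Sum>j\<in>UNIV. Ric1 j j x) = (\<Sum>j\<in>UNIV. \<Sum>i\<in>UNIV. ddg i j j i x)
         - (\<Sum>j\<in>UNIV. \<Sum>i\<in>UNIV. ddg i i j j x) / 2 - (\<Sum>j\<in>UNIV. \<Sum>i\<in>UNIV. ddg j j i i x) / 2"
        unfolding Ric1_def dcc_def sum_divide_distrib sum_subtractf[symmetric]
        by (intro sum.cong refl) (simp add: field_simps)
      also have "(\<Sum>j\<in>UNIV. \<Sum>i\<in>UNIV. ddg i j j i x) = (\<Sum>j\<in>UNIV. \<Sum>i\<in>UNIV. ddg j i i j x)"
        by (rule sum.swap)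
      also have "(\<Sum>j\<in>UNIV. \<Sum>i\<in>UNIV. ddg i i j j x) = (\<Sum>j\<in>UNIV. \<Sum>i\<in>UNIV. ddg j j i i x)"
        by (rule sum.swap)
      finally show ?thesis by (simp add: D_def sum_subtractf)
    qed
    finally show ?case by simp
  qed
qed auto

end

section \<open>The first moment of the mean curvature\<close>

lemma mean_curv_shift: "mean_curv g p (p + y) = mean_curv (\<lambda>y. g (p + y)) 0 y"
proof -
  have c: "christoffel (\<lambda>y. g (p + y)) k i j y = christoffel g k i j (p + y)" for k i j y
    using pdiff_shift[of _ "\<lambda>x. g x $ _ $ _" p]
    by (simp add: christoffel_def metric_inv_def)
  have n: "unit_normal (\<lambda>y. g (p + y)) 0 y = unit_normal g p (p + y)" for y
    by (simp add: unit_normal_def metric_inv_def)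
  have "pdiff i (\<lambda>y. unit_normal (\<lambda>y. g (p + y)) 0 y $ i) y = pdiff i (\<lambda>x. unit_normal g p x $ i) (p + y)" for i
    unfolding n using pdiff_shift[of i "\<lambda>x. unit_normal g p x $ i" p] by simp
  then show ?thesis by (simp add: mean_curv_def divergence_def c n)
qed

text \<open>Regularity and symmetry are now required at every point beyond K, since the flux
  identities are used at fixed radii. The scalar curvature acts through \<open>par_D\<close>;
  \<open>shift\<close> makes the mean curvature expansion available about every centre.\<close>

locale exterior_metric = decaying_metric_C2 +
  fixes K :: real
  assumes K_pos: "K > 0"
    and h_sym: "\<And>i j x. K < norm x \<Longrightarrow> h i j x = h j i x"
    and c1_h: "\<And>i j. c1_outside K (h i j)"
    and c1_dg: "\<And>k i j. c1_outside K (dg k i j)"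
    and par_D: "parity_decay 1 (2 * q + 2) D"
    and shift: "\<And>p. decaying_metric (\<lambda>y. g (p + y)) q"
begin

lemma pdiff_h: "pdiff k (h i j) = dg k i j"
  by (simp add: h_def[abs_def] dg_def[abs_def] pdiff_diff_const)

lemma dg_sym_outside: "K < norm x \<Longrightarrow> dg k i j x = dg k j i x"
proof -
  assume x: "K < norm x"
  have "open {x::real^3. K < norm x}" by (intro open_Collect_less continuous_intros)
  then have "\<forall>\<^sub>F y in nhds x. h i j y = h j i y"
    unfolding eventually_nhds using x h_sym by (intro exI[of _ "{x. K < norm x}"]) auto
  then show ?thesis unfolding pdiff_h[symmetric] by (rule pdiff_cong_nhds)
qed

section \<open>The fields of mass and centre and their divergences\<close>

definition Y where "Y j x = (\<Sum>i\<in>UNIV. dg i i j x - dg j i i x)"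
definition X where "X l j x = x $ l * Y j x - h j l x + mat 1 $ j $ l * (\<Sum>i\<in>UNIV. h i i x)"

lemma c1_Y: "c1_outside K (Y j)"
  unfolding Y_def[abs_def] by (intro c1_outside_sum c1_outside_diff c1_dg finite)

lemma c1_X: "c1_outside K (X l j)"
  unfolding X_def[abs_def]
  by (intro c1_outside_add c1_outside_diff c1_outside_mult c1_outside_coord c1_Y c1_h c1_outside_const
      c1_outside_sum finite)

lemma outside: "\<forall>\<^sub>F x::real^3 in at_infinity. K < norm x"
  by (rule eventually_at_infinityI[of "K + 1"]) simp

lemma divg_Y: "K < norm x \<Longrightarrow> divg Y x = D x"
proof -
  assume x: "K < norm x"
  note d = c1_outsideD(1)[OF c1_dg x]
  have "pdiff j (Y j) x = (\<Sum>i\<in>UNIV. ddg j i i j x - ddg j j i i x)" for j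
    unfolding Y_def[abs_def] ddg_def by (subst pdiff_sum; intro differentiable_diff d sum.cong refl pdiff_diff)
  then show ?thesis by (simp add: divg_def D_def)
qed

text \<open>The product rule leaves Y_l beside x^l div Y, and the correction -h_jl + \<delta>_jl
  h_ii is chosen to have divergence -Y_l.\<close>

lemma divg_X: "K < norm x \<Longrightarrow> divg (X l) x = x $ l * D x"
proof -
  assume x: "K < norm x"
  note dh = c1_outsideD(1)[OF c1_h x] and dY = c1_outsideD(1)[OF c1_Y x]
  have "pdiff j (X l j) x = mat 1 $ l $ j * Y j x + pdiff j (Y j) x * x $ l - dg j j l x
      + mat 1 $ j $ l * (\<Sum>i\<in>UNIV. dg j i i x)" for j
  proof -
    have s: "(\<lambda>x. \<Sum>i\<in>UNIV. h i i x) differentiable (at x)"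
      by (rule differentiable_sum) (auto intro: dh)
    have "pdiff j (X l j) x = pdiff j (\<lambda>x. x $ l * Y j x - h j l x) x + pdiff j (\<lambda>x. mat 1 $ j $ l * (\<Sum>i\<in>UNIV. h i i x)) x"
      unfolding X_def[abs_def] by (intro pdiff_add differentiable_diff differentiable_mult coord_differentiable dY dh s differentiable_const)
    also have "pdiff j (\<lambda>x. x $ l * Y j x - h j l x) x = pdiff j (\<lambda>x. x $ l * Y j x) x - pdiff j (h j l) x"
      by (intro pdiff_diff differentiable_mult coord_differentiable dY dh)
    also have "pdiff j (\<lambda>x. x $ l * Y j x) x = mat 1 $ l $ j * Y j x + pdiff j (Y j) x * x $ l"
      by (subst pdiff_mult; (intro coord_differentiable dY)?) (simp add: pdiff_coord)
    also have "pdiff j (\<lambda>x. mat 1 $ j $ l * (\<Sum>i\<in>UNIV. h i i x)) x = pdiff j (\<lambda>x. \<Sum>i\<in>UNIV. h i i x) x * mat 1 $ j $ l"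
      by (subst pdiff_mult; (intro s differentiable_const)?) simp
    also have "pdiff j (\<lambda>x. \<Sum>i\<in>UNIV. h i i x) x = (\<Sum>i\<in>UNIV. dg j i i x)"
      by (subst pdiff_sum) (auto intro: dh simp: pdiff_h)
    finally show ?thesis by (simp add: pdiff_h mult.commute)
  qed
  then have "divg (X l) x = (\<Sum>j\<in>UNIV. mat 1 $ l $ j * Y j x) + divg Y x * x $ l - (\<Sum>j\<in>UNIV. dg j j l x)
      + (\<Sum>j\<in>UNIV. (\<Sum>i\<in>UNIV. dg j i i x) * mat 1 $ j $ l)"
    by (simp add: divg_def sum.distrib sum_subtractf sum_distrib_right mult.commute[of "mat 1 $ _ $ l"])
  then show ?thesis using divg_Y[OF x] by (simp add: Y_def sum_subtractf)
qed

text \<open>\<open>D\<close> is even of order 2q + 2; giving up one order allows it to be treated as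
  odd, which brings Y under \<open>flux_limit\<close>. For X the factor x^l itself supplies the
  oddness at the same order.\<close>

lemma par_divg_Y: "parity_decay (- 1) (2 * q + 1) (divg Y)"
proof (rule par_cong)
  show "parity_decay (- 1) (2 * q + 1) D" by (rule par_flip[of 1]) (use par_D in \<open>simp add: add.assoc\<close>)
  show "\<forall>\<^sub>F x in at_infinity. D x = divg Y x"
    using outside by eventually_elim (simp add: divg_Y)
qed

lemma par_divg_X: "parity_decay (- 1) (2 * q + 1) (divg (X l))"
proof (rule par_cong)
  show "parity_decay (- 1) (2 * q + 1) (\<lambda>x. x $ l * D x)" by (rule par_mult_le[OF par_coord par_D]) auto
  show "\<forall>\<^sub>F x in at_infinity. x $ l * D x = divg (X l) x"
    using outside by eventually_elim (simp add: divg_X)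
qed

section \<open>From the linearized mean curvature to fluxes\<close>

lemma sphere_continuous:
  assumes "K + norm p < R"
  shows "continuous_on (sphere 0 1) (\<lambda>w. h i j (p + R *\<^sub>R w))"
    "continuous_on (sphere 0 1) (\<lambda>w. dg k i j (p + R *\<^sub>R w))"
    "continuous_on (sphere 0 1) (\<lambda>w. Y j (p + R *\<^sub>R w))"
  by (rule continuous_on_sphere_compose[OF c1_outside_continuous(1)[OF c1_h] assms]
      continuous_on_sphere_compose[OF c1_outside_continuous(1)[OF c1_dg] assms]
      continuous_on_sphere_compose[OF c1_outside_continuous(1)[OF c1_Y] assms])+

lemma flux_X_integrand:
  "(\<Sum>j\<in>UNIV. X l j (p + R *\<^sub>R w) * w $ j) = (p $ l + R * w $ l) * (\<Sum>j\<in>UNIV. Y j (p + R *\<^sub>R w) * w $ j)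
     - (\<Sum>j\<in>UNIV. h j l (p + R *\<^sub>R w) * w $ j) + w $ l * (\<Sum>i\<in>UNIV. h i i (p + R *\<^sub>R w))"
proof -
  have "(\<Sum>j\<in>UNIV. X l j (p + R *\<^sub>R w) * w $ j) = (p $ l + R * w $ l) * (\<Sum>j\<in>UNIV. Y j (p + R *\<^sub>R w) * w $ j)
     - (\<Sum>j\<in>UNIV. h j l (p + R *\<^sub>R w) * w $ j)
     + (\<Sum>i\<in>UNIV. h i i (p + R *\<^sub>R w)) * (\<Sum>j\<in>UNIV. w $ j * mat 1 $ j $ l)"
    unfolding X_def sum_distrib_left[of "p $ l + R * w $ l"] sum_distrib_left[of "\<Sum>i\<in>UNIV. h i i (p + R *\<^sub>R w)"]
      sum_subtractf[symmetric] sum.distrib[symmetric]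
    by (intro sum.cong refl) (simp add: algebra_simps)
  then show ?thesis by (simp add: mult.commute)
qed

text \<open>\<open>H_lin\<close> of the translated metric at R w, expressed through the original h
  at p + R w; the symmetry of h has already reduced the contracted Christoffel term to the
  derivative of the trace.\<close>

definition H_lin_at where
  "H_lin_at p R w = - (\<Sum>i\<in>UNIV. h i i (p + R *\<^sub>R w)) / R - (\<Sum>i\<in>UNIV. \<Sum>k\<in>UNIV. dg i i k (p + R *\<^sub>R w) * w $ k)
     + (\<Sum>i\<in>UNIV. \<Sum>j\<in>UNIV. dg j i i (p + R *\<^sub>R w) * w $ j) / 2
     + 2 * (\<Sum>i\<in>UNIV. \<Sum>k\<in>UNIV. w $ i * w $ k * h i k (p + R *\<^sub>R w)) / R
     + (\<Sum>i\<in>UNIV. \<Sum>j\<in>UNIV. \<Sum>k\<in>UNIV. w $ i * w $ j * w $ k * dg i j k (p + R *\<^sub>R w)) / 2"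

text \<open>Tangential integration by parts of \<open>w\<^sub>l w\<^sub>j h\<^sub>i\<^sub>j\<close> in the direction \<open>i\<close>, summed over \<open>i, j\<close>; this is
  what turns \<open>H_lin\<close> into a flux density.\<close>

lemma usphere_tangential_h:
  assumes R: "K + norm p < R"
  shows "usphere (\<lambda>w. (\<Sum>j\<in>UNIV. w $ j * h l j (p + R *\<^sub>R w)) + w $ l * (\<Sum>i\<in>UNIV. h i i (p + R *\<^sub>R w))
      + R * w $ l * (\<Sum>i\<in>UNIV. \<Sum>j\<in>UNIV. dg i i j (p + R *\<^sub>R w) * w $ j)
      - 4 * w $ l * (\<Sum>i\<in>UNIV. \<Sum>j\<in>UNIV. w $ i * w $ j * h i j (p + R *\<^sub>R w))
      - R * w $ l * (\<Sum>i\<in>UNIV. \<Sum>j\<in>UNIV. \<Sum>k\<in>UNIV. w $ i * w $ j * w $ k * dg k i j (p + R *\<^sub>R w))) = 0"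
proof -
  note c = sphere_continuous[OF R]
  define G where "G i j w = h i j (p + R *\<^sub>R w)" for i j w
  define dG where "dG k i j w = dg k i j (p + R *\<^sub>R w)" for k i j w
  note cG = c(1)[folded G_def] c(2)[folded dG_def]
  \<comment> \<open>The gradient in w of w_l w_j h_ij(p + R w).\<close>
  define E where "E i j w = (w $ j * G i j w) *\<^sub>R axis l 1 + (w $ l * G i j w) *\<^sub>R axis j 1
      + (w $ l * w $ j) *\<^sub>R (\<chi> k. R * dG k i j w)" for i j w
  have E: "((\<lambda>w. w $ l * w $ j * G i j w) has_derivative (\<lambda>v. E i j w \<bullet> v)) (at w)" if "norm w = 1" for i j w
    using has_derivative_on_sphere[OF c1_h R that, of i j] unfolding E_def pdiff_h G_def[symmetric] dG_def[symmetric]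
    by (auto intro!: derivative_eq_intros bounded_linear_imp_has_derivative[OF bounded_linear_vec_nth]
        simp: inner_add_left inner_axis' algebra_simps)
  have Ec: "continuous_on (sphere 0 1) (E i j)" for i j
    unfolding E_def by (intro continuous_intros continuous_on_vec_lambda cG)
  define T where "T i j w = E i j w $ i - w $ i * (E i j w \<bullet> w) - 2 * w $ i * (w $ l * w $ j * G i j w)" for i j w
  have T0: "usphere (T i j) = 0" for i j
    unfolding T_def by (rule usphere_tangential[OF E Ec])
  have Tc: "continuous_on (sphere 0 1) (T i j)" for i j
    unfolding T_def by (intro continuous_intros Ec cG)
  have "usphere (\<lambda>w. \<Sum>i\<in>UNIV. \<Sum>j\<in>UNIV. T i j w) = (\<Sum>i\<in>UNIV. \<Sum>j\<in>UNIV. usphere (T i j))"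
    by (subst usphere_sum, simp, intro continuous_intros Tc) (intro sum.cong refl usphere_sum finite Tc)
  then have 0: "usphere (\<lambda>w. \<Sum>i\<in>UNIV. \<Sum>j\<in>UNIV. T i j w) = 0" by (simp add: T0)
  \<comment> \<open>The 4 is 2 from the homogeneity of w_l w_j plus 2 from the mean curvature of the
    unit sphere.\<close>
  have T: "T i j w = mat 1 $ l $ i * (w $ j * G i j w) + w $ l * (G i j w * mat 1 $ j $ i) + R * w $ l * (dG i i j w * w $ j)
      - 4 * w $ l * (w $ i * w $ j * G i j w) - R * w $ l * (\<Sum>k\<in>UNIV. w $ i * w $ j * w $ k * dG k i j w)" for i j w
  proof -
    have "E i j w \<bullet> w = 2 * (w $ l * w $ j * G i j w) + R * w $ l * w $ j * (\<Sum>k\<in>UNIV. w $ k * dG k i j w)"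
      unfolding E_def
      by (simp add: inner_add_left inner_axis' algebra_simps)
         (simp add: inner_vec_def sum_distrib_left mult_ac)
    moreover have "E i j w $ i = mat 1 $ l $ i * (w $ j * G i j w) + w $ l * (G i j w * mat 1 $ j $ i) + R * w $ l * (dG i i j w * w $ j)"
      unfolding E_def by (simp add: axis_def mat_def)
    moreover have "R * w $ l * (\<Sum>k\<in>UNIV. w $ i * w $ j * w $ k * dG k i j w)
        = w $ i * (R * w $ l * w $ j * (\<Sum>k\<in>UNIV. w $ k * dG k i j w))"
      by (simp add: sum_distrib_left mult_ac)
    ultimately show ?thesis unfolding T_def by (simp add: algebra_simps)
  qed
  have "(\<Sum>i\<in>UNIV. \<Sum>j\<in>UNIV. T i j w) = (\<Sum>j\<in>UNIV. w $ j * G l j w) + w $ l * (\<Sum>i\<in>UNIV. G i i w)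
      + R * w $ l * (\<Sum>i\<in>UNIV. \<Sum>j\<in>UNIV. dG i i j w * w $ j)
      - 4 * w $ l * (\<Sum>i\<in>UNIV. \<Sum>j\<in>UNIV. w $ i * w $ j * G i j w)
      - R * w $ l * (\<Sum>i\<in>UNIV. \<Sum>j\<in>UNIV. \<Sum>k\<in>UNIV. w $ i * w $ j * w $ k * dG k i j w)" for w
    unfolding T by (simp only: sum.distrib sum_subtractf sum_distrib_left[symmetric] sum_mat_1)
  then show ?thesis using 0 by (simp add: G_def dG_def)
qed

text \<open>Adding the null integrand S removes the terms w_i w_j h_ij and w_i w_j w_k h_ij,k from
  the moment density pointwise. What is left is the flux density of X - p^l Y, where the subtraction
  turns x^l into x^l - p^l = R w_l.\<close>

lemma usphere_H_lin:
  assumes R: "K + norm p < R" "R > 0"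
  shows "R\<^sup>2 * usphere (\<lambda>w. R * w $ l * H_lin_at p R w) = - (flux (X l) p R - p $ l * flux Y p R) / 2"
proof -
  note c = sphere_continuous[OF R(1)]
  define S where "S w = (\<Sum>j\<in>UNIV. w $ j * h l j (p + R *\<^sub>R w)) + w $ l * (\<Sum>i\<in>UNIV. h i i (p + R *\<^sub>R w))
      + R * w $ l * (\<Sum>i\<in>UNIV. \<Sum>j\<in>UNIV. dg i i j (p + R *\<^sub>R w) * w $ j)
      - 4 * w $ l * (\<Sum>i\<in>UNIV. \<Sum>j\<in>UNIV. w $ i * w $ j * h i j (p + R *\<^sub>R w))
      - R * w $ l * (\<Sum>i\<in>UNIV. \<Sum>j\<in>UNIV. \<Sum>k\<in>UNIV. w $ i * w $ j * w $ k * dg k i j (p + R *\<^sub>R w))" for w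
  define FX where "FX w = (\<Sum>j\<in>UNIV. X l j (p + R *\<^sub>R w) * w $ j)" for w
  define FY where "FY w = (\<Sum>j\<in>UNIV. Y j (p + R *\<^sub>R w) * w $ j)" for w
  have S0: "usphere S = 0" unfolding S_def by (rule usphere_tangential_h[OF R(1)])
  have Sc: "continuous_on (sphere 0 1) S" unfolding S_def by (intro continuous_intros c)
  have Yc: "continuous_on (sphere 0 1) FY" unfolding FY_def by (intro continuous_intros c)
  have Xc: "continuous_on (sphere 0 1) FX"
    unfolding FX_def flux_X_integrand by (intro continuous_intros c)
  have pt: "R * w $ l * H_lin_at p R w = (- 1 / 2) * ((FX w - p $ l * FY w) + S w)" if "norm w = 1" for w
  proof -
    have w: "K < norm (p + R *\<^sub>R w)" by (rule norm_add_sphere_gt[OF R(1) that])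
    define t where "t = (\<Sum>i\<in>UNIV. h i i (p + R *\<^sub>R w))"
    define a1 where "a1 = (\<Sum>i\<in>UNIV. \<Sum>k\<in>UNIV. dg i i k (p + R *\<^sub>R w) * w $ k)"
    define a2 where "a2 = (\<Sum>i\<in>UNIV. \<Sum>j\<in>UNIV. dg j i i (p + R *\<^sub>R w) * w $ j)"
    define a3 where "a3 = (\<Sum>i\<in>UNIV. \<Sum>k\<in>UNIV. w $ i * w $ k * h i k (p + R *\<^sub>R w))"
    define a4 where "a4 = (\<Sum>i\<in>UNIV. \<Sum>j\<in>UNIV. \<Sum>k\<in>UNIV. w $ i * w $ j * w $ k * dg i j k (p + R *\<^sub>R w))"
    define a5 where "a5 = (\<Sum>j\<in>UNIV. h j l (p + R *\<^sub>R w) * w $ j)"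
    have 1: "(\<Sum>j\<in>UNIV. w $ j * h l j (p + R *\<^sub>R w)) = a5"
      unfolding a5_def by (simp add: h_sym[OF w, of l] mult.commute)
    have 2: "(\<Sum>i\<in>UNIV. \<Sum>j\<in>UNIV. \<Sum>k\<in>UNIV. w $ i * w $ j * w $ k * dg k i j (p + R *\<^sub>R w)) = a4"
    proof -
      have "a4 = (\<Sum>j\<in>UNIV. \<Sum>i\<in>UNIV. \<Sum>k\<in>UNIV. w $ i * w $ j * w $ k * dg i j k (p + R *\<^sub>R w))"
        unfolding a4_def by (rule sum.swap)
      also have "\<dots> = (\<Sum>j\<in>UNIV. \<Sum>k\<in>UNIV. \<Sum>i\<in>UNIV. w $ i * w $ j * w $ k * dg i j k (p + R *\<^sub>R w))"
        by (intro sum.cong refl sum.swap)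
      finally show ?thesis by (simp add: mult_ac)
    qed
    have 3: "FY w = a1 - a2"
    proof -
      have "FY w = (\<Sum>j\<in>UNIV. \<Sum>i\<in>UNIV. dg i i j (p + R *\<^sub>R w) * w $ j) - (\<Sum>j\<in>UNIV. \<Sum>i\<in>UNIV. dg j i i (p + R *\<^sub>R w) * w $ j)"
        unfolding FY_def Y_def by (simp add: sum_distrib_right left_diff_distrib sum_subtractf)
      then show ?thesis unfolding a1_def a2_def
        by (simp add: sum.swap[of "\<lambda>j i. dg i i j (p + R *\<^sub>R w) * w $ j"] sum.swap[of "\<lambda>j i. dg j i i (p + R *\<^sub>R w) * w $ j"])
    qed
    have 4: "FX w - p $ l * FY w = R * w $ l * FY w - a5 + w $ l * t"
      unfolding FX_def flux_X_integrand FY_def[symmetric] a5_def t_def by (simp add: algebra_simps)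
    show ?thesis
      unfolding 4
      unfolding S_def 1 2 3 H_lin_at_def t_def[symmetric] a1_def[symmetric] a2_def[symmetric] a3_def[symmetric] a4_def[symmetric]
      using R(2) by (simp add: field_simps)
  qed
  have "usphere (\<lambda>w. R * w $ l * H_lin_at p R w) = (- 1 / 2) * usphere (\<lambda>w. (FX w - p $ l * FY w) + S w)"
    unfolding usphere_cmult[symmetric] by (rule usphere_cong) (rule pt)
  also have "usphere (\<lambda>w. (FX w - p $ l * FY w) + S w) = usphere (\<lambda>w. FX w - p $ l * FY w) + usphere S"
    by (intro usphere_add continuous_intros Xc Yc Sc)
  also have "usphere (\<lambda>w. FX w - p $ l * FY w) = usphere FX - p $ l * usphere FY"
    unfolding usphere_cmult[symmetric] by (intro usphere_diff continuous_intros Xc Yc)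
  finally have e: "usphere (\<lambda>w. R * w $ l * H_lin_at p R w) = (- 1 / 2) * (usphere FX - p $ l * usphere FY + usphere S)" .
  show ?thesis
    unfolding flux_def FX_def[symmetric] FY_def[symmetric] e S0 by (simp add: algebra_simps)
qed

text \<open>The linearization error is even of order 2q + 1, hence odd after multiplication by w_l.
  The weight R and the area R^2 give R^3, and oddness gains one power: 3 - (2q + 1) - 1 = 1 -
  2q.\<close>

lemma mean_curv_integral:
  "(\<lambda>R. sphere_integral p R (\<lambda>x. (x $ l - p $ l) * (mean_curv g p x - 2 / R))
      + (flux (X l) p R - p $ l * flux Y p R) / 2) \<in> O[at_top](\<lambda>R. R powr (1 - 2 * q))"
proof -
  interpret P: decaying_metric "\<lambda>y. g (p + y)" q by (rule shift)
  define E where "E x = P.\<omega> l x * (mean_curv (\<lambda>y. g (p + y)) 0 x - 2 / norm x - P.H_lin x)" for x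
  have E: "parity_decay (- 1) (2 * q + 1) E"
    unfolding E_def[abs_def] by (rule par_mult_le[OF P.par_\<omega> P.mean_curv_linearization]) auto
  have Ph: "P.h i j y = h i j (p + y)" for i j y by (simp add: P.h_def h_def)
  have Pdg: "P.dg k i j y = dg k i j (p + y)" for k i j y
    using pdiff_shift[of k "\<lambda>x. g x $ i $ j" p] by (simp add: P.dg_def dg_def)
  have ev: "\<forall>\<^sub>F R in at_top. R ^ 3 * usphere (\<lambda>w. E (R *\<^sub>R w)) =
      sphere_integral p R (\<lambda>x. (x $ l - p $ l) * (mean_curv g p x - 2 / R))
      + (flux (X l) p R - p $ l * flux Y p R) / 2"
    using eventually_gt_at_top[of "K + norm p"] eventually_par_continuous[OF E]
  proof eventually_elim
    case (elim R)
    then have R: "K + norm p < R" "0 < R" using K_pos norm_ge_zero[of p] by linarith+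
    have \<omega>: "P.\<omega> i (R *\<^sub>R w) = w $ i" if "norm w = 1" for i w
      using that R(2) by (simp add: P.\<omega>_def)
    have Hl: "P.H_lin (R *\<^sub>R w) = H_lin_at p R w" if "norm w = 1" for w
    proof -
      have w: "K < norm (p + R *\<^sub>R w)" by (rule norm_add_sphere_gt[OF R(1) that])
      have cc: "P.cc i i j (R *\<^sub>R w) = dg j i i (p + R *\<^sub>R w)" for i j
        unfolding P.cc_def Pdg using dg_sym_outside[OF w, of i j i] by simp
      show ?thesis
        unfolding P.H_lin_def P.A1_lin_def P.B1_lin_def H_lin_at_def cc Ph Pdg \<omega>[OF that]
        using that R(2) by (simp add: sum_distrib_left sum_divide_distrib sum_negf mult_ac add_divide_distrib diff_divide_distrib)
    qed
    have pt: "R * w $ l * (mean_curv (\<lambda>y. g (p + y)) 0 (R *\<^sub>R w) - 2 / R) = R * E (R *\<^sub>R w) + R * w $ l * H_lin_at p R w"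
      if "norm w = 1" for w
    proof -
      have n: "norm (R *\<^sub>R w) = R" using that R(2) by simp
      show ?thesis
        unfolding E_def \<omega>[OF that] Hl[OF that] n
        by (simp only: right_diff_distrib mult.assoc diff_add_cancel)
    qed
    have Hc: "continuous_on (sphere 0 1) (H_lin_at p R)"
      unfolding H_lin_at_def using R(2) by (intro continuous_intros sphere_continuous[OF R(1)]) auto
    have "sphere_integral p R (\<lambda>x. (x $ l - p $ l) * (mean_curv g p x - 2 / R))
        = R\<^sup>2 * usphere (\<lambda>w. R * E (R *\<^sub>R w) + R * w $ l * H_lin_at p R w)"
      unfolding sphere_integral_usphere using pt by (intro arg_cong2[of _ _ _ _ "(*)"] refl usphere_cong) (simp add: mean_curv_shift)
    also have "usphere (\<lambda>w. R * E (R *\<^sub>R w) + R * w $ l * H_lin_at p R w)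
        = R * usphere (\<lambda>w. E (R *\<^sub>R w)) + usphere (\<lambda>w. R * w $ l * H_lin_at p R w)"
      unfolding usphere_cmult[of R "\<lambda>w. E (R *\<^sub>R w)", symmetric]
      by (intro usphere_add continuous_intros elim Hc)
    also have "R\<^sup>2 * (R * usphere (\<lambda>w. E (R *\<^sub>R w)) + usphere (\<lambda>w. R * w $ l * H_lin_at p R w))
        = R ^ 3 * usphere (\<lambda>w. E (R *\<^sub>R w)) + R\<^sup>2 * usphere (\<lambda>w. R * w $ l * H_lin_at p R w)"
      by (simp add: distrib_left power2_eq_square power3_eq_cube)
    finally show ?case
      unfolding usphere_H_lin[OF R] by (simp flip: add_divide_distrib)
  qed
  have "(\<lambda>R. R ^ 3 * usphere (\<lambda>w. E (R *\<^sub>R w))) \<in> O[at_top](\<lambda>R. R ^ 3 * R powr (- (2 * q + 1) - 1))"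
    by (intro landau_o.big.mult_left usphere_odd_decay E)
  also have "(\<lambda>R::real. R ^ 3 * R powr (- (2 * q + 1) - 1)) \<in> O[at_top](\<lambda>R. R powr (1 - 2 * q))"
    by (intro bigoI[of _ 1] eventually_mono[OF eventually_gt_at_top[of 0]])
       (auto simp: powr_add[symmetric] simp flip: powr_numeral)
  finally show ?thesis using landau_o.big.in_cong[OF ev] by blast
qed

section \<open>Mass and centre as limits of fluxes\<close>

lemma mass_flux: "r > 0 \<Longrightarrow> sphere_integral 0 r (mass_density g r) = flux Y 0 r"
proof -
  assume r: "r > 0"
  have "mass_density g r (r *\<^sub>R w) = (\<Sum>j\<in>UNIV. Y j (r *\<^sub>R w) * w $ j)" for w
    using r unfolding mass_density_def Y_def dg_def sum_distrib_right
    by (subst sum.swap) simp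
  then show ?thesis by (simp add: sphere_integral_usphere flux_def)
qed

text \<open>The definition uses g where X uses h. The Euclidean part contributes w_l - 3 w_l = -2
  w_l to the subtracted density, and this integrates to zero.\<close>

lemma center_flux:
  assumes r: "K < r"
  shows "sphere_integral 0 r (\<lambda>x. x $ l * mass_density g r x)
       - sphere_integral 0 r (\<lambda>x. \<Sum>i\<in>UNIV. g x $ i $ l * (x $ i / r) - g x $ i $ i * (x $ l / r)) = flux (X l) 0 r"
proof -
  have r0: "r > 0" and r': "K + norm (0::real^3) < r" using r K_pos by auto
  note c = sphere_continuous[OF r', simplified]
  define FY where "FY w = (\<Sum>j\<in>UNIV. Y j (r *\<^sub>R w) * w $ j)" for w
  define P where "P w = (\<Sum>j\<in>UNIV. h j l (r *\<^sub>R w) * w $ j) - w $ l * (\<Sum>i\<in>UNIV. h i i (r *\<^sub>R w))" for w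
  have 1: "mass_density g r (r *\<^sub>R w) = FY w" for w
    using r0 unfolding mass_density_def FY_def Y_def dg_def sum_distrib_right
    by (subst sum.swap) simp
  have g: "g x $ i $ j = h i j x + mat 1 $ i $ j" for i j x by (simp add: h_def)
  have 2: "(\<Sum>i\<in>UNIV. g (r *\<^sub>R w) $ i $ l * ((r *\<^sub>R w) $ i / r) - g (r *\<^sub>R w) $ i $ i * ((r *\<^sub>R w) $ l / r)) = P w - 2 * w $ l" for w
  proof -
    have "(\<Sum>i\<in>UNIV. g (r *\<^sub>R w) $ i $ l * ((r *\<^sub>R w) $ i / r) - g (r *\<^sub>R w) $ i $ i * ((r *\<^sub>R w) $ l / r))
        = P w + (\<Sum>i\<in>UNIV. w $ i * mat 1 $ i $ l) - w $ l * (\<Sum>i\<in>UNIV. (mat 1 :: real^3^3) $ i $ i)"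
      unfolding P_def sum_distrib_left g sum_subtractf[symmetric] sum.distrib[symmetric] using r0
      by (intro sum.cong refl) (simp add: algebra_simps)
    also have "(\<Sum>i\<in>UNIV. (mat 1 :: real^3^3) $ i $ i) = 3" by (simp add: mat_def)
    finally show ?thesis by simp
  qed
  have Pc: "continuous_on (sphere 0 1) P" and Yc: "continuous_on (sphere 0 1) FY"
    unfolding P_def FY_def by (intro continuous_intros c)+
  have "usphere (\<lambda>w. P w - 2 * w $ l) = usphere P - 2 * usphere (\<lambda>w. w $ l)"
    unfolding usphere_cmult[symmetric] by (intro usphere_diff continuous_intros Pc)
  then have "usphere (\<lambda>w. P w - 2 * w $ l) = usphere P" by (simp add: usphere_coord)
  moreover have "(\<Sum>j\<in>UNIV. X l j (0 + r *\<^sub>R w) * w $ j) = r * w $ l * FY w - P w" for w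
    unfolding flux_X_integrand by (simp add: FY_def P_def)
  moreover have "usphere (\<lambda>w. r * w $ l * FY w - P w) = usphere (\<lambda>w. r * w $ l * FY w) - usphere P"
    by (intro usphere_diff continuous_intros Pc Yc)
  ultimately show ?thesis
    unfolding sphere_integral_usphere flux_def by (simp add: 1 2[simplified] right_diff_distrib)
qed

theorem mean_curv_moment:
  assumes q: "q > 1 / 2" and m: "mass g \<noteq> 0"
  shows "(\<lambda>R. sphere_integral p R (\<lambda>x. (x $ l - p $ l) * (mean_curv g p x - 2 / R))
            - 8 * pi * mass g * (p $ l - center_of_mass g $ l)) \<in> O[at_top](\<lambda>R. R powr (1 - 2 * q))"
proof -
  obtain LY where LY: "\<And>p. (\<lambda>R. flux Y p R - LY) \<in> O[at_top](\<lambda>R. R powr (1 - 2 * q))"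
    using flux_limit[OF c1_Y par_divg_Y q] by blast
  obtain LX where LX: "\<And>p. (\<lambda>R. flux (X l) p R - LX) \<in> O[at_top](\<lambda>R. R powr (1 - 2 * q))"
    using flux_limit[OF c1_X par_divg_X q] by blast
  have "Lim at_top (\<lambda>r. sphere_integral 0 r (mass_density g r)) = LY"
    using LY[of 0] q by (intro Lim_of_rate[where F = "flux Y 0" and s = "2 * q - 1"])
      (auto simp: mass_flux intro: eventually_mono[OF eventually_gt_at_top[of 0]])
  then have mass: "16 * pi * mass g = LY" by (simp add: mass_def)
  have "\<forall>\<^sub>F r in at_top. sphere_integral 0 r (\<lambda>x. x $ l * mass_density g r x)
       - sphere_integral 0 r (\<lambda>x. \<Sum>i\<in>UNIV. g x $ i $ l * (x $ i / r) - g x $ i $ i * (x $ l / r)) = flux (X l) 0 r"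
    by (rule eventually_mono[OF eventually_gt_at_top[of K]]) (rule center_flux)
  then have "Lim at_top (\<lambda>r. sphere_integral 0 r (\<lambda>x. x $ l * mass_density g r x)
       - sphere_integral 0 r (\<lambda>x. \<Sum>i\<in>UNIV. g x $ i $ l * (x $ i / r) - g x $ i $ i * (x $ l / r))) = LX"
    by (rule Lim_of_rate[where s = "2 * q - 1", rotated 2]) (use LX[of 0] q in auto)
  then have center: "16 * pi * mass g * center_of_mass g $ l = LX"
    using m by (simp add: center_of_mass_def)
  \<comment> \<open>Both limits carry the normalization 16 pi m, which the factor 1/2 of the moment
    identity reduces to 8 pi m.\<close>
  have eq: "8 * pi * mass g * (p $ l - center_of_mass g $ l) = (p $ l * LY - LX) / 2"
    unfolding mass[symmetric] center[symmetric] by (simp add: algebra_simps)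
  have "(\<lambda>R. (- 1 / 2) * (flux (X l) p R - LX)) \<in> O[at_top](\<lambda>R. R powr (1 - 2 * q))"
    using LX[of p] by (subst landau_o.big.cmult_in_iff) auto
  \<comment> \<open>The coefficient may vanish, where it cannot be cancelled inside the O-class;
    that case is treated separately.\<close>
  moreover have "(\<lambda>R. (p $ l / 2) * (flux Y p R - LY)) \<in> O[at_top](\<lambda>R. R powr (1 - 2 * q))"
    using LY[of p] by (cases "p $ l = 0") (auto simp del: times_divide_eq_left)
  ultimately have "(\<lambda>R. ((- 1 / 2) * (flux (X l) p R - LX) + (p $ l / 2) * (flux Y p R - LY))
      + (sphere_integral p R (\<lambda>x. (x $ l - p $ l) * (mean_curv g p x - 2 / R))
      + (flux (X l) p R - p $ l * flux Y p R) / 2)) \<in> O[at_top](\<lambda>R. R powr (1 - 2 * q))"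
    by (intro sum_in_bigo(1) mean_curv_integral)
  moreover have "((- 1 / 2) * (F - LX) + (p $ l / 2) * (F' - LY)) + (I + (F - p $ l * F') / 2)
      = I - (p $ l * LY - LX) / 2" for F F' I :: real
    by (simp add: field_simps)
  ultimately show ?thesis unfolding eq by (simp only:)
qed

end

section \<open>Passage from the manifold to the asymptotic hypotheses\<close>

theorem lemma3p2:
  fixes M :: "'a topology" and A :: "'a chart set"
    and g :: "'a chart \<Rightarrow> real^3 \<Rightarrow> real^3^3"
    and c :: "'a chart" and R\<^sub>0 q :: real and p :: "real^3" and l :: 3
  assumes "riemannian_3manifold M A g"
    and "exterior_chart M A c R\<^sub>0"
    and "q > 1/2"
    and "asymptotically_flat (g c) q"
    and "regge_teitelboim (g c) q"
    and "mass (g c) \<noteq> 0"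
  shows "(\<lambda>R. sphere_integral p R (\<lambda>x. (x $ l - p $ l) * (mean_curv (g c) p x - 2 / R))
            - 8 * pi * mass (g c) * (p $ l - center_of_mass (g c) $ l))
         \<in> O[at_top](\<lambda>R. R powr (1 - 2 * q))"
proof -
  let ?h = "\<lambda>i j x. g c x $ i $ j - mat 1 $ i $ j"
  have R0: "R\<^sub>0 > 0" and cA: "c \<in> A" and img: "snd c ` fst c = {x. norm x > R\<^sub>0}"
    using assms(2) by (auto simp: exterior_chart_def)
  have op: "open {x::real^3. norm x > R\<^sub>0}" by (intro open_Collect_less continuous_intros)
  have sm_g: "pdiffs \<alpha> (\<lambda>x. g c x $ i $ j) differentiable (at x)" if "R\<^sub>0 < norm x" for \<alpha> i j x
  proof -
    have "smooth_fun_on {x. norm x > R\<^sub>0} (\<lambda>x. g c x $ i $ j)"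
      using assms(1) cA img unfolding riemannian_3manifold_def by metis
    then have "pdiffs \<alpha> (\<lambda>x. g c x $ i $ j) differentiable_on {x. norm x > R\<^sub>0}"
      unfolding smooth_fun_on_def by blast
    then show ?thesis using that op by (simp add: differentiable_on_eq_differentiable_at)
  qed
  have sm: "pdiffs \<alpha> (?h i j) differentiable (at x)" if "R\<^sub>0 < norm x" for \<alpha> i j x
  proof (cases "\<alpha> = []")
    case True
    then show ?thesis using sm_g[OF that, of "[]"] by simp
  next
    case False
    then show ?thesis using sm_g[OF that] by (simp add: pdiffs_diff_const)
  qed
  have symm: "transpose (g c x) = g c x" if "R\<^sub>0 < norm x" for x
    using assms(1) cA img that unfolding riemannian_3manifold_def by blast
  have parity_decay: "parity_decay ((- 1) ^ length \<alpha>) (q + real (length \<alpha>)) (pdiffs \<alpha> (?h i j))" for \<alpha> i j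
  proof (rule par_pdiffs[OF sm])
    show "pdiffs \<alpha> (?h i j) \<in> O[at_infinity](\<lambda>x. norm x powr (- q - real (length \<alpha>)))"
      using assms(4) unfolding asymptotically_flat_def by blast
    \<comment> \<open>The Euclidean metric is constant, hence even, so g and h have the same odd
      part.\<close>
    have "odd_part (?h i j) = odd_part (\<lambda>x. g c x $ i $ j)" by (simp add: odd_part_def fun_eq_iff)
    then show "pdiffs \<alpha> (odd_part (?h i j)) \<in> O[at_infinity](\<lambda>x. norm x powr (- 1 - q - real (length \<alpha>)))"
      using assms(5) unfolding regge_teitelboim_def by simp
  qed
  have p0: "parity_decay 1 q (?h i j)" and p1: "parity_decay (- 1) (q + 1) (pdiff k (\<lambda>x. g c x $ i $ j))"
    and p2: "parity_decay 1 (q + 2) (pdiff m (pdiff k (\<lambda>x. g c x $ i $ j)))" for i j k m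
    using parity_decay[of "[]" i j] parity_decay[of "[k]" i j] parity_decay[of "[m, k]" i j]
    by (simp_all add: pdiff_diff_const power2_eq_square)
  have ev: "\<forall>\<^sub>F x::real^3 in at_infinity. R\<^sub>0 < norm x"
    by (rule eventually_at_infinityI[of "R\<^sub>0 + 1"]) simp
  have d0: "(\<lambda>x. g c x $ i $ j) differentiable (at x)"
    and d1: "pdiff k (\<lambda>x. g c x $ i $ j) differentiable (at x)"
    and d2: "pdiff m (pdiff k (\<lambda>x. g c x $ i $ j)) differentiable (at x)" if "R\<^sub>0 < norm x" for i j k m x
    using sm_g[OF that, of "[]"] sm_g[OF that, of "[k]"] sm_g[OF that, of "[m, k]"] by simp_all
  interpret decaying_metric_C2 "g c" q
  proof
    show "q > 0" using assms(3) by simp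
    show "\<forall>\<^sub>F x in at_infinity. transpose (g c x) = g c x" using ev by eventually_elim (rule symm)
    show "\<forall>\<^sub>F x in at_infinity. \<forall>i j. (\<lambda>x. g c x $ i $ j) differentiable (at x)"
      using ev by eventually_elim (use d0 in blast)
    show "\<forall>\<^sub>F x in at_infinity. \<forall>k i j. pdiff k (\<lambda>x. g c x $ i $ j) differentiable (at x)"
      using ev by eventually_elim (use d1 in blast)
  qed (rule p0 p1 p2)+
  interpret exterior_metric "g c" q R\<^sub>0
  proof (intro exterior_metric.intro exterior_metric_axioms.intro)
    show "decaying_metric_C2 (g c) q" by (rule decaying_metric_C2_axioms)
    show "R\<^sub>0 > 0" by (rule R0)
    show "h i j x = h j i x" if "R\<^sub>0 < norm x" for i j x
      using transpose_eq_nth[OF symm[OF that], of i j] by (simp add: h_def mat_def)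
    show "c1_outside R\<^sub>0 (h i j)" for i j
      unfolding c1_outside_def
      using sm[of _ "[]" i j] sm[of _ "[_]" i j] by (auto simp: h_def[abs_def] intro: differentiable_imp_continuous_within)
    show "c1_outside R\<^sub>0 (dg k i j)" for k i j
      unfolding c1_outside_def dg_def[abs_def]
      using d1 d2 by (auto intro: differentiable_imp_continuous_within)
    \<comment> \<open>Second derivatives alone give \<open>D\<close> the order q + 2. Subtracting
      the linearization error from the assumptions on the scalar curvature raises it to 2q + 2 with
      even parity; continuity is read off from the second derivatives.\<close>
    show "parity_decay 1 (2 * q + 2) D"
      unfolding parity_decay_def
    proof (intro conjI)
      note L = scalar_curv_linearization
      have "parity_decay 1 (q + 2) D" unfolding D_def[abs_def] by (intro par_sum par_diff par_ddg)
      then show "\<forall>\<^sub>F x in at_infinity. isCont D x" by (rule par_cont)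
      have "scalar_curv (g c) \<in> O[at_infinity](\<lambda>x. norm x powr (- (2 * q + 2)))"
        using assms(4) unfolding asymptotically_flat_def by (simp add: algebra_simps)
      from sum_in_bigo(2)[OF this par_bigo[OF L]]
      show "D \<in> O[at_infinity](\<lambda>x. norm x powr (- (2 * q + 2)))" by simp
      have "odd_part (scalar_curv (g c)) \<in> O[at_infinity](\<lambda>x. norm x powr (- (2 * q + 2) - 1))"
        using assms(5) unfolding regge_teitelboim_def by (simp add: algebra_simps)
      then have "(\<lambda>x. 2 * odd_part (scalar_curv (g c)) x) \<in> O[at_infinity](\<lambda>x. norm x powr (- (2 * q + 2) - 1))"
        by simp
      moreover have "2 * odd_part (scalar_curv (g c)) x = scalar_curv (g c) x - scalar_curv (g c) (- x)" for x
        by (simp add: odd_part_def)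
      ultimately have "(\<lambda>x. scalar_curv (g c) x - scalar_curv (g c) (- x))
          \<in> O[at_infinity](\<lambda>x. norm x powr (- (2 * q + 2) - 1))"
        by (simp only:)
      from sum_in_bigo(2)[OF this par_parity[OF L]]
      show "(\<lambda>x. D x - 1 * D (- x)) \<in> O[at_infinity](\<lambda>x. norm x powr (- (2 * q + 2) - 1))"
        by (simp add: algebra_simps)
    qed
    \<comment> \<open>Each level uses the next one: translating h relies on the decay of first
      derivatives, translating these on the decay of second derivatives.\<close>
    show "decaying_metric (\<lambda>y. g c (p + y)) q" for p
    proof
      have sh: "\<forall>\<^sub>F x in at_infinity. R\<^sub>0 < norm (p + x)"
        using ev filterlim_shift_at_infinity unfolding filterlim_iff by blast
      show "q > 0" by (rule q_pos)
      show "\<forall>\<^sub>F x in at_infinity. transpose (g c (p + x)) = g c (p + x)"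
        using sh by eventually_elim (rule symm)
      show "\<forall>\<^sub>F x in at_infinity. \<forall>i j. (\<lambda>x. g c (p + x) $ i $ j) differentiable (at x)"
        using sh
      proof eventually_elim
        case (elim x)
        have "((\<lambda>y. g c y $ i $ j) \<circ> (\<lambda>y. p + y)) differentiable (at x)" for i j
          by (rule differentiable_chain_at) (auto intro: d0 elim)
        then show ?case by (simp add: o_def)
      qed
      show "parity_decay 1 q (\<lambda>x. g c (p + x) $ i $ j - mat 1 $ i $ j)" for i j
      proof (rule par_shift[OF p0])
        show "\<forall>\<^sub>F x in at_infinity. ?h i j differentiable (at x)"
          using ev by eventually_elim (use sm[of _ "[]"] in simp)
        show "pdiff k (?h i j) \<in> O[at_infinity](\<lambda>x. norm x powr (- q - 1))" for k
          using par_bigo[OF p1, of k i j] by (simp add: pdiff_diff_const)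
      qed (use q_pos in simp)
      have "parity_decay (- 1) (q + 1) (\<lambda>x. pdiff k (\<lambda>x. g c x $ i $ j) (p + x))" for k i j
      proof (rule par_shift[OF p1])
        show "\<forall>\<^sub>F x in at_infinity. pdiff k (\<lambda>x. g c x $ i $ j) differentiable (at x)"
          using ev by eventually_elim (rule d1)
        show "pdiff m (pdiff k (\<lambda>x. g c x $ i $ j)) \<in> O[at_infinity](\<lambda>x. norm x powr (- (q + 1) - 1))" for m
          using par_bigo[OF p2, of m k i j] by (simp add: algebra_simps)
      qed (use q_pos in simp)
      then show "parity_decay (- 1) (q + 1) (pdiff k (\<lambda>x. g c (p + x) $ i $ j))" for k i j
        unfolding pdiff_shift[of k "\<lambda>x. g c x $ i $ j"] .
    qed
  qed
  show ?thesis by (rule mean_curv_moment[OF assms(3,6)])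
qed

end
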